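(* Let $(\zeta_j)_{j\in\mathbb Z}$ be i.i.d. positive random variables with finite mean $\mu$, let $\omega_0:=0$, $\omega_k:=\omega_{k-1}+\zeta_k$ for $k\in\mathbb Z$, and let $P$ be the law of the environment $\omega=(\omega_k)_{k\in\mathbb Z}$. Let $(\xi_i)_{i\ge1}$ be i.i.d. $\mathbb Z$-valued random variables with density $(p_k)_{k\in\mathbb Z}$ satisfying $p_k=p_{-k}$, $p_{k+1}\le p_k$ for all $k\ge0$, and $v_p:=\sum_k k^2p_k\in(0,\infty)$; let $S_0:=0$, $S_n:=\sum_{i=1}^n\xi_i$, with law $Q$. For fixed $\omega$ define $Y_n:=\omega_{S_n}$, $\tau(0):=0$, $\tau(n):=\sum_{k=1}^n|\omega_{S_k}-\omega_{S_{k-1}}|$, and the continuous-time process $X(t):=Y_n+\mathrm{sgn}(\xi_{n+1})(t-\tau(n))$ for $t\in[\tau(n),\tau(n+1))$. Let $P_\omega$ be the law of $(X(t))_{t\ge0}$ induced by $Q$ (the quenched law). Set $\bar m:=\sum_{k\in\mathbb Z}|k|p_k$ and $m_2:=\lim_{n\to\infty}E_Q(S_n^2)/n$. Then for $P$-a.e. $\omega$, $$\frac{X(t)}{\sqrt t}\xrightarrow[t\to\infty]{d}\mathcal N\!\left(0,\frac{\mu}{\bar m}m_2\right)$$ with convergence in distribution relative to $P_\omega$.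
   Context: $\mathrm{sgn}$ is the sign function (its value at $0$ is irrelevant). $\mathcal N(0,\sigma^2)$ denotes the centered normal law with variance $\sigma^2$; $E_Q$ is expectation with respect to $Q$ (note $m_2=v_p$). The process $X$ is viewed on the space of continuous paths $C([0,\infty);\mathbb R)$. *)

theory Defs
  imports "HOL-Probability.Probability"
begin

text \<open>Environment: \<open>\<omega>_0 = 0\<close>, \<open>\<omega>_k = \<omega>_{k-1} + \<zeta>_k\<close> for all integers k.\<close>
definition env :: "(int \<Rightarrow> real) \<Rightarrow> int \<Rightarrow> real" where
  "env \<zeta> k = (if 0 \<le> k then (\<Sum>j\<in>{1..k}. \<zeta> j) else - (\<Sum>j\<in>{k+1..0}. \<zeta> j))"

text \<open>Steps: \<open>xs i\<close> plays the role of \<open>\<xi>_{i+1}\<close>; \<open>S_n = \<xi>_1 + ... + \<xi>_n\<close>.\<close>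
definition walkS :: "(nat \<Rightarrow> int) \<Rightarrow> nat \<Rightarrow> int" where
  "walkS xs n = (\<Sum>i<n. xs i)"

definition tau :: "(int \<Rightarrow> real) \<Rightarrow> (nat \<Rightarrow> int) \<Rightarrow> nat \<Rightarrow> real" where
  "tau \<omega> xs n = (\<Sum>k\<in>{1..n}. \<bar>\<omega> (walkS xs k) - \<omega> (walkS xs (k - 1))\<bar>)"

text \<open>\<open>X(t) = Y_n + sgn(\<xi>_{n+1}) (t - \<tau>(n))\<close> for \<open>t \<in> [\<tau>(n), \<tau>(n+1))\<close>; since \<open>\<tau>\<close> is
  nondecreasing with \<open>\<tau>(0) = 0\<close>, for \<open>t \<ge> 0\<close> this n is the least n with \<open>t < \<tau>(n+1)\<close>.\<close>
definition procX :: "(int \<Rightarrow> real) \<Rightarrow> (nat \<Rightarrow> int) \<Rightarrow> real \<Rightarrow> real" where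
  "procX \<omega> xs t =
     (let n = (LEAST n. t < tau \<omega> xs (Suc n))
      in \<omega> (walkS xs n) + sgn (real_of_int (xs n)) * (t - tau \<omega> xs n))"

definition walk_law :: "int pmf \<Rightarrow> (nat \<Rightarrow> int) measure" where
  "walk_law p = (\<Pi>\<^sub>M i\<in>(UNIV::nat set). measure_pmf p)"

definition m2 :: "int pmf \<Rightarrow> real" where
  "m2 p = lim (\<lambda>n. (\<integral>xs. (real_of_int (walkS xs n))\<^sup>2 \<partial>walk_law p) / real n)"

definition mbar :: "int pmf \<Rightarrow> real" where
  "mbar p = (\<Sum>\<^sub>\<infinity>k. \<bar>real_of_int k\<bar> * pmf p k)"

definition vp :: "int pmf \<Rightarrow> real" where
  "vp p = (\<Sum>\<^sub>\<infinity>k. (real_of_int k)\<^sup>2 * pmf p k)"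

end

theory Submission
  imports Defs
begin

text \<open>Fix the environment. If \<open>\<tau>(n) / n \<rightarrow> \<mu> \<cdot> mbar\<close> in probability under the law of the walk, then
  the number of steps made by time \<open>t\<close> is close to \<open>t / (\<mu> \<cdot> mbar)\<close>; since \<open>\<omega>\<^sub>k = \<mu> k + o(k)\<close> by the
  strong law, \<open>X(t)\<close> is close to \<open>\<mu>\<close> times the position of the walk at that deterministic time
  (Kolmogorov's maximal inequality controls the random time change), and the central limit
  theorem for \<open>S\<close> applies.

  The law of large numbers for \<open>\<tau>\<close> is where unimodality enters: the law of \<open>S\<^sub>m\<close> is again symmetric
  and unimodal, hence a mixture of uniform laws on centred intervals, so that the expectation of
  a function of \<open>j + S\<^sub>m\<close> is a mixture of its window averages around \<open>j\<close>, which the strong law for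
  the environment controls. This yields the decay of correlations needed for an \<open>L\<^sup>2\<close> estimate
  when the gaps \<open>\<zeta>\<^sub>j\<close> are bounded. Unbounded gaps are truncated at \<open>M\<close>; the remainder is
  nonnegative and has small expectation, so Markov's inequality suffices.\<close>

section \<open>The strong law of large numbers for product measures\<close>

text \<open>Past \<open>AE_has_window_mean\<close> the environment is fixed and enters only through
  the sign of its gaps and through \<open>has_window_mean\<close>, for the gaps and for their
  truncations at natural levels. These are countably many conditions, so one null set serves all
  sequences of times. The obstacle is that the gaps have only a first moment: second moments of the
  jumps then have no bound uniform in the position of the walk, and a variance argument is available
  only after truncation. During \<open>m\<close> further steps the walk spreads over a distance of
  order sqrt(m), but it may start at distance of order sqrt(n) from the origin. Averaging the
  environment over such an off-centre window costs a relative error of order \<eta> sqrt(n/m),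
  useless for small \<open>m\<close>; yet the sum of sqrt(n/m) over m < n is O(n), which is just
  what a second moment divided by n^2 tolerates. Hence the window error is measured by |a| + |b| and
  not by the length of the window. The random clock depends on the walk itself. It is never
  decoupled from it, only enclosed between deterministic step counts, for which convergence in
  probability is enough.\<close>

lemma distr_PiM_reindex_UNIV:
  fixes f :: "'i \<Rightarrow> 'j"
  assumes "prob_space D" "inj f"
  shows "distr (\<Pi>\<^sub>M j\<in>(UNIV::'j set). D) (\<Pi>\<^sub>M i\<in>(UNIV::'i set). D) (\<lambda>x i. x (f i))
    = (\<Pi>\<^sub>M i\<in>(UNIV::'i set). D)"
  using distr_PiM_reindex[of UNIV "\<lambda>_. D" f UNIV] assms by (simp add: restrict_UNIV)

lemma indep_vars_PiM_coordinates:
  assumes "prob_space D"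
  shows "prob_space.indep_vars (\<Pi>\<^sub>M i\<in>(UNIV::'i set). D) (\<lambda>_. D) (\<lambda>i x. x i) (UNIV :: 'i set)"
proof -
  interpret P: prob_space "\<Pi>\<^sub>M i\<in>(UNIV::'i set). D"
    by (intro prob_space_PiM assms)
  have "distr (\<Pi>\<^sub>M i\<in>(UNIV::'i set). D) D (\<lambda>x. x i) = D" for i
    by (rule distr_PiM_component) (auto intro: assms)
  then show ?thesis
    by (subst P.indep_vars_iff_distr_eq_PiM') (auto simp: distr_id restrict_UNIV)
qed

lemma distr_PiM_coordinate:
  assumes "prob_space D" "f \<in> measurable D N"
  shows "distr (\<Pi>\<^sub>M i\<in>(UNIV::'i set). D) N (\<lambda>x. f (x j)) = distr D N f"
proof -
  have "distr (\<Pi>\<^sub>M i\<in>(UNIV::'i set). D) D (\<lambda>x. x j) = D"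
    by (rule distr_PiM_component) (auto intro: assms)
  then have "distr D N f = distr (distr (\<Pi>\<^sub>M i\<in>(UNIV::'i set). D) D (\<lambda>x. x j)) N f"
    by simp
  also have "\<dots> = distr (\<Pi>\<^sub>M i\<in>(UNIV::'i set). D) N (\<lambda>x. f (x j))"
    by (subst distr_distr) (auto simp: assms comp_def)
  finally show ?thesis by simp
qed

lemma
  fixes f :: "'a \<Rightarrow> real"
  assumes "prob_space D" and [measurable]: "f \<in> borel_measurable D"
  shows integral_PiM_coordinate:
      "(\<integral>x. f (x j) \<partial>(\<Pi>\<^sub>M i\<in>(UNIV::'i set). D)) = (\<integral>x. f x \<partial>D)"
    and integrable_PiM_coordinate:
      "integrable (\<Pi>\<^sub>M i\<in>(UNIV::'i set). D) (\<lambda>x. f (x j)) \<longleftrightarrow> integrable D f"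
proof -
  have D: "distr (\<Pi>\<^sub>M i\<in>(UNIV::'i set). D) D (\<lambda>x. x j) = D"
    by (rule distr_PiM_component) (auto intro: assms)
  show "(\<integral>x. f (x j) \<partial>(\<Pi>\<^sub>M i\<in>(UNIV::'i set). D)) = (\<integral>x. f x \<partial>D)"
    by (subst (2) D[symmetric], subst integral_distr) auto
  show "integrable (\<Pi>\<^sub>M i\<in>(UNIV::'i set). D) (\<lambda>x. f (x j)) \<longleftrightarrow> integrable D f"
    by (subst (2) D[symmetric], subst integrable_distr_eq) auto
qed

text \<open>Hoeffding's inequality makes the deviation probabilities geometrically small in
  \<open>n\<close>, so Borel-Cantelli applies directly, without passing to a subsequence.\<close>

lemma strong_law_bounded:
  fixes f :: "'a \<Rightarrow> real"
  assumes D: "prob_space D" and [measurable]: "f \<in> borel_measurable D"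
    and B: "\<And>x. \<bar>f x\<bar> \<le> B"
  shows "AE x in (\<Pi>\<^sub>M i\<in>(UNIV::nat set). D).
    (\<lambda>n. (\<Sum>i<n. f (x i)) / real n) \<longlonglongrightarrow> (\<integral>x. f x \<partial>D)"
proof -
  let ?P = "\<Pi>\<^sub>M i\<in>(UNIV::nat set). D"
  interpret P: prob_space ?P by (intro prob_space_PiM D)
  \<comment> \<open>The added 1 keeps the range \<open>{-b..b}\<close> nondegenerate even for
    \<open>f = 0\<close>, as Hoeffding's exponent divides by the square of its length.\<close>
  define b where "b = \<bar>B\<bar> + 1"
  have b: "\<bar>f x\<bar> \<le> b" "b > 0" for x using B[of x] by (auto simp: b_def)
  let ?\<mu> = "\<integral>x. f x \<partial>D"
  have Emu: "P.expectation (\<lambda>x. f (x 0)) = ?\<mu>"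
    by (rule integral_PiM_coordinate) (auto simp: D)
  let ?A = "\<lambda>\<epsilon> n. {x \<in> space ?P. \<bar>(\<Sum>i<n. f (x i)) / real n - ?\<mu>\<bar> \<ge> \<epsilon>}"
  have main: "AE x in ?P. eventually (\<lambda>n. x \<in> space ?P - ?A \<epsilon> n) sequentially"
    if e: "\<epsilon> > 0" for \<epsilon>
  proof (rule borel_cantelli_AE1)
    define c where "c = 2 * \<epsilon>\<^sup>2 / (b - (-b))\<^sup>2"
    have c: "c > 0" using e b by (auto simp: c_def intro!: divide_pos_pos)
    have le: "P.prob (?A \<epsilon> n) \<le> 2 * exp (-c) ^ n" if "n > 0" for n
    proof -
      interpret H: Hoeffding_ineq_iid ?P "{..<n}" "\<lambda>i x. f (x i)" "\<lambda>x. f (x 0)" "-b" b ?\<mu>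
      proof unfold_locales
        have "P.indep_vars (\<lambda>_. borel) (\<lambda>i x. f (x i)) (UNIV :: nat set)"
          by (rule P.indep_vars_compose2[OF indep_vars_PiM_coordinates[OF D]]) auto
        then show "P.indep_vars (\<lambda>_. borel) (\<lambda>i x. f (x i)) {..<n}"
          by (rule P.indep_vars_subset) auto
        show "distr ?P borel (\<lambda>x. f (x i)) = distr ?P borel (\<lambda>x. f (x 0))" for i
          by (simp add: distr_PiM_coordinate D)
        show "AE x in ?P. f (x 0) \<in> {- b..b}"
          using b by (auto simp: abs_le_iff minus_le_iff)
        show "?\<mu> \<equiv> P.expectation (\<lambda>x. f (x 0))" by (simp add: Emu)
      qed auto
      have "P.prob (?A \<epsilon> n) \<le> 2 * exp (-2 * n * \<epsilon>\<^sup>2 / (b - (-b))\<^sup>2)"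
        using H.Hoeffding_ineq_abs_ge'[of \<epsilon>] e b that by (simp add: lessThan_empty_iff)
      also have "-2 * n * \<epsilon>\<^sup>2 / (b - (-b))\<^sup>2 = real n * (-c)"
        by (simp add: c_def)
      also have "exp (real n * (-c)) = exp (-c) ^ n"
        by (rule exp_of_nat_mult)
      finally show ?thesis .
    qed
    have "summable (\<lambda>n. 2 * exp (-c) ^ n)"
      using c by (intro summable_mult summable_geometric) auto
    then show "summable (\<lambda>n. P.prob (?A \<epsilon> n))"
      by (rule summable_comparison_test'[where N=1]) (use le in auto)
  qed (auto simp: P.emeasure_finite less_top[symmetric])
  have "AE x in ?P. \<forall>k. eventually (\<lambda>n. x \<in> space ?P - ?A (1 / real (Suc k)) n) sequentially"
    by (subst AE_all_countable, intro allI main) simp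
  then show ?thesis
  proof eventually_elim
    case (elim x)
    show ?case
    proof (rule tendstoI)
      fix e :: real assume "e > 0"
      then obtain k where k: "1 / real (Suc k) < e"
        using reals_Archimedean[of e] by (auto simp: inverse_eq_divide)
      show "\<forall>\<^sub>F n in sequentially. dist ((\<Sum>i<n. f (x i)) / real n) ?\<mu> < e"
        using elim[rule_format, of k]
        by eventually_elim (use k in \<open>auto simp: dist_real_def\<close>)
    qed
  qed
qed

text \<open>The running maximum of the partial sums, written as a recursion along the shift: this is
  the form in which Garsia's proof of the maximal ergodic lemma uses it.\<close>

primrec garsia_max :: "('a \<Rightarrow> real) \<Rightarrow> nat \<Rightarrow> (nat \<Rightarrow> 'a) \<Rightarrow> real" where
  "garsia_max f 0 x = 0"
| "garsia_max f (Suc n) x = max 0 (f (x 0) + garsia_max f n (\<lambda>i. x (Suc i)))"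

lemma garsia_max_nonneg: "0 \<le> garsia_max f n x"
  by (cases n) auto

lemma garsia_max_mono: "garsia_max f n x \<le> garsia_max f (Suc n) x"
proof (induction n arbitrary: x)
  case (Suc n)
  from Suc[of "\<lambda>i. x (Suc i)"] show ?case by simp
qed simp

lemma sum_le_garsia_max: "k \<le> n \<Longrightarrow> (\<Sum>i<k. f (x i)) \<le> garsia_max f n x"
proof (induction n arbitrary: k x)
  case (Suc n)
  show ?case
  proof (cases k)
    case (Suc k')
    with Suc.IH[of k' "\<lambda>i. x (Suc i)"] Suc.prems show ?thesis
      by (simp add: sum.lessThan_Suc_shift del: sum.lessThan_Suc)
  qed simp
qed simp

text \<open>Where the maximum is positive it equals \<open>f (x 0)\<close> plus the shorter maximum
  along the shifted sequence; elsewhere it is 0, which is at most that shifted maximum. Integrate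
  both cases together: the shift preserves the product measure, so the two maxima cancel up to a
  sign given by monotonicity in \<open>n\<close>.\<close>

lemma maximal_ergodic:
  fixes f :: "'a \<Rightarrow> real"
  assumes D: "prob_space D" and f: "integrable D f"
  shows "0 \<le> (\<integral>x. f (x 0) * indicator {x. 0 < garsia_max f n x} x \<partial>(\<Pi>\<^sub>M i\<in>(UNIV::nat set). D))"
proof -
  let ?P = "\<Pi>\<^sub>M i\<in>(UNIV::nat set). D"
  note [measurable] = borel_measurable_integrable[OF f]
  let ?shift = "\<lambda>x i. x (Suc i)"
  have shift_distr: "distr ?P ?P ?shift = ?P"
    by (rule distr_PiM_reindex_UNIV) (auto simp: D)
  have [measurable]: "?shift \<in> measurable ?P ?P"
    by (rule measurable_PiM_single') (auto simp: space_PiM)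
  have meas[measurable]: "garsia_max f n \<in> borel_measurable ?P" for n
  proof (induction n)
    case (Suc n)
    note [measurable] = Suc
    show ?case by simp
  qed simp
  have f0: "integrable ?P (\<lambda>x. f (x 0))"
    by (subst integrable_PiM_coordinate) (auto simp: D f)
  have int_shift: "integrable ?P (\<lambda>x. garsia_max f n (?shift x)) \<longleftrightarrow> integrable ?P (garsia_max f n)"
    and eq_shift: "(\<integral>x. garsia_max f n (?shift x) \<partial>?P) = (\<integral>x. garsia_max f n x \<partial>?P)" for n
  proof -
    show "integrable ?P (\<lambda>x. garsia_max f n (?shift x)) \<longleftrightarrow> integrable ?P (garsia_max f n)"
      by (subst (2) shift_distr[symmetric], subst integrable_distr_eq) auto
    show "(\<integral>x. garsia_max f n (?shift x) \<partial>?P) = (\<integral>x. garsia_max f n x \<partial>?P)"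
      by (subst (2) shift_distr[symmetric], subst integral_distr) auto
  qed
  have int: "integrable ?P (garsia_max f n)" for n
  proof (induction n)
    case (Suc n)
    have "integrable ?P (\<lambda>x. f (x 0) + garsia_max f n (?shift x))"
      by (intro Bochner_Integration.integrable_add f0) (simp add: int_shift Suc)
    then show ?case by (simp add: integrable_max)
  qed simp
  show ?thesis
  proof (cases n)
    case (Suc m)
    let ?A = "{x. 0 < garsia_max f n x}"
    have i1: "integrable ?P (\<lambda>x. f (x 0) * indicator ?A x)"
      by (rule Bochner_Integration.integrable_bound[OF f0]) (auto simp: indicator_def)
    have "(\<integral>x. garsia_max f m x \<partial>?P) \<le> (\<integral>x. garsia_max f n x \<partial>?P)"
      unfolding Suc by (intro integral_mono int garsia_max_mono)
    also have "\<dots> \<le> (\<integral>x. f (x 0) * indicator ?A x + garsia_max f m (?shift x) \<partial>?P)"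
    proof (intro integral_mono int Bochner_Integration.integrable_add i1)
      show "integrable ?P (\<lambda>x. garsia_max f m (?shift x))" by (simp add: int_shift int)
      show "garsia_max f n x \<le> f (x 0) * indicator ?A x + garsia_max f m (?shift x)" for x
        using garsia_max_nonneg[of f m "?shift x"] by (auto simp: Suc indicator_def)
    qed
    also have "\<dots> = (\<integral>x. f (x 0) * indicator ?A x \<partial>?P) + (\<integral>x. garsia_max f m x \<partial>?P)"
      by (subst Bochner_Integration.integral_add[OF i1]) (simp_all add: int_shift int eq_shift)
    finally show ?thesis by simp
  qed simp
qed

text \<open>This is the maximal ergodic lemma for \<open>r - l\<close>: on the event that some
  average exceeds \<open>l\<close> the integral of \<open>r\<close> is at least \<open>l\<close>
  times the probability. Events with \<open>k\<close> bounded by \<open>n\<close> are treated first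
  and increase to the full event.\<close>

lemma weak_type_maximal_inequality:
  fixes r :: "'a \<Rightarrow> real"
  assumes D: "prob_space D" and r: "integrable D r" "\<And>x. 0 \<le> r x" and l: "0 < l"
  shows "measure (\<Pi>\<^sub>M i\<in>(UNIV::nat set). D)
      {x \<in> space (\<Pi>\<^sub>M i\<in>(UNIV::nat set). D). \<exists>k. (\<Sum>i<k. r (x i)) > l * real k} \<le> (\<integral>x. r x \<partial>D) / l"
proof -
  let ?P = "\<Pi>\<^sub>M i\<in>(UNIV::nat set). D"
  interpret D: prob_space D by fact
  interpret P: prob_space ?P by (intro prob_space_PiM D)
  note [measurable] = borel_measurable_integrable[OF r(1)]
  let ?A = "\<lambda>n. {x \<in> space ?P. \<exists>k\<le>n. (\<Sum>i<k. r (x i)) > l * real k}"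
  let ?f = "\<lambda>x. r x - l"
  let ?G = "\<lambda>n. {x. 0 < garsia_max ?f n x}"
  have f: "integrable D ?f" using r by auto
  have r0: "integrable ?P (\<lambda>x. r (x 0))"
    by (subst integrable_PiM_coordinate) (auto simp: D r)
  have meas[measurable]: "garsia_max ?f n \<in> borel_measurable ?P" for n
  proof (induction n)
    case (Suc n)
    have [measurable]: "(\<lambda>x i. x (Suc i)) \<in> measurable ?P ?P"
      by (rule measurable_PiM_single') (auto simp: space_PiM)
    note [measurable] = Suc
    show ?case by simp
  qed simp
  have le: "P.prob (?A n) \<le> (\<integral>x. r x \<partial>D) / l" for n
  proof -
    have sub: "?A n \<subseteq> ?G n \<inter> space ?P"
    proof safe
      fix x k assume k: "k \<le> n" "(\<Sum>i<k. r (x i)) > l * real k"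
      have "(\<Sum>i<k. ?f (x i)) \<le> garsia_max ?f n x" by (rule sum_le_garsia_max) fact
      then show "0 < garsia_max ?f n x" using k by (simp add: sum_subtractf mult.commute)
    qed
    have G[measurable]: "?G n \<inter> space ?P \<in> sets ?P"
      using measurable_sets[OF meas[of n], of "{0<..}"] by (simp add: vimage_def greaterThan_def)
    have ind: "integrable ?P (indicator (?G n) :: _ \<Rightarrow> real)"
      by (subst integrable_indicator_iff) (auto simp: G P.emeasure_finite less_top[symmetric])
    have ri: "integrable ?P (\<lambda>x. r (x 0) * indicator (?G n) x)"
      by (rule Bochner_Integration.integrable_bound[OF r0]) (auto simp: indicator_def)
    have "0 \<le> (\<integral>x. ?f (x 0) * indicator (?G n) x \<partial>?P)"
      by (rule maximal_ergodic[OF D f])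
    also have "\<dots> = (\<integral>x. r (x 0) * indicator (?G n) x - l * indicator (?G n) x \<partial>?P)"
      by (simp add: left_diff_distrib)
    also have "\<dots> = (\<integral>x. r (x 0) * indicator (?G n) x \<partial>?P) - l * P.prob (?G n \<inter> space ?P)"
      using ind ri by simp
    also have "(\<integral>x. r (x 0) * indicator (?G n) x \<partial>?P) \<le> (\<integral>x. r (x 0) \<partial>?P)"
      by (intro integral_mono ri r0) (auto simp: indicator_def r)
    also have "\<dots> = (\<integral>x. r x \<partial>D)"
      by (rule integral_PiM_coordinate) (auto simp: D)
    finally have "l * P.prob (?G n \<inter> space ?P) \<le> (\<integral>x. r x \<partial>D)" by simp
    moreover have "P.prob (?A n) \<le> P.prob (?G n \<inter> space ?P)"
      by (rule P.finite_measure_mono[OF sub G])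
    ultimately have "l * P.prob (?A n) \<le> (\<integral>x. r x \<partial>D)"
      using l by (smt (verit) mult_left_mono)
    then show ?thesis using l by (simp add: field_simps)
  qed
  have "(\<lambda>n. P.prob (?A n)) \<longlonglongrightarrow> P.prob (\<Union>n. ?A n)"
    by (rule P.finite_Lim_measure_incseq) (auto simp: incseq_def intro: order_trans)
  also have "(\<Union>n. ?A n) = {x \<in> space ?P. \<exists>k. (\<Sum>i<k. r (x i)) > l * real k}"
    by auto
  finally show ?thesis
    by (rule LIMSEQ_le_const2) (use le in auto)
qed

text \<open>Averages of the two-sided truncation \<open>g M\<close> converge by the bounded case.
  The remainder \<open>r M\<close> has small mean for large \<open>M\<close>, and the weak type
  inequality turns this into a bound on its averages that is uniform in their length.\<close>

theorem strong_law_of_large_numbers: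
  fixes f :: "'a \<Rightarrow> real"
  assumes D: "prob_space D" and f: "integrable D f"
  shows "AE x in (\<Pi>\<^sub>M i\<in>(UNIV::nat set). D).
    (\<lambda>n. (\<Sum>i<n. f (x i)) / real n) \<longlonglongrightarrow> (\<integral>x. f x \<partial>D)"
proof -
  let ?P = "\<Pi>\<^sub>M i\<in>(UNIV::nat set). D"
  interpret D: prob_space D by fact
  interpret P: prob_space ?P by (intro prob_space_PiM D)
  note [measurable] = borel_measurable_integrable[OF f]
  let ?\<mu> = "\<integral>x. f x \<partial>D"
  define g where "g M x = max (- real M) (min (real M) (f x))" for M x
  have [measurable]: "g M \<in> borel_measurable D" for M
    unfolding g_def[abs_def] by simp
  have g_int: "integrable D (g M)" for M
    unfolding g_def by (intro integrable_max integrable_min f) auto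
  define r where "r M x = \<bar>f x - g M x\<bar>" for M x
  have r_int: "integrable D (r M)" for M
    unfolding r_def by (intro integrable_abs Bochner_Integration.integrable_diff f g_int)
  have r0: "(\<lambda>M. \<integral>x. r M x \<partial>D) \<longlonglongrightarrow> (\<integral>x. 0 \<partial>D)"
  proof (rule integral_dominated_convergence)
    show "integrable D (\<lambda>x. \<bar>f x\<bar>)" using f by auto
    show "AE x in D. (\<lambda>M. r M x) \<longlonglongrightarrow> 0"
    proof (intro AE_I2)
      fix x
      obtain N where N: "\<bar>f x\<bar> \<le> real N" using real_arch_simple by blast
      have "r M x = 0" if "M \<ge> N" for M
        using N that by (auto simp: r_def g_def max_def min_def)
      then show "(\<lambda>M. r M x) \<longlonglongrightarrow> 0"
        by (intro tendsto_eventually) (auto simp: eventually_sequentially)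
    qed
    show "AE x in D. norm (r M x) \<le> \<bar>f x\<bar>" for M
      by (auto simp: r_def g_def max_def min_def)
  qed (auto simp: r_def)
  have bad: "AE x in ?P. \<exists>M. (\<integral>x. r M x \<partial>D) \<le> l \<and> (\<forall>k. (\<Sum>i<k. r M (x i)) \<le> l * real k)"
    if l: "l > 0" for l
  proof -
    have "\<forall>\<^sub>F M in sequentially. (\<integral>x. r M x \<partial>D) < l"
      using order_tendstoD(2)[OF r0, of l] l by simp
    then obtain N where N: "\<And>M. M \<ge> N \<Longrightarrow> (\<integral>x. r M x \<partial>D) < l"
      by (auto simp: eventually_sequentially)
    let ?B = "\<lambda>M. {x \<in> space ?P. \<exists>k. (\<Sum>i<k. r M (x i)) > l * real k}"
    have [measurable]: "?B M \<in> sets ?P" for M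
      by (simp add: r_def)
    \<comment> \<open>The sequences for which every level \<open>M \<ge> N\<close> fails. Its
      probability is below the weak type bound of each such level, hence 0; the good level may
      depend on the sequence, which is harmless.\<close>
    let ?N = "\<Inter>M\<in>{N..}. ?B M"
    have meas: "?N \<in> sets ?P" by (rule sets.countable_INT') auto
    have "P.prob ?N \<le> (\<integral>x. r M x \<partial>D) / l" if "M \<ge> N" for M
    proof -
      have "P.prob ?N \<le> P.prob (?B M)"
        by (rule P.finite_measure_mono) (use that in auto)
      also have "\<dots> \<le> (\<integral>x. r M x \<partial>D) / l"
        by (rule weak_type_maximal_inequality[OF D r_int _ l]) (simp add: r_def)
      finally show ?thesis .
    qed
    moreover have "(\<lambda>M. (\<integral>x. r M x \<partial>D) / l) \<longlonglongrightarrow> 0 / l"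
      using r0 by (intro tendsto_divide) (use l in auto)
    ultimately have "P.prob ?N \<le> 0"
      by (intro LIMSEQ_le_const[of _ 0 "P.prob ?N"]) auto
    then have "?N \<in> null_sets ?P"
      using meas by (auto simp: null_sets_def P.emeasure_eq_measure measure_le_0_iff)
    then have "AE x in ?P. x \<notin> ?N" by (rule AE_not_in)
    then show ?thesis
    proof (rule AE_mp, intro AE_I2 impI)
      fix x assume x: "x \<in> space ?P" "x \<notin> ?N"
      then obtain M where "M \<ge> N" "x \<notin> ?B M" by auto
      then show "\<exists>M. (\<integral>x. r M x \<partial>D) \<le> l \<and> (\<forall>k. (\<Sum>i<k. r M (x i)) \<le> l * real k)"
        using N[of M] x by (intro exI[of _ M]) (auto simp: not_less)
    qed
  qed
  have "AE x in ?P. \<forall>j. \<exists>M. (\<integral>x. r M x \<partial>D) \<le> 1 / real (Suc j) \<and>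
      (\<forall>k. (\<Sum>i<k. r M (x i)) \<le> 1 / real (Suc j) * real k)"
    by (subst AE_all_countable, intro allI bad) simp
  moreover have "AE x in ?P. \<forall>M. (\<lambda>n. (\<Sum>i<n. g M (x i)) / real n) \<longlonglongrightarrow> (\<integral>x. g M x \<partial>D)"
  proof (subst AE_all_countable, intro allI)
    show "AE x in ?P. (\<lambda>n. (\<Sum>i<n. g M (x i)) / real n) \<longlonglongrightarrow> (\<integral>x. g M x \<partial>D)" for M
      by (rule strong_law_bounded[OF D, where B="real M"]) (auto simp: g_def)
  qed
  ultimately show ?thesis
  proof eventually_elim
    case (elim x)
    show ?case
    proof (rule tendstoI)
      fix e :: real assume e: "e > 0"
      then obtain j where j: "1 / real (Suc j) < e / 3"
        using reals_Archimedean[of "e / 3"] by (auto simp: inverse_eq_divide)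
      define l where "l = 1 / real (Suc j)"
      have l: "l < e / 3" "l > 0" using j by (auto simp: l_def)
      from elim(1) obtain M where M: "(\<integral>x. r M x \<partial>D) \<le> l" "\<And>k. (\<Sum>i<k. r M (x i)) \<le> l * real k"
        unfolding l_def by blast
      have "\<bar>?\<mu> - (\<integral>x. g M x \<partial>D)\<bar> = \<bar>\<integral>x. f x - g M x \<partial>D\<bar>"
        using f g_int by simp
      also have "\<dots> \<le> (\<integral>x. r M x \<partial>D)"
        unfolding r_def by (rule integral_abs_bound)
      finally have 1: "\<bar>?\<mu> - (\<integral>x. g M x \<partial>D)\<bar> < e / 3" using M l by linarith
      have 2: "\<bar>(\<Sum>i<n. f (x i)) / real n - (\<Sum>i<n. g M (x i)) / real n\<bar> < e / 3" for n
      proof -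
        have "\<bar>(\<Sum>i<n. f (x i)) / real n - (\<Sum>i<n. g M (x i)) / real n\<bar>
            = \<bar>\<Sum>i<n. f (x i) - g M (x i)\<bar> / real n"
          by (simp add: diff_divide_distrib[symmetric] sum_subtractf)
        also have "\<dots> \<le> (l * real n) / real n"
          by (intro divide_right_mono order_trans[OF sum_abs] M(2)[unfolded r_def]) auto
        also have "\<dots> \<le> l" using l by (cases "n = 0") auto
        finally show ?thesis using l by linarith
      qed
      have "\<forall>\<^sub>F n in sequentially. dist ((\<Sum>i<n. g M (x i)) / real n) (\<integral>x. g M x \<partial>D) < e / 3"
        using elim(2) e by (intro tendstoD) auto
      then show "\<forall>\<^sub>F n in sequentially. dist ((\<Sum>i<n. f (x i)) / real n) ?\<mu> < e"
      proof eventually_elim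
        case (elim n)
        then show ?case using 1 2[of n] unfolding dist_real_def by linarith
      qed
    qed
  qed
qed

section \<open>Window averages of the environment\<close>

lemma env_0 [simp]: "env z 0 = 0"
  by (simp add: env_def)

lemma env_diff_nonneg:
  assumes "0 \<le> a" "a \<le> b"
  shows "env z b - env z a = (\<Sum>j\<in>{a+1..b}. z j)"
proof -
  have "{1..b} = {1..a} \<union> {a+1..b}" using assms by auto
  then show ?thesis using assms by (simp add: env_def sum.union_disjoint)
qed

lemma env_diff:
  assumes "a \<le> b"
  shows "env z b - env z a = (\<Sum>j\<in>{a+1..b}. z j)"
proof -
  consider "0 \<le> a" | "a < 0" "0 \<le> b" | "b < 0" by linarith
  then show ?thesis
  proof cases
    case 2
    have "{a+1..b} = {a+1..0} \<union> {1..b}" using 2 by auto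
    then show ?thesis using 2 by (simp add: env_def sum.union_disjoint)
  next
    case 3
    have "{a+1..0} = {a+1..b} \<union> {b+1..0}" using 3 assms by auto
    then show ?thesis using 3 assms by (simp add: env_def sum.union_disjoint)
  qed (rule env_diff_nonneg, use assms in auto)
qed

lemma env_of_nat: "env z (int n) = (\<Sum>i<n. z (int i + 1))"
proof (induction n)
  case (Suc n)
  have "env z (int (Suc n)) - env z (int n) = (\<Sum>j\<in>{int n + 1..int (Suc n)}. z j)"
    by (rule env_diff) simp
  also have "{int n + 1..int (Suc n)} = {int n + 1}" by auto
  finally show ?case using Suc by simp
qed simp

lemma env_minus_of_nat: "env z (- int n) = - (\<Sum>i<n. z (- int i))"
proof (induction n)
  case (Suc n)
  have "env z (- int n) - env z (- int (Suc n)) = (\<Sum>j\<in>{- int (Suc n) + 1..- int n}. z j)"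
    by (rule env_diff) simp
  also have "{- int (Suc n) + 1..- int n} = {- int n}" by auto
  finally show ?case using Suc by simp
qed simp

text \<open>The offsets, relative to the starting site, of the gaps crossed by a jump of size
  \<open>l\<close>. They do not depend on the starting site, so a sum over starting sites can later
  be exchanged with the sum over crossed gaps.\<close>

definition jump_span :: "int \<Rightarrow> int set" where
  "jump_span l = (if 0 \<le> l then {1..l} else {l+1..0})"

lemma finite_jump_span [simp]: "finite (jump_span l)"
  and card_jump_span [simp]: "real (card (jump_span l)) = \<bar>real_of_int l\<bar>"
  and jump_span_bound: "i \<in> jump_span l \<Longrightarrow> \<bar>i\<bar> \<le> \<bar>l\<bar>"
  by (auto simp: jump_span_def split: if_splits)

lemma abs_env_diff:
  assumes "\<And>j. 0 \<le> z j"
  shows "\<bar>env z (j + l) - env z j\<bar> = (\<Sum>i\<in>jump_span l. z (j + i))"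
proof (cases "0 \<le> l")
  case True
  have "env z (j + l) - env z j = (\<Sum>i\<in>{j+1..j+l}. z i)"
    using True by (intro env_diff) auto
  also have "\<dots> = (\<Sum>i\<in>jump_span l. z (j + i))"
    unfolding jump_span_def using True
    by (intro sum.reindex_bij_witness[of _ "\<lambda>i. j + i" "\<lambda>i. i - j"]) auto
  finally show ?thesis by (simp add: sum_nonneg assms)
next
  case False
  have "env z j - env z (j + l) = (\<Sum>i\<in>{j+l+1..j}. z i)"
    using False by (intro env_diff) auto
  also have "\<dots> = (\<Sum>i\<in>jump_span l. z (j + i))"
    unfolding jump_span_def using False
    by (intro sum.reindex_bij_witness[of _ "\<lambda>i. j + i" "\<lambda>i. i - j"]) auto
  finally show ?thesis using sum_nonneg[of "jump_span l" "\<lambda>i. z (j + i)"] assms by simp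
qed

text \<open>The quantitative form of \<open>(z\<^sub>a + \<dots> + z\<^sub>b) / (b - a + 1) \<rightarrow> \<mu>\<close> that is uniform over windows whose
  length is comparable to their distance from the origin.\<close>

definition has_window_mean :: "(int \<Rightarrow> real) \<Rightarrow> real \<Rightarrow> bool" where
  "has_window_mean z \<mu> \<longleftrightarrow> (\<forall>\<eta>>0. \<exists>C\<ge>0. \<forall>a b.
     \<bar>\<Sum>j\<in>{a..b}. z j - \<mu>\<bar> \<le> \<eta> * (\<bar>real_of_int a\<bar> + \<bar>real_of_int b\<bar>) + C)"

lemma has_window_meanD:
  assumes "has_window_mean z \<mu>" "\<eta> > 0"
  obtains C where "C \<ge> 0"
    "\<And>a b. \<bar>\<Sum>j\<in>{a..b}. z j - \<mu>\<bar> \<le> \<eta> * (\<bar>real_of_int a\<bar> + \<bar>real_of_int b\<bar>) + C"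
  using assms unfolding has_window_mean_def by blast

lemma has_window_mean_diff:
  assumes "has_window_mean z \<mu>" "has_window_mean z' \<mu>'"
  shows "has_window_mean (\<lambda>j. z j - z' j) (\<mu> - \<mu>')"
  unfolding has_window_mean_def
proof (intro allI impI)
  fix \<eta> :: real assume "\<eta> > 0"
  then have "\<eta> / 2 > 0" by simp
  obtain C where C: "C \<ge> 0"
    "\<And>a b. \<bar>\<Sum>j\<in>{a..b}. z j - \<mu>\<bar> \<le> \<eta> / 2 * (\<bar>real_of_int a\<bar> + \<bar>real_of_int b\<bar>) + C"
    using has_window_meanD[OF assms(1) \<open>\<eta> / 2 > 0\<close>] by blast
  obtain C' where C': "C' \<ge> 0"
    "\<And>a b. \<bar>\<Sum>j\<in>{a..b}. z' j - \<mu>'\<bar> \<le> \<eta> / 2 * (\<bar>real_of_int a\<bar> + \<bar>real_of_int b\<bar>) + C'"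
    using has_window_meanD[OF assms(2) \<open>\<eta> / 2 > 0\<close>] by blast
  have "\<bar>\<Sum>j\<in>{a..b}. z j - z' j - (\<mu> - \<mu>')\<bar>
      \<le> \<eta> * (\<bar>real_of_int a\<bar> + \<bar>real_of_int b\<bar>) + (C + C')" for a b
  proof -
    have "(\<Sum>j\<in>{a..b}. z j - z' j - (\<mu> - \<mu>'))
        = (\<Sum>j\<in>{a..b}. z j - \<mu>) - (\<Sum>j\<in>{a..b}. z' j - \<mu>')"
      by (simp add: sum_subtractf[symmetric] algebra_simps)
    then show ?thesis using C(2)[of a b] C'(2)[of a b] by (simp add: field_simps)
  qed
  then show "\<exists>C\<ge>0. \<forall>a b. \<bar>\<Sum>j\<in>{a..b}. z j - z' j - (\<mu> - \<mu>')\<bar>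
      \<le> \<eta> * (\<bar>real_of_int a\<bar> + \<bar>real_of_int b\<bar>) + C"
    using C C' by (intro exI[of _ "C + C'"]) auto
qed

lemma has_window_mean_env_bound:
  assumes "has_window_mean z \<mu>" "\<eta> > 0"
  obtains C where "C \<ge> 0" "\<And>k. \<bar>env z k - \<mu> * real_of_int k\<bar> \<le> \<eta> * \<bar>real_of_int k\<bar> + C"
proof -
  obtain C where C: "C \<ge> 0"
    "\<And>a b. \<bar>\<Sum>j\<in>{a..b}. z j - \<mu>\<bar> \<le> \<eta> * (\<bar>real_of_int a\<bar> + \<bar>real_of_int b\<bar>) + C"
    using has_window_meanD[OF assms] by blast
  have "\<bar>env z k - \<mu> * real_of_int k\<bar> \<le> \<eta> * \<bar>real_of_int k\<bar> + (C + \<eta>)" for k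
  proof (cases "0 \<le> k")
    case True
    have "env z k - \<mu> * real_of_int k = (\<Sum>j\<in>{1..k}. z j - \<mu>)"
      using True by (simp add: env_def sum_subtractf mult.commute)
    then show ?thesis using C(2)[of 1 k] by (simp add: field_simps)
  next
    case False
    have "env z k - \<mu> * real_of_int k = - (\<Sum>j\<in>{k+1..0}. z j - \<mu>)"
      using False by (simp add: env_def sum_subtractf mult.commute)
    then have "\<bar>env z k - \<mu> * real_of_int k\<bar> \<le> \<eta> * \<bar>real_of_int (k+1)\<bar> + C"
      using C(2)[of "k+1" 0] by simp
    also have "\<dots> \<le> \<eta> * (\<bar>real_of_int k\<bar> + 1) + C"
      using assms(2) by (intro add_mono mult_left_mono) auto
    finally show ?thesis by (simp add: field_simps)
  qed
  then show ?thesis using that[of "C + \<eta>"] C assms by auto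
qed

text \<open>A window sum is a difference of two values of \<open>env\<close>, each with an error
  linear in its own distance from 0. This is why the errors at the endpoints add up and the length
  of the window does not enter.\<close>

lemma has_window_mean_of_tendsto:
  assumes "(\<lambda>n. (\<Sum>i<n. z (int i + 1)) / real n) \<longlonglongrightarrow> \<mu>"
    and "(\<lambda>n. (\<Sum>i<n. z (- int i)) / real n) \<longlonglongrightarrow> \<mu>"
  shows "has_window_mean z \<mu>"
  unfolding has_window_mean_def
proof (intro allI impI)
  fix \<eta> :: real assume \<eta>: "\<eta> > 0"
  have lin: "\<exists>C\<ge>0. \<forall>n. \<bar>(\<Sum>i<n. f i) - \<mu> * real n\<bar> \<le> \<eta> * real n + C"
    if lim: "(\<lambda>n. (\<Sum>i<n. f i) / real n) \<longlonglongrightarrow> \<mu>" for f :: "nat \<Rightarrow> real"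
  proof -
    obtain N where N: "\<And>n. n \<ge> N \<Longrightarrow> \<bar>(\<Sum>i<n. f i) / real n - \<mu>\<bar> < \<eta>"
      using lim \<eta> unfolding LIMSEQ_def dist_real_def by blast
    \<comment> \<open>The finitely many indices up to \<open>N\<close>, where the limit says
      nothing, are absorbed by the sum of their errors.\<close>
    define C where "C = (\<Sum>n\<le>N. \<bar>(\<Sum>i<n. f i) - \<mu> * real n\<bar>)"
    have "C \<ge> 0" by (auto simp: C_def intro: sum_nonneg)
    moreover have "\<bar>(\<Sum>i<n. f i) - \<mu> * real n\<bar> \<le> \<eta> * real n + C" for n
    proof (cases "n \<le> N")
      case True
      then have "\<bar>(\<Sum>i<n. f i) - \<mu> * real n\<bar> \<le> C"
        unfolding C_def by (intro member_le_sum[of n "{..N}" "\<lambda>n. \<bar>(\<Sum>i<n. f i) - \<mu> * real n\<bar>"]) auto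
      then show ?thesis using \<eta> by (smt (verit) mult_nonneg_nonneg of_nat_0_le_iff)
    next
      case False
      then have n: "real n > 0" by auto
      have "\<bar>(\<Sum>i<n. f i) - \<mu> * real n\<bar> = \<bar>(\<Sum>i<n. f i) / real n - \<mu>\<bar> * real n"
      proof -
        have "(\<Sum>i<n. f i) - \<mu> * real n = ((\<Sum>i<n. f i) / real n - \<mu>) * real n"
          using n by (simp add: field_simps)
        then show ?thesis by (simp add: abs_mult)
      qed
      also have "\<dots> \<le> \<eta> * real n"
        using N[of n] False n by (intro mult_right_mono) auto
      finally show ?thesis using \<open>C \<ge> 0\<close> by simp
    qed
    ultimately show ?thesis by blast
  qed
  obtain C1 where C1: "C1 \<ge> 0" "\<And>n. \<bar>(\<Sum>i<n. z (int i + 1)) - \<mu> * real n\<bar> \<le> \<eta> * real n + C1"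
    using lin[OF assms(1)] by blast
  obtain C2 where C2: "C2 \<ge> 0" "\<And>n. \<bar>(\<Sum>i<n. z (- int i)) - \<mu> * real n\<bar> \<le> \<eta> * real n + C2"
    using lin[OF assms(2)] by blast
  have env: "\<bar>env z k - \<mu> * real_of_int k\<bar> \<le> \<eta> * \<bar>real_of_int k\<bar> + (C1 + C2)" for k
  proof (cases "0 \<le> k")
    case True
    then obtain n where "k = int n" using nonneg_int_cases by blast
    then show ?thesis using C1(2)[of n] C2(1) by (simp add: env_of_nat)
  next
    case False
    then obtain n where "k = - int n" by (metis int_cases2 linorder_le_cases negative_zle_0 of_nat_0_le_iff)
    then show ?thesis using C2(2)[of n] C1(1) by (simp add: env_minus_of_nat)
  qed
  have "\<bar>\<Sum>j\<in>{a..b}. z j - \<mu>\<bar>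
      \<le> \<eta> * (\<bar>real_of_int a\<bar> + \<bar>real_of_int b\<bar>) + (2 * (C1 + C2) + \<eta>)" for a b
  proof (cases "a \<le> b")
    case True
    have "(\<Sum>j\<in>{a..b}. z j - \<mu>) = (env z b - \<mu> * real_of_int b) - (env z (a - 1) - \<mu> * real_of_int (a - 1))"
      using True env_diff[of "a - 1" b z] by (simp add: sum_subtractf algebra_simps)
    then have "\<bar>\<Sum>j\<in>{a..b}. z j - \<mu>\<bar>
        \<le> \<eta> * \<bar>real_of_int b\<bar> + (C1 + C2) + (\<eta> * \<bar>real_of_int (a - 1)\<bar> + (C1 + C2))"
      using env[of b] env[of "a - 1"] by linarith
    also have "\<dots> \<le> \<eta> * \<bar>real_of_int b\<bar> + (C1 + C2) + (\<eta> * (\<bar>real_of_int a\<bar> + 1) + (C1 + C2))"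
      using \<eta> by (intro add_mono mult_left_mono) auto
    finally show ?thesis by (simp add: algebra_simps)
  qed (use \<eta> C1 C2 in simp)
  then show "\<exists>C\<ge>0. \<forall>a b. \<bar>\<Sum>j\<in>{a..b}. z j - \<mu>\<bar>
      \<le> \<eta> * (\<bar>real_of_int a\<bar> + \<bar>real_of_int b\<bar>) + C"
    using \<eta> C1 C2 by (intro exI[of _ "2 * (C1 + C2) + \<eta>"]) auto
qed

text \<open>The strong law is applied to each half-line separately, after an injective reindexing by
  the natural numbers.\<close>

lemma AE_has_window_mean:
  fixes f :: "'a \<Rightarrow> real"
  assumes D: "prob_space D" and f: "integrable D f"
  shows "AE \<zeta> in (\<Pi>\<^sub>M j\<in>(UNIV::int set). D). has_window_mean (\<lambda>j. f (\<zeta> j)) (\<integral>x. f x \<partial>D)"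
proof -
  have half: "AE \<zeta> in (\<Pi>\<^sub>M j\<in>(UNIV::int set). D).
      (\<lambda>n. (\<Sum>i<n. f (\<zeta> (h i))) / real n) \<longlonglongrightarrow> (\<integral>x. f x \<partial>D)" if "inj h" for h :: "nat \<Rightarrow> int"
  proof (rule AE_distrD[where f="\<lambda>x i. x (h i)" and M'="\<Pi>\<^sub>M i\<in>(UNIV::nat set). D"
        and P="\<lambda>x. (\<lambda>n. (\<Sum>i<n. f (x i)) / real n) \<longlonglongrightarrow> (\<integral>x. f x \<partial>D)"])
    show "(\<lambda>x i. x (h i)) \<in> measurable (\<Pi>\<^sub>M j\<in>(UNIV::int set). D) (\<Pi>\<^sub>M i\<in>(UNIV::nat set). D)"
      by (rule measurable_PiM_single') (auto simp: space_PiM)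
    show "AE x in distr (\<Pi>\<^sub>M j\<in>(UNIV::int set). D) (\<Pi>\<^sub>M i\<in>(UNIV::nat set). D) (\<lambda>x i. x (h i)).
        (\<lambda>n. (\<Sum>i<n. f (x i)) / real n) \<longlonglongrightarrow> (\<integral>x. f x \<partial>D)"
      unfolding distr_PiM_reindex_UNIV[OF D that] by (rule strong_law_of_large_numbers[OF D f])
  qed
  have "AE \<zeta> in (\<Pi>\<^sub>M j\<in>(UNIV::int set). D).
      (\<lambda>n. (\<Sum>i<n. f (\<zeta> (int i + 1))) / real n) \<longlonglongrightarrow> (\<integral>x. f x \<partial>D)"
    by (rule half) (auto simp: inj_def)
  moreover have "AE \<zeta> in (\<Pi>\<^sub>M j\<in>(UNIV::int set). D).
      (\<lambda>n. (\<Sum>i<n. f (\<zeta> (- int i))) / real n) \<longlonglongrightarrow> (\<integral>x. f x \<partial>D)"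
    by (rule half) (auto simp: inj_def)
  ultimately show ?thesis
    by eventually_elim (rule has_window_mean_of_tendsto)
qed

section \<open>Symmetric unimodal laws as mixtures\<close>

definition sym_unimodal :: "int pmf \<Rightarrow> bool" where
  "sym_unimodal q \<longleftrightarrow> (\<forall>k. pmf q (- k) = pmf q k) \<and> (\<forall>k\<ge>0. pmf q (k + 1) \<le> pmf q k)"

lemma sym_unimodal_antimono:
  assumes "sym_unimodal q" "\<bar>a\<bar> \<le> \<bar>b\<bar>"
  shows "pmf q b \<le> pmf q a"
proof -
  have abs: "pmf q \<bar>k\<bar> = pmf q k" for k
    using assms(1) by (auto simp: sym_unimodal_def abs_if)
  have "pmf q (m + int n) \<le> pmf q m" if "m \<ge> 0" for m n
  proof (induction n)
    case (Suc n)
    have "pmf q (m + int n + 1) \<le> pmf q (m + int n)"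
      using assms(1) that by (auto simp: sym_unimodal_def)
    with Suc show ?case by (simp add: algebra_simps)
  qed simp
  from this[of "\<bar>a\<bar>" "nat (\<bar>b\<bar> - \<bar>a\<bar>)"] assms(2) have "pmf q \<bar>b\<bar> \<le> pmf q \<bar>a\<bar>" by simp
  then show ?thesis by (simp add: abs)
qed

abbreviation centred_uniform :: "nat \<Rightarrow> int pmf" where
  "centred_uniform r \<equiv> pmf_of_set {- int r..int r}"

text \<open>Cut the graph of \<open>q\<close> into horizontal layers. The layer of height
  \<open>d r\<close> lies over \<open>{-r..r}\<close>, so it is a multiple of a uniform law with
  mass \<open>(2 * r + 1) * d r\<close>, and \<open>pmf q i\<close> is the total height of the
  layers with \<open>r \<ge> |i|\<close>.\<close>

lemma sym_unimodal_mixture: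
  assumes q: "sym_unimodal q"
  obtains w :: "nat pmf" where "q = bind_pmf w centred_uniform"
proof -
  define d where "d r = pmf q (int r) - pmf q (int r + 1)" for r
  have d: "d r \<ge> 0" for r using q by (auto simp: d_def sym_unimodal_def)
  define e where "e r i = (if \<bar>i\<bar> \<le> int r then d r else 0)" for r i
  have e: "e r i \<ge> 0" for r i using d by (auto simp: e_def)
  \<comment> \<open>Needed only for the decay of \<open>pmf q (int r)\<close>, so that the
    telescoping sum of the layers leaves no remainder at infinity.\<close>
  have "summable (\<lambda>r. pmf q (int r))"
  proof (rule summableI_nonneg_bounded)
    fix n
    have "(\<Sum>r<n. pmf q (int r)) = measure q (int ` {..<n})"
      by (subst measure_measure_pmf_finite) (auto simp: sum.reindex)
    then show "(\<Sum>r<n. pmf q (int r)) \<le> 1" by simp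
  qed auto
  then have lim: "(\<lambda>r. pmf q (int r)) \<longlonglongrightarrow> 0" by (rule summable_LIMSEQ_zero)
  have e_sums: "(\<lambda>r. e r i) sums pmf q i" for i
  proof -
    define k where "k = nat \<bar>i\<bar>"
    have "(\<lambda>r. pmf q (int (r + k))) \<longlonglongrightarrow> 0" using lim by (rule LIMSEQ_ignore_initial_segment)
    from telescope_sums'[OF this] have "(\<lambda>r. e (r + k) i) sums pmf q (int k)"
      by (simp add: e_def d_def k_def algebra_simps)
    moreover have "(\<Sum>r<k. e r i) = 0" by (intro sum.neutral) (auto simp: e_def k_def)
    moreover have "pmf q (int k) = pmf q i" using q by (auto simp: k_def sym_unimodal_def abs_if)
    ultimately show ?thesis using sums_iff_shift[of "\<lambda>r. e r i" k "pmf q i"] by simp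
  qed
  have e_int: "(\<integral>\<^sup>+r. ennreal (e r i) \<partial>count_space UNIV) = ennreal (pmf q i)" for i
    by (simp add: nn_integral_count_space_nat suminf_ennreal_eq[OF e e_sums])
  have inner: "(\<integral>\<^sup>+i. ennreal (e r i) \<partial>count_space UNIV) = ennreal (real (2 * r + 1) * d r)" for r
  proof -
    have "(\<integral>\<^sup>+i. ennreal (e r i) \<partial>count_space UNIV)
        = (\<integral>\<^sup>+i. ennreal (d r) * indicator {- int r..int r} i \<partial>count_space UNIV)"
      by (intro nn_integral_cong) (auto simp: e_def indicator_def abs_le_iff)
    also have "\<dots> = ennreal (d r) * of_nat (2 * r + 1)"
      by (subst nn_integral_cmult_indicator) (auto simp: nat_add_distrib nat_mult_distrib)
    also have "\<dots> = ennreal (real (2 * r + 1) * d r)"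
      by (simp only: ennreal_of_nat_eq_real_of_nat mult.commute ennreal_mult'[OF d])
    finally show ?thesis .
  qed
  have nn: "0 \<le> real (2 * r + 1) * d r" for r using d by simp
  have tot: "(\<integral>\<^sup>+r. ennreal (real (2 * r + 1) * d r) \<partial>count_space UNIV) = 1"
  proof -
    have "(\<integral>\<^sup>+r. ennreal (real (2 * r + 1) * d r) \<partial>count_space UNIV)
        = (\<integral>\<^sup>+r. \<integral>\<^sup>+i. ennreal (e r i) \<partial>count_space UNIV \<partial>count_space UNIV)"
      by (simp only: inner)
    also have "\<dots> = (\<integral>\<^sup>+i. \<integral>\<^sup>+r. ennreal (e r i) \<partial>count_space UNIV \<partial>count_space UNIV)"
      using nn_integral_fst_count_space[of "\<lambda>(r, i). ennreal (e r i)"]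
        nn_integral_snd_count_space[of "\<lambda>(r, i). ennreal (e r i)"] by simp
    also have "\<dots> = (\<integral>\<^sup>+i. ennreal (pmf q i) \<partial>count_space UNIV)" by (simp only: e_int)
    also have "\<dots> = 1" by (simp add: nn_integral_pmf measure_pmf.emeasure_space_1[simplified])
    finally show ?thesis .
  qed
  define w where "w = embed_pmf (\<lambda>r. real (2 * r + 1) * d r)"
  have w: "pmf w r = real (2 * r + 1) * d r" for r
    unfolding w_def by (rule pmf_embed_pmf[OF nn tot])
  have "q = bind_pmf w centred_uniform"
  proof (rule pmf_eqI)
    fix i
    have "ennreal (pmf (bind_pmf w centred_uniform) i)
        = (\<integral>\<^sup>+r. ennreal (pmf w r) * ennreal (pmf (centred_uniform r) i) \<partial>count_space UNIV)"
      by (simp add: ennreal_pmf_bind nn_integral_measure_pmf)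
    also have "\<dots> = (\<integral>\<^sup>+r. ennreal (e r i) \<partial>count_space UNIV)"
    proof (intro nn_integral_cong)
      fix r :: nat
      have "pmf w r * pmf (centred_uniform r) i = e r i"
        by (auto simp: w e_def indicator_def abs_le_iff nat_add_distrib nat_mult_distrib)
      then show "ennreal (pmf w r) * ennreal (pmf (centred_uniform r) i) = ennreal (e r i)"
        by (simp add: ennreal_mult'[symmetric])
    qed
    also have "\<dots> = ennreal (pmf q i)" by (rule e_int)
    finally show "pmf q i = pmf (bind_pmf w centred_uniform) i" by simp
  qed
  then show ?thesis using that by blast
qed

definition conv_pmf :: "int pmf \<Rightarrow> int pmf \<Rightarrow> int pmf" where
  "conv_pmf q p = bind_pmf q (\<lambda>x. map_pmf (\<lambda>y. x + y) p)"

lemma pmf_map_plus: "pmf (map_pmf (\<lambda>y. x + y) p) (k :: int) = pmf p (k - x)"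
  using pmf_map_inj'[of "\<lambda>y. x + y" p "k - x"] by (simp add: inj_def)

text \<open>Only one factor has to be written as a mixture. Convolving \<open>p\<close> with a
  uniform law gives window averages \<open>u r k\<close> of \<open>p\<close> around
  \<open>k\<close>; these are symmetric and decrease in \<open>k \<ge> 0\<close>, and both
  properties survive mixing over \<open>r\<close>.\<close>

lemma sym_unimodal_conv_pmf:
  assumes "sym_unimodal q" "sym_unimodal p"
  shows "sym_unimodal (conv_pmf q p)"
proof -
  obtain w where w: "q = bind_pmf w centred_uniform" by (rule sym_unimodal_mixture[OF assms(1)])
  define u where "u r k = (\<Sum>x\<in>{k - int r..k + int r}. pmf p x) / real (2 * r + 1)" for r k
  have u: "pmf (bind_pmf (centred_uniform r) (\<lambda>x. map_pmf (\<lambda>y. x + y) p)) k = u r k" for r k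
  proof -
    have "pmf (bind_pmf (centred_uniform r) (\<lambda>x. map_pmf (\<lambda>y. x + y) p)) k
        = (\<Sum>x\<in>{- int r..int r}. pmf p (k - x)) / real (2 * r + 1)"
      by (simp add: pmf_bind integral_pmf_of_set pmf_map_plus nat_add_distrib nat_mult_distrib)
    also have "(\<Sum>x\<in>{- int r..int r}. pmf p (k - x)) = (\<Sum>x\<in>{k - int r..k + int r}. pmf p x)"
      by (rule sum.reindex_bij_witness[of _ "\<lambda>x. k - x" "\<lambda>x. k - x"]) auto
    finally show ?thesis by (simp add: u_def)
  qed
  have conv: "pmf (conv_pmf q p) k = (\<integral>r. u r k \<partial>measure_pmf w)" for k
    unfolding conv_pmf_def w bind_assoc_pmf by (subst pmf_bind) (simp add: u)
  have u_int: "integrable (measure_pmf w) (\<lambda>r. u r k)" for k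
    by (rule measure_pmf.integrable_const_bound[where B=1]) (auto simp: u[symmetric] pmf_le_1)
  have u_sym: "u r (- k) = u r k" for r k
  proof -
    have "(\<Sum>x\<in>{- k - int r..- k + int r}. pmf p x) = (\<Sum>x\<in>{k - int r..k + int r}. pmf p x)"
      using assms(2)
      by (intro sum.reindex_bij_witness[of _ uminus uminus]) (auto simp: sym_unimodal_def)
    then show ?thesis by (simp add: u_def)
  qed
  have u_mono: "u r (k + 1) \<le> u r k" if "0 \<le> k" for r k
  proof -
    \<comment> \<open>Moving the window one step to the right exchanges the site
      \<open>k - r\<close> for \<open>k + 1 + r\<close>, which is at least as far from the
      origin.\<close>
    have 1: "{k + 1 - int r..k + 1 + int r} = insert (k + 1 + int r) {k + 1 - int r..k + int r}"
      and 2: "{k - int r..k + int r} = insert (k - int r) {k + 1 - int r..k + int r}"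
      using that by auto
    have "pmf p (k + 1 + int r) \<le> pmf p (k - int r)"
      by (rule sym_unimodal_antimono[OF assms(2)]) (use that in auto)
    then have "(\<Sum>x\<in>{k + 1 - int r..k + 1 + int r}. pmf p x) \<le> (\<Sum>x\<in>{k - int r..k + int r}. pmf p x)"
      unfolding 1 2 by simp
    then show ?thesis unfolding u_def by (intro divide_right_mono) auto
  qed
  show ?thesis
    unfolding sym_unimodal_def conv
    by (auto simp: u_sym intro!: integral_mono u_int u_mono)
qed

lemma expectation_bind_pmf:
  fixes f :: "'b \<Rightarrow> real"
  assumes "\<And>x. \<bar>f x\<bar> \<le> B"
  shows "measure_pmf.expectation (bind_pmf w N) f = (\<integral>x. measure_pmf.expectation (N x) f \<partial>measure_pmf w)"
  unfolding measure_pmf_bind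
  using assms
  by (subst integral_bind[where K="count_space UNIV" and B=B and B'=1])
     (auto simp: measure_pmf_in_subprob_algebra measure_pmf.emeasure_le_1)

text \<open>In the mixture, a radius above \<open>R\<close> produces a long window average around
  \<open>j\<close>, controlled by \<open>window\<close>; a radius up to \<open>R\<close> is
  estimated by \<open>B\<close>. The second kind has little weight if \<open>q\<close> puts little
  mass near 0.\<close>

lemma sym_unimodal_expectation_window:
  fixes g :: "int \<Rightarrow> real"
  assumes q: "sym_unimodal q" and B: "\<And>i. \<bar>g i\<bar> \<le> B" and C: "C \<ge> 0" and \<eta>: "\<eta> > 0"
    and window: "\<And>a b. \<bar>\<Sum>i\<in>{a..b}. g i\<bar> \<le> \<eta> * (\<bar>real_of_int a\<bar> + \<bar>real_of_int b\<bar>) + C"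
  shows "\<bar>measure_pmf.expectation q (\<lambda>i. g (j + i))\<bar>
    \<le> \<eta> + (2 * \<eta> * \<bar>real_of_int j\<bar> + C) / real (2 * R + 1) + B * measure_pmf.prob q {i. \<bar>i\<bar> \<le> int R}"
proof -
  obtain w where w: "q = bind_pmf w centred_uniform" by (rule sym_unimodal_mixture[OF q])
  have B0: "B \<ge> 0" using B[of 0] by linarith
  let ?K = "(2 * \<eta> * \<bar>real_of_int j\<bar> + C) / real (2 * R + 1)"
  have K0: "?K \<ge> 0" using C \<eta> by (intro divide_nonneg_nonneg) auto
  let ?A = "\<lambda>r. measure_pmf.expectation (centred_uniform r) (\<lambda>i. g (j + i))"
  have AB: "\<bar>?A r\<bar> \<le> B" for r
  proof -
    have "\<bar>?A r\<bar> \<le> (\<integral>i. \<bar>g (j + i)\<bar> \<partial>centred_uniform r)" by (rule integral_abs_bound)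
    also have "\<dots> \<le> (\<integral>i. B \<partial>centred_uniform r)"
      by (intro integral_mono measure_pmf.integrable_const_bound[where B=B]) (auto simp: B B0)
    finally show ?thesis by simp
  qed
  have A: "\<bar>?A r\<bar> \<le> \<eta> + ?K" if "r > R" for r
  proof -
    have "?A r = (\<Sum>i\<in>{- int r..int r}. g (j + i)) / real (2 * r + 1)"
      by (simp add: integral_pmf_of_set nat_add_distrib nat_mult_distrib)
    also have "(\<Sum>i\<in>{- int r..int r}. g (j + i)) = (\<Sum>i\<in>{j - int r..j + int r}. g i)"
      by (rule sum.reindex_bij_witness[of _ "\<lambda>x. x - j" "\<lambda>x. j + x"]) auto
    finally have "\<bar>?A r\<bar> = \<bar>\<Sum>i\<in>{j - int r..j + int r}. g i\<bar> / real (2 * r + 1)"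
      by simp
    also have "\<dots> \<le> (\<eta> * (\<bar>real_of_int (j - int r)\<bar> + \<bar>real_of_int (j + int r)\<bar>) + C) / real (2 * r + 1)"
      by (intro divide_right_mono window) auto
    also have "\<dots> \<le> (\<eta> * (2 * \<bar>real_of_int j\<bar> + real (2 * r + 1)) + C) / real (2 * r + 1)"
      using \<eta> by (intro divide_right_mono add_right_mono mult_left_mono) auto
    also have "\<dots> = \<eta> + (2 * \<eta> * \<bar>real_of_int j\<bar> + C) / real (2 * r + 1)"
      by (simp add: field_simps)
    also have "\<dots> \<le> \<eta> + ?K"
      using that C \<eta> by (intro add_left_mono divide_left_mono) auto
    finally show ?thesis .
  qed
  have "\<bar>measure_pmf.expectation q (\<lambda>i. g (j + i))\<bar> = \<bar>\<integral>r. ?A r \<partial>measure_pmf w\<bar>"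
    unfolding w by (subst expectation_bind_pmf[where B=B]) (auto simp: B)
  also have "\<dots> \<le> (\<integral>r. \<bar>?A r\<bar> \<partial>measure_pmf w)" by (rule integral_abs_bound)
  also have "\<dots> \<le> (\<integral>r. (\<eta> + ?K) + B * indicator {..R} r \<partial>measure_pmf w)"
  proof (intro integral_mono)
    show "integrable (measure_pmf w) (\<lambda>r. \<bar>?A r\<bar>)"
      by (intro measure_pmf.integrable_const_bound[where B=B]) (auto simp: AB)
    show "\<bar>?A r\<bar> \<le> (\<eta> + ?K) + B * indicator {..R} r" for r
    proof (cases "r \<le> R")
      case True
      then show ?thesis using AB[of r] K0 \<eta> by simp
    qed (use A[of r] in auto)
  qed (auto simp: measure_pmf.emeasure_eq_measure)
  also have "\<dots> = (\<eta> + ?K) + B * measure_pmf.prob w {..R}"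
    by (simp add: measure_pmf.emeasure_eq_measure measure_pmf.prob_space[simplified])
  \<comment> \<open>The mixing law itself is not known, but a uniform law of radius at most
    \<open>R\<close> lives inside \<open>{i. |i| \<le> R}\<close>, so its weight is visible in
    \<open>q\<close>.\<close>
  also have "measure_pmf.prob w {..R} \<le> measure_pmf.prob q {i. \<bar>i\<bar> \<le> int R}"
  proof -
    have eq: "measure_pmf.prob q {i. \<bar>i\<bar> \<le> int R}
        = (\<integral>r. measure_pmf.prob (centred_uniform r) {i. \<bar>i\<bar> \<le> int R} \<partial>measure_pmf w)"
      using expectation_bind_pmf[of "indicator {i. \<bar>i\<bar> \<le> int R}" 1 w centred_uniform]
      by (simp add: w indicator_def)
    have "measure_pmf.prob w {..R} = (\<integral>r. indicator {..R} r \<partial>measure_pmf w)" by simp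
    also have "\<dots> \<le> (\<integral>r. measure_pmf.prob (centred_uniform r) {i. \<bar>i\<bar> \<le> int R} \<partial>measure_pmf w)"
    proof (intro integral_mono)
      show "indicator {..R} r \<le> measure_pmf.prob (centred_uniform r) {i. \<bar>i\<bar> \<le> int R}" for r
      proof (cases "r \<le> R")
        case True
        then have "{- int r..int r} \<subseteq> {i. \<bar>i\<bar> \<le> int R}" by auto
        then have "measure_pmf.prob (centred_uniform r) {i. \<bar>i\<bar> \<le> int R} = 1"
          by (subst measure_pmf.prob_eq_1) (auto simp: AE_measure_pmf_iff set_pmf_of_set)
        then show ?thesis by simp
      qed simp
      show "integrable (measure_pmf w) (\<lambda>r. measure_pmf.prob (centred_uniform r) {i. \<bar>i\<bar> \<le> int R})"
        by (intro measure_pmf.integrable_const_bound[where B=1]) auto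
    qed (auto simp: measure_pmf.emeasure_eq_measure)
    finally show ?thesis using eq by simp
  qed
  finally show ?thesis using B0 by (simp add: mult_left_mono)
qed

text \<open>For unbounded nonnegative \<open>g\<close> no cut at a radius is possible. Instead the
  constant \<open>C\<close> is divided by \<open>2 * r + 1\<close>, and the reciprocal of
  \<open>2 * r + 1\<close> is the mass that the uniform law gives to 0; mixing these masses yields
  \<open>pmf q 0\<close>.\<close>

lemma sym_unimodal_nn_integral_window:
  fixes g :: "int \<Rightarrow> real"
  assumes q: "sym_unimodal q" and g: "\<And>i. 0 \<le> g i" and C: "C \<ge> 0" and c: "c \<ge> 0"
    and window: "\<And>r::nat. (\<Sum>i\<in>{- int r..int r}. g i) \<le> c * real (2 * r + 1) + C"
  shows "(\<integral>\<^sup>+i. ennreal (g i) \<partial>measure_pmf q) \<le> ennreal (c + C * pmf q 0)"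
proof -
  obtain w where w: "q = bind_pmf w centred_uniform" by (rule sym_unimodal_mixture[OF q])
  have inner: "(\<integral>\<^sup>+i. ennreal (g i) \<partial>centred_uniform r) \<le> ennreal (c + C * pmf (centred_uniform r) 0)" for r
  proof -
    have "(\<integral>\<^sup>+i. ennreal (g i) \<partial>centred_uniform r) = ennreal (\<integral>i. g i \<partial>centred_uniform r)"
      by (rule nn_integral_eq_integral) (auto simp: g intro!: integrable_measure_pmf_finite)
    also have "(\<integral>i. g i \<partial>centred_uniform r) = (\<Sum>i\<in>{- int r..int r}. g i) / real (2 * r + 1)"
      by (simp add: integral_pmf_of_set nat_add_distrib nat_mult_distrib)
    also have "\<dots> \<le> (c * real (2 * r + 1) + C) / real (2 * r + 1)"
      by (intro divide_right_mono window) auto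
    also have "\<dots> = c + C * pmf (centred_uniform r) 0"
      by (simp add: field_simps nat_add_distrib nat_mult_distrib)
    finally show ?thesis by (simp add: ennreal_leI)
  qed
  have "(\<integral>\<^sup>+i. ennreal (g i) \<partial>measure_pmf q) = (\<integral>\<^sup>+r. \<integral>\<^sup>+i. ennreal (g i) \<partial>centred_uniform r \<partial>measure_pmf w)"
    by (simp add: w)
  also have "\<dots> \<le> (\<integral>\<^sup>+r. ennreal (c + C * pmf (centred_uniform r) 0) \<partial>measure_pmf w)"
    by (intro nn_integral_mono inner)
  also have "\<dots> = ennreal (\<integral>r. c + C * pmf (centred_uniform r) 0 \<partial>measure_pmf w)"
  proof (rule nn_integral_eq_integral)
    have "integrable (measure_pmf w) (\<lambda>r. pmf (centred_uniform r) 0)"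
      by (intro measure_pmf.integrable_const_bound[where B=1]) (auto simp: pmf_le_1 simp del: pmf_of_set)
    then show "integrable (measure_pmf w) (\<lambda>r. c + C * pmf (centred_uniform r) 0)"
      by (simp del: pmf_of_set)
  qed (use c C in auto)
  also have "(\<integral>r. c + C * pmf (centred_uniform r) 0 \<partial>measure_pmf w)
      = c + C * (\<integral>r. pmf (centred_uniform r) 0 \<partial>measure_pmf w)"
    by (subst Bochner_Integration.integral_add)
       (auto intro!: integrable_mult_right measure_pmf.integrable_const_bound[where B=1]
         simp: pmf_le_1 measure_pmf.prob_space[simplified] simp del: pmf_of_set)
  also have "(\<integral>r. pmf (centred_uniform r) 0 \<partial>measure_pmf w) = pmf q 0"
    unfolding w by (subst pmf_bind) simp
  finally show ?thesis .
qed

section \<open>The random walk\<close>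

lemma walkS_0 [simp]: "walkS xs 0 = 0"
  and walkS_Suc: "walkS xs (Suc n) = walkS xs n + xs n"
  by (simp_all add: walkS_def)

lemma walkS_comb_seq_le: "n \<le> k \<Longrightarrow> walkS (comb_seq k \<omega> \<omega>') n = walkS \<omega> n"
  by (auto simp: walkS_def comb_seq_def intro!: sum.cong)

lemma walkS_comb_seq_add: "walkS (comb_seq k \<omega> \<omega>') (k + m) = walkS \<omega> k + walkS \<omega>' m"
  by (induction m) (simp_all add: walkS_comb_seq_le walkS_Suc comb_seq_add[of k \<omega> \<omega>', unfolded add.commute[of _ k]])

lemma walkS_comb_seq_shift: "walkS (comb_seq k \<omega> \<omega>') (k + m) - walkS (comb_seq k \<omega> \<omega>') k = walkS \<omega>' m"
  by (simp add: walkS_comb_seq_add walkS_comb_seq_le)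

lemma
  fixes f :: "'a \<Rightarrow> real"
  assumes "(\<lambda>k. f k * pmf p k) summable_on UNIV" "\<And>k. 0 \<le> f k"
  shows integrable_measure_pmf_of_summable_on: "integrable (measure_pmf p) f"
    and expectation_eq_infsum: "measure_pmf.expectation p f = (\<Sum>\<^sub>\<infinity>k. f k * pmf p k)"
proof -
  have "(\<lambda>k. norm (f k * pmf p k)) summable_on UNIV"
    using assms by simp
  then have "Infinite_Set_Sum.abs_summable_on (\<lambda>k. f k * pmf p k) UNIV"
    by (rule abs_summable_equivalent[THEN iffD1])
  then have *: "integrable (count_space UNIV) (\<lambda>k. pmf p k *\<^sub>R f k)"
    by (simp add: Infinite_Set_Sum.abs_summable_on_def mult.commute)
  then show int: "integrable (measure_pmf p) f"
    unfolding measure_pmf_eq_density by (subst integrable_density) auto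
  have "measure_pmf.expectation p f = infsetsum (\<lambda>k. pmf p k * f k) UNIV"
    by (rule pmf_expectation_eq_infsetsum)
  also have "\<dots> = (\<Sum>\<^sub>\<infinity>k. f k * pmf p k)"
    using * by (subst infsetsum_infsum) (auto simp: Infinite_Set_Sum.abs_summable_on_def mult.commute)
  finally show "measure_pmf.expectation p f = (\<Sum>\<^sub>\<infinity>k. f k * pmf p k)" .
qed

section \<open>The path space of the walk and its Markov property\<close>

locale unimodal_walk =
  fixes p :: "int pmf"
  assumes p_unimodal: "sym_unimodal p"
    and p_summable: "(\<lambda>k. (real_of_int k)\<^sup>2 * pmf p k) summable_on UNIV"
    and vp_pos: "0 < vp p"
begin

sublocale step: sequence_space "measure_pmf p"
  by (intro_locales) (simp_all add: product_sigma_finite_def product_prob_space_axioms_def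
      measure_pmf.prob_space_axioms measure_pmf.sigma_finite_measure_axioms)

abbreviation "W \<equiv> walk_law p"

sublocale W: prob_space W
  unfolding walk_law_def by (rule prob_space_PiM) (rule measure_pmf.prob_space_axioms)

sublocale WW: pair_prob_space W W ..

lemma space_W [simp]: "space W = UNIV"
  by (simp add: walk_law_def space_PiM PiE_def extensional_def)

lemma sets_Collect_W:
  assumes "Measurable.pred W P"
  shows "{xs. P xs} \<in> sets W"
  using predE[OF assms] by simp

lemma measurable_coord [measurable]: "(\<lambda>xs. xs i) \<in> measurable W (count_space UNIV)"
proof -
  have "(\<lambda>xs. xs i) \<in> measurable W (measure_pmf p)"
    unfolding walk_law_def by (rule measurable_component_singleton) auto
  then show ?thesis by (simp cong: measurable_cong_sets)
qed

lemma measurable_walkS [measurable]: "(\<lambda>xs. walkS xs n) \<in> measurable W (count_space UNIV)"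
proof (induction n)
  case (Suc n)
  note [measurable] = Suc
  have "(\<lambda>xs. (\<lambda>j xs. j + xs n) (walkS xs n) xs) \<in> measurable W (count_space UNIV)"
    by (rule measurable_compose_countable) (auto intro: measurable_compose[OF measurable_coord])
  then show ?case by (simp add: walkS_Suc)
qed simp

lemma measurable_comb [measurable]:
  "(\<lambda>x. comb_seq k (fst x) (snd x)) \<in> measurable (W \<Otimes>\<^sub>M W) W"
  unfolding walk_law_def using measurable_comb_seq[of k "measure_pmf p"] by (simp add: split_beta')

lemma distr_comb: "distr (W \<Otimes>\<^sub>M W) W (\<lambda>x. comb_seq k (fst x) (snd x)) = W"
  unfolding walk_law_def using step.PiM_comb_seq[of k] by (simp add: split_beta')

text \<open>The Markov property at the fixed time \<open>k\<close>: \<open>comb_seq k\<close>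
  follows its first argument for \<open>k\<close> steps and a fresh copy afterwards, and gluing two
  independent copies reproduces the law of the walk. Iterated integrals thus replace conditional
  expectations.\<close>

lemma integral_split:
  fixes f :: "_ \<Rightarrow> real"
  assumes f: "integrable W f"
  shows "(\<integral>xs. f xs \<partial>W) = (\<integral>\<omega>. \<integral>\<omega>'. f (comb_seq k \<omega> \<omega>') \<partial>W \<partial>W)"
proof -
  note [measurable] = borel_measurable_integrable[OF f]
  have "integrable (W \<Otimes>\<^sub>M W) (\<lambda>x. f (comb_seq k (fst x) (snd x)))"
    using f by (subst (asm) distr_comb[of k, symmetric], subst (asm) integrable_distr_eq) auto
  then have "(\<integral>x. f (comb_seq k (fst x) (snd x)) \<partial>(W \<Otimes>\<^sub>M W)) = (\<integral>\<omega>. \<integral>\<omega>'. f (comb_seq k \<omega> \<omega>') \<partial>W \<partial>W)"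
    by (subst WW.integral_fst'[symmetric]) auto
  moreover have "(\<integral>xs. f xs \<partial>W) = (\<integral>x. f (comb_seq k (fst x) (snd x)) \<partial>(W \<Otimes>\<^sub>M W))"
    by (subst distr_comb[of k, symmetric], subst integral_distr) auto
  ultimately show ?thesis by simp
qed

lemma nn_integral_split:
  assumes [measurable]: "f \<in> borel_measurable W"
  shows "(\<integral>\<^sup>+xs. f xs \<partial>W) = (\<integral>\<^sup>+\<omega>. \<integral>\<^sup>+\<omega>'. f (comb_seq k \<omega> \<omega>') \<partial>W \<partial>W)"
proof -
  have "(\<integral>\<^sup>+xs. f xs \<partial>W) = (\<integral>\<^sup>+x. f (comb_seq k (fst x) (snd x)) \<partial>(W \<Otimes>\<^sub>M W))"
    by (subst distr_comb[of k, symmetric], subst nn_integral_distr) auto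
  also have "\<dots> = (\<integral>\<^sup>+\<omega>. \<integral>\<^sup>+\<omega>'. f (comb_seq k \<omega> \<omega>') \<partial>W \<partial>W)"
    by (subst W.nn_integral_fst[symmetric]) auto
  finally show ?thesis .
qed

lemma prob_split:
  assumes [measurable]: "A \<in> sets W"
  shows "W.prob A = (\<integral>\<omega>. W.prob {\<omega>'. comb_seq k \<omega> \<omega>' \<in> A} \<partial>W)"
proof -
  have "W.prob A = (\<integral>xs. indicator A xs \<partial>W)" by simp
  also have "\<dots> = (\<integral>\<omega>. \<integral>\<omega>'. indicator A (comb_seq k \<omega> \<omega>') \<partial>W \<partial>W)"
    by (rule integral_split) (auto simp: W.emeasure_eq_measure)
  also have "\<dots> = (\<integral>\<omega>. \<integral>\<omega>'. indicator {\<omega>'. comb_seq k \<omega> \<omega>' \<in> A} \<omega>' \<partial>W \<partial>W)"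
    by (simp add: indicator_def)
  finally show ?thesis by simp
qed

lemma distr_coord: "distr W (count_space UNIV) (\<lambda>xs. xs i) = measure_pmf p"
proof -
  have "distr W (measure_pmf p) (\<lambda>xs. xs i) = measure_pmf p"
    unfolding walk_law_def
    by (rule distr_PiM_component) (auto simp: measure_pmf.prob_space_axioms)
  moreover have "distr W (measure_pmf p) (\<lambda>xs. xs i) = distr W (count_space UNIV) (\<lambda>xs. xs i)"
    by (rule distr_cong) auto
  ultimately show ?thesis by simp
qed

lemma integral_coord:
  fixes f :: "int \<Rightarrow> real"
  shows "(\<integral>xs. f (xs i) \<partial>W) = measure_pmf.expectation p f"
  by (subst distr_coord[of i, symmetric], subst integral_distr) auto

lemma integrable_coord:
  fixes f :: "int \<Rightarrow> real"
  shows "integrable W (\<lambda>xs. f (xs i)) \<longleftrightarrow> integrable (measure_pmf p) f"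
  by (subst distr_coord[of i, symmetric], subst integrable_distr_eq) auto

lemma nn_integral_coord: "(\<integral>\<^sup>+xs. f (xs i) \<partial>W) = (\<integral>\<^sup>+x. f x \<partial>measure_pmf p)"
  by (subst distr_coord[of i, symmetric], subst nn_integral_distr) auto

section \<open>Law and moments of the walk, and the maximal inequality\<close>

primrec S_pmf :: "nat \<Rightarrow> int pmf" where
  "S_pmf 0 = return_pmf 0"
| "S_pmf (Suc n) = conv_pmf (S_pmf n) p"

lemma sym_unimodal_S_pmf: "sym_unimodal (S_pmf n)"
proof (induction n)
  case 0
  show ?case by (auto simp: sym_unimodal_def indicator_def)
qed (simp add: sym_unimodal_conv_pmf p_unimodal)

lemma distr_walkS: "distr W (count_space UNIV) (\<lambda>xs. walkS xs n) = measure_pmf (S_pmf n)"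
proof (induction n)
  case 0
  show ?case
    by (rule measure_eqI) (auto simp: emeasure_distr W.emeasure_space_1[simplified] indicator_def)
next
  case (Suc n)
  show ?case
  proof (rule measure_eqI)
    fix A :: "int set"
    have "emeasure (distr W (count_space UNIV) (\<lambda>xs. walkS xs (Suc n))) A
        = (\<integral>\<^sup>+xs. indicator A (walkS xs n + xs n) \<partial>W)"
      by (subst nn_integral_indicator[symmetric], simp, subst nn_integral_distr) (auto simp: walkS_Suc)
    also have "\<dots> = (\<integral>\<^sup>+\<omega>. \<integral>\<^sup>+\<omega>'. indicator A (walkS \<omega> n + \<omega>' 0) \<partial>W \<partial>W)"
      by (subst nn_integral_split[where k=n]) (auto simp: walkS_comb_seq_le comb_seq_def
        walkS_Suc[symmetric])
    also have "\<dots> = (\<integral>\<^sup>+\<omega>. \<integral>\<^sup>+y. indicator A (walkS \<omega> n + y) \<partial>measure_pmf p \<partial>W)"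
      by (intro nn_integral_cong nn_integral_coord)
    also have "\<dots> = (\<integral>\<^sup>+x. \<integral>\<^sup>+y. indicator A (x + y) \<partial>measure_pmf p \<partial>measure_pmf (S_pmf n))"
      by (subst Suc[symmetric], subst nn_integral_distr) auto
    also have "\<dots> = emeasure (measure_pmf (S_pmf (Suc n))) A"
      by (subst nn_integral_indicator[symmetric])
         (simp_all only: conv_pmf_def nn_integral_bind_pmf nn_integral_map_pmf S_pmf.simps sets_measure_pmf UNIV_I)
    finally show "emeasure (distr W (count_space UNIV) (\<lambda>xs. walkS xs (Suc n))) A
        = emeasure (measure_pmf (S_pmf (Suc n))) A" .
  qed simp
qed

lemma integral_walkS:
  fixes f :: "int \<Rightarrow> real"
  shows "(\<integral>xs. f (walkS xs n) \<partial>W) = measure_pmf.expectation (S_pmf n) f"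
  by (subst distr_walkS[of n, symmetric], subst integral_distr) auto

lemma nn_integral_walkS: "(\<integral>\<^sup>+xs. f (walkS xs n) \<partial>W) = (\<integral>\<^sup>+x. f x \<partial>measure_pmf (S_pmf n))"
  by (subst distr_walkS[of n, symmetric], subst nn_integral_distr) auto

lemma prob_walkS: "measure_pmf.prob (S_pmf n) A = W.prob {xs. walkS xs n \<in> A}"
  by (subst distr_walkS[of n, symmetric], subst measure_distr) (auto simp: vimage_def)

lemma integrable_sq: "integrable (measure_pmf p) (\<lambda>k. (real_of_int k)\<^sup>2)"
  and expectation_sq: "measure_pmf.expectation p (\<lambda>k. (real_of_int k)\<^sup>2) = vp p"
  unfolding vp_def
  using integrable_measure_pmf_of_summable_on[OF p_summable] expectation_eq_infsum[OF p_summable]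
  by auto

lemma integrable_of_int: "integrable (measure_pmf p) real_of_int"
  by (rule measure_pmf.square_integrable_imp_integrable[OF _ integrable_sq]) simp

lemma integrable_abs_p: "integrable (measure_pmf p) (\<lambda>k. \<bar>real_of_int k\<bar>)"
  by (intro integrable_abs integrable_of_int)

lemma expectation_abs: "measure_pmf.expectation p (\<lambda>k. \<bar>real_of_int k\<bar>) = mbar p"
  unfolding mbar_def
proof (rule expectation_eq_infsum)
  show "(\<lambda>k. \<bar>real_of_int k\<bar> * pmf p k) summable_on UNIV"
  proof (rule summable_on_comparison_test[OF p_summable])
    show "\<bar>real_of_int k\<bar> * pmf p k \<le> (real_of_int k)\<^sup>2 * pmf p k" for k
    proof (rule mult_right_mono)
      have "\<bar>k\<bar> * 1 \<le> \<bar>k\<bar> * \<bar>k\<bar>" by (cases "k = 0") (use mult_left_mono[of 1 "\<bar>k\<bar>" "\<bar>k\<bar>"] in auto)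
      then have "real_of_int \<bar>k\<bar> \<le> real_of_int (\<bar>k\<bar> * \<bar>k\<bar>)" by linarith
      then show "\<bar>real_of_int k\<bar> \<le> (real_of_int k)\<^sup>2" by (simp add: power2_eq_square)
    qed simp
  qed auto
qed auto

lemma mbar_pos: "0 < mbar p"
proof -
  have "mbar p \<ge> 0" unfolding expectation_abs[symmetric] by simp
  moreover have "mbar p \<noteq> 0"
  proof
    assume "mbar p = 0"
    then have "AE k in measure_pmf p. \<bar>real_of_int k\<bar> = 0"
      unfolding expectation_abs[symmetric]
      by (subst (asm) integral_nonneg_eq_0_iff_AE[OF integrable_abs_p]) auto
    then have "AE k in measure_pmf p. (real_of_int k)\<^sup>2 = 0" by auto
    then have "vp p = (\<integral>k. 0 \<partial>measure_pmf p)"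
      unfolding expectation_sq[symmetric] by (intro integral_cong_AE) auto
    then show False using vp_pos by simp
  qed
  ultimately show ?thesis by simp
qed

lemma expectation_step: "measure_pmf.expectation p real_of_int = 0"
proof -
  have "map_pmf uminus p = p"
  proof (rule pmf_eqI)
    show "pmf (map_pmf uminus p) k = pmf p k" for k
      using pmf_map_inj'[of uminus p "- k"] p_unimodal by (simp add: sym_unimodal_def)
  qed
  then have "measure_pmf.expectation p real_of_int = measure_pmf.expectation (map_pmf uminus p) real_of_int"
    by simp
  also have "\<dots> = - measure_pmf.expectation p real_of_int"
    by (simp del: of_int_minus add: of_int_minus)
  finally show ?thesis by simp
qed

lemma integrable_walkS_sq: "integrable W (\<lambda>xs. (real_of_int (walkS xs n))\<^sup>2)"
proof (induction n)
  case (Suc n)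
  have "integrable W (\<lambda>xs. 2 * (real_of_int (walkS xs n))\<^sup>2 + 2 * (real_of_int (xs n))\<^sup>2)"
    using Suc integrable_coord[of "\<lambda>k. (real_of_int k)\<^sup>2" n] integrable_sq by auto
  then show ?case
  proof (rule Bochner_Integration.integrable_bound)
    show "AE xs in W. norm ((real_of_int (walkS xs (Suc n)))\<^sup>2)
        \<le> norm (2 * (real_of_int (walkS xs n))\<^sup>2 + 2 * (real_of_int (xs n))\<^sup>2)"
    proof (intro AE_I2)
      fix xs
      have "(a + b)\<^sup>2 \<le> 2 * a\<^sup>2 + 2 * b\<^sup>2" for a b :: real
        using sum_squares_bound[of a b] by (simp add: power2_sum)
      then show "norm ((real_of_int (walkS xs (Suc n)))\<^sup>2)
        \<le> norm (2 * (real_of_int (walkS xs n))\<^sup>2 + 2 * (real_of_int (xs n))\<^sup>2)"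
        by (simp add: walkS_Suc)
    qed
  qed measurable
qed simp

lemma integrable_walkS: "integrable W (\<lambda>xs. real_of_int (walkS xs n))"
  by (rule W.square_integrable_imp_integrable[OF _ integrable_walkS_sq]) measurable

lemma expectation_walkS_sq: "(\<integral>xs. (real_of_int (walkS xs n))\<^sup>2 \<partial>W) = real n * vp p"
proof (induction n)
  case (Suc n)
  have "(\<integral>xs. (real_of_int (walkS xs (Suc n)))\<^sup>2 \<partial>W)
      = (\<integral>\<omega>. \<integral>\<omega>'. (real_of_int (walkS \<omega> n + \<omega>' 0))\<^sup>2 \<partial>W \<partial>W)"
    by (subst integral_split[OF integrable_walkS_sq, where k=n])
       (simp add: walkS_Suc walkS_comb_seq_le comb_seq_def)
  also have "\<dots> = (\<integral>\<omega>. (real_of_int (walkS \<omega> n))\<^sup>2 + vp p \<partial>W)"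
  proof (intro Bochner_Integration.integral_cong refl)
    fix \<omega>
    have "(\<integral>\<omega>'. (real_of_int (walkS \<omega> n + \<omega>' 0))\<^sup>2 \<partial>W)
        = measure_pmf.expectation p (\<lambda>k. (real_of_int (walkS \<omega> n + k))\<^sup>2)"
      by (rule integral_coord)
    also have "\<dots> = measure_pmf.expectation p (\<lambda>k. (real_of_int (walkS \<omega> n))\<^sup>2 + (real_of_int k)\<^sup>2
        + (2 * real_of_int (walkS \<omega> n)) * real_of_int k)"
      by (simp add: power2_sum)
    also have "\<dots> = (real_of_int (walkS \<omega> n))\<^sup>2 + vp p"
      using integrable_sq integrable_of_int
      by (simp add: expectation_sq expectation_step measure_pmf.prob_space[simplified])
    finally show "(\<integral>\<omega>'. (real_of_int (walkS \<omega> n + \<omega>' 0))\<^sup>2 \<partial>W) = (real_of_int (walkS \<omega> n))\<^sup>2 + vp p" .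
  qed
  also have "\<dots> = real (Suc n) * vp p"
    using integrable_walkS_sq[of n] Suc by (simp add: W.prob_space[simplified] algebra_simps)
  finally show ?case .
qed simp

text \<open>The quotient is constantly \<open>vp p\<close> from \<open>n = 1\<close> on; at
  \<open>n = 0\<close> it is 0 by the convention for division by zero, so the equality holds only
  eventually.\<close>

lemma m2_eq_vp: "m2 p = vp p"
proof -
  have "(\<lambda>n. (\<integral>xs. (real_of_int (walkS xs n))\<^sup>2 \<partial>W) / real n) \<longlonglongrightarrow> vp p"
    by (rule tendsto_eventually) (auto simp: eventually_sequentially expectation_walkS_sq intro!: exI[of _ 1])
  then show ?thesis unfolding m2_def by (rule limI)
qed

text \<open>The variance of the absolute value is nonnegative.\<close>

lemma expectation_abs_walkS: "(\<integral>xs. \<bar>real_of_int (walkS xs n)\<bar> \<partial>W) \<le> sqrt (real n * vp p)"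
proof -
  have "0 \<le> W.variance (\<lambda>xs. \<bar>real_of_int (walkS xs n)\<bar>)"
    by (rule W.variance_positive)
  also have "\<dots> = real n * vp p - (\<integral>xs. \<bar>real_of_int (walkS xs n)\<bar> \<partial>W)\<^sup>2"
    by (subst W.variance_eq)
       (auto simp: expectation_walkS_sq integrable_walkS_sq intro!: integrable_abs integrable_walkS)
  finally show ?thesis by (intro real_le_rsqrt) simp
qed

text \<open>Letting the walk start anywhere makes the bound provable by induction on \<open>n\<close>, conditioning on
  the first step, without a stopping time.\<close>

lemma kolmogorov_maximal:
  fixes x l :: real
  assumes l: "0 < l"
  shows "W.prob {xs. \<exists>k\<le>n. \<bar>x + real_of_int (walkS xs k)\<bar> \<ge> l} \<le> (x\<^sup>2 + real n * vp p) / l\<^sup>2"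
proof (induction n arbitrary: x)
  case 0
  show ?case
  proof (cases "\<bar>x\<bar> \<ge> l")
    case True
    then have "l\<^sup>2 \<le> x\<^sup>2" using l by (metis abs_le_square_iff abs_of_pos)
    then have "1 \<le> x\<^sup>2 / l\<^sup>2" using l by simp
    then show ?thesis by (intro order_trans[OF W.prob_le_1]) simp
  qed (use l in auto)
next
  case (Suc n)
  show ?case
  proof (cases "\<bar>x\<bar> \<ge> l")
    case True
    then have "l\<^sup>2 \<le> x\<^sup>2" using l by (metis abs_le_square_iff abs_of_pos)
    then have "l\<^sup>2 \<le> x\<^sup>2 + real (Suc n) * vp p" using vp_pos by (simp add: add_increasing2)
    then have "1 \<le> (x\<^sup>2 + real (Suc n) * vp p) / l\<^sup>2" using l by simp
    then show ?thesis by (rule order_trans[OF W.prob_le_1])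
  next
    case False
    let ?A = "{xs. \<exists>k\<le>Suc n. \<bar>x + real_of_int (walkS xs k)\<bar> \<ge> l}"
    have [measurable]: "?A \<in> sets W" by (rule sets_Collect_W) measurable
    have eq: "comb_seq 1 \<omega> \<omega>' \<in> ?A \<longleftrightarrow> (\<exists>k\<le>n. \<bar>(x + real_of_int (\<omega> 0)) + real_of_int (walkS \<omega>' k)\<bar> \<ge> l)" for \<omega> \<omega>'
    proof -
      have *: "walkS (comb_seq 1 \<omega> \<omega>') (Suc k) = \<omega> 0 + walkS \<omega>' k" for k
        using walkS_comb_seq_add[of 1 \<omega> \<omega>' k] by (simp add: walkS_Suc)
      have "comb_seq 1 \<omega> \<omega>' \<in> ?A \<longleftrightarrow> (\<exists>k\<le>n. \<bar>x + real_of_int (walkS (comb_seq 1 \<omega> \<omega>') (Suc k))\<bar> \<ge> l)"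
      proof
        assume "comb_seq 1 \<omega> \<omega>' \<in> ?A"
        then obtain k where k: "k \<le> Suc n" "\<bar>x + real_of_int (walkS (comb_seq 1 \<omega> \<omega>') k)\<bar> \<ge> l" by auto
        have "k \<noteq> 0" using k(2) False by (intro notI) simp
        with k show "\<exists>k\<le>n. \<bar>x + real_of_int (walkS (comb_seq 1 \<omega> \<omega>') (Suc k))\<bar> \<ge> l"
          by (cases k) auto
      next
        assume "\<exists>k\<le>n. \<bar>x + real_of_int (walkS (comb_seq 1 \<omega> \<omega>') (Suc k))\<bar> \<ge> l"
        then obtain k where "k \<le> n" "\<bar>x + real_of_int (walkS (comb_seq 1 \<omega> \<omega>') (Suc k))\<bar> \<ge> l" by blast
        then show "comb_seq 1 \<omega> \<omega>' \<in> ?A" by (intro CollectI exI[of _ "Suc k"]) simp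
      qed
      then show ?thesis by (simp only: * of_int_add add.assoc)
    qed
    \<comment> \<open>The induction hypothesis after a first step \<open>k\<close>, as a function of
      that step. Averaging over \<open>p\<close> removes the linear term, since the step is centred,
      and the square contributes the one additional \<open>vp p\<close>.\<close>
    let ?h = "\<lambda>k. ((x + real_of_int k)\<^sup>2 + real n * vp p) / l\<^sup>2"
    have h: "?h = (\<lambda>k. (x\<^sup>2 + real n * vp p) / l\<^sup>2 + (1 / l\<^sup>2) * (real_of_int k)\<^sup>2 + (2 * x / l\<^sup>2) * real_of_int k)"
      by (rule ext) (simp add: power2_sum add_divide_distrib)
    have h_int: "integrable (measure_pmf p) ?h"
      unfolding h using integrable_sq integrable_of_int by auto
    have "measure_pmf.expectation p ?h = (x\<^sup>2 + real n * vp p) / l\<^sup>2 + (1 / l\<^sup>2) * vp p + (2 * x / l\<^sup>2) * 0"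
      unfolding h using integrable_sq integrable_of_int
      by (simp add: expectation_sq expectation_step measure_pmf.prob_space[simplified])
    then have h_exp: "measure_pmf.expectation p ?h = (x\<^sup>2 + real (Suc n) * vp p) / l\<^sup>2"
      by (simp add: add_divide_distrib distrib_right)
    have int: "integrable W (\<lambda>\<omega>. ((x + real_of_int (\<omega> 0))\<^sup>2 + real n * vp p) / l\<^sup>2)"
      using integrable_coord[of ?h 0] h_int by simp
    have "W.prob ?A = (\<integral>\<omega>. W.prob {\<omega>'. comb_seq 1 \<omega> \<omega>' \<in> ?A} \<partial>W)"
      by (rule prob_split) simp
    also have "\<dots> \<le> (\<integral>\<omega>. ((x + real_of_int (\<omega> 0))\<^sup>2 + real n * vp p) / l\<^sup>2 \<partial>W)"
    proof (rule integral_mono[OF _ int])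
      show "W.prob {\<omega>'. comb_seq 1 \<omega> \<omega>' \<in> ?A} \<le> ((x + real_of_int (\<omega> 0))\<^sup>2 + real n * vp p) / l\<^sup>2" for \<omega>
        unfolding eq by (rule Suc)
      show "integrable W (\<lambda>\<omega>. W.prob {\<omega>'. comb_seq 1 \<omega> \<omega>' \<in> ?A})"
        unfolding eq
        by (subst integrable_coord[of "\<lambda>y. W.prob {\<omega>'. \<exists>k\<le>n. \<bar>(x + real_of_int y) + real_of_int (walkS \<omega>' k)\<bar> \<ge> l}"])
           (auto intro!: measure_pmf.integrable_const_bound[where B=1])
    qed
    also have "\<dots> = (x\<^sup>2 + real (Suc n) * vp p) / l\<^sup>2"
      unfolding integral_coord[of ?h 0] by (rule h_exp)
    finally show ?thesis .
  qed
qed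

section \<open>Central limit theorem for the walk and small-ball probabilities\<close>

lemma walkS_clt:
  "weak_conv_m (\<lambda>n. distr W borel (\<lambda>xs. real_of_int (walkS xs n) / sqrt (real n * vp p)))
     std_normal_distribution"
proof -
  have vp: "(sqrt (vp p))\<^sup>2 = vp p" using vp_pos by simp
  have mean0: "W.expectation (\<lambda>xs. real_of_int (xs i)) = 0" for i
    by (subst integral_coord) (rule expectation_step)
  have "weak_conv_m (\<lambda>n. distr W borel (\<lambda>xs. (\<Sum>i<n. real_of_int (xs i)) / sqrt (real n * (sqrt (vp p))\<^sup>2)))
     std_normal_distribution"
  proof (rule W.central_limit_theorem_zero_mean)
    show "W.indep_vars (\<lambda>i. borel) (\<lambda>i xs. real_of_int (xs i)) UNIV"
      unfolding walk_law_def
      by (rule prob_space.indep_vars_compose2[OF _ indep_vars_PiM_coordinates])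
         (auto intro: prob_space_PiM measure_pmf.prob_space_axioms)
    show "distr W borel (\<lambda>xs. real_of_int (xs i)) = distr (measure_pmf p) borel real_of_int" for i
      by (subst distr_coord[of i, symmetric], subst distr_distr) (auto simp: comp_def)
    show "integrable W (\<lambda>xs. (real_of_int (xs i))\<^sup>2)" for i
      using integrable_coord[of "\<lambda>k. (real_of_int k)\<^sup>2" i] integrable_sq by simp
    show "W.variance (\<lambda>xs. real_of_int (xs i)) = (sqrt (vp p))\<^sup>2" for i
      using integral_coord[of "\<lambda>k. (real_of_int k)\<^sup>2" i] by (simp add: vp mean0 expectation_sq)
  qed (use vp_pos mean0 in auto)
  then show ?thesis by (simp add: vp walkS_def)
qed

lemma isCont_cdf_std_normal: "isCont (cdf std_normal_distribution) x"
proof -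
  interpret real_distribution std_normal_distribution by (rule real_dist_normal_dist)
  have "emeasure std_normal_distribution {x} = 0"
    by (subst emeasure_density) (auto simp: nn_integral_indicator_singleton)
  then show ?thesis by (simp add: isCont_cdf measure_def)
qed

text \<open>A substitute for a local limit theorem: the normal limit has no atom at 0, so a small
  interval around 0 has small limiting probability, and at the scale sqrt(m) the walk inherits
  this.\<close>

lemma walkS_anticoncentration:
  assumes \<kappa>: "\<kappa> > 0"
  obtains \<delta> m0 where "\<delta> > 0"
    "\<And>m. m \<ge> m0 \<Longrightarrow> W.prob {xs. \<bar>real_of_int (walkS xs m)\<bar> \<le> \<delta> * sqrt (real m)} \<le> \<kappa>"
proof -
  let ?N = std_normal_distribution
  let ?Z = "\<lambda>n xs. real_of_int (walkS xs n) / sqrt (real n * vp p)"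
  let ?D = "\<lambda>n. distr W borel (?Z n)"
  have "\<kappa> / 4 > 0" using \<kappa> by simp
  then have "\<exists>d>0. \<forall>y. \<bar>y - 0\<bar> < d \<longrightarrow> \<bar>cdf ?N y - cdf ?N 0\<bar> < \<kappa> / 4"
    using isCont_cdf_std_normal[of 0] unfolding continuous_at_eps_delta dist_real_def by blast
  then obtain d where d: "d > 0" "\<And>y. \<bar>y\<bar> < d \<Longrightarrow> \<bar>cdf ?N y - cdf ?N 0\<bar> < \<kappa> / 4" by auto
  define s where "s = d / 2"
  have s: "s > 0" "\<bar>s\<bar> < d" "\<bar>- s\<bar> < d" using d by (auto simp: s_def)
  have lt: "cdf ?N s - cdf ?N (- s) < \<kappa>" using d(2)[OF s(2)] d(2)[OF s(3)] \<kappa> by linarith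
  have "(\<lambda>n. cdf (?D n) s - cdf (?D n) (- s)) \<longlonglongrightarrow> cdf ?N s - cdf ?N (- s)"
    using walkS_clt isCont_cdf_std_normal unfolding weak_conv_m_def weak_conv_def
    by (intro tendsto_diff) auto
  from order_tendstoD(2)[OF this lt] obtain m0 where
    m0: "\<And>m. m \<ge> m0 \<Longrightarrow> cdf (?D m) s - cdf (?D m) (- s) < \<kappa>"
    by (auto simp: eventually_sequentially)
  \<comment> \<open>Halving \<open>s\<close> puts the closed event inside the half-open interval
    \<open>{-s<..s}\<close>, whose probability is a difference of two values of the distribution
    function.\<close>
  define \<delta> where "\<delta> = s / 2 * sqrt (vp p)"
  have "\<delta> > 0" using s vp_pos by (simp add: \<delta>_def)
  moreover have "W.prob {xs. \<bar>real_of_int (walkS xs m)\<bar> \<le> \<delta> * sqrt (real m)} \<le> \<kappa>"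
    if m: "m \<ge> Suc m0" for m
  proof -
    interpret Dm: real_distribution "?D m"
      by (rule W.real_distribution_distr) measurable
    have r: "sqrt (real m * vp p) > 0" using m vp_pos by simp
    have "{xs. \<bar>real_of_int (walkS xs m)\<bar> \<le> \<delta> * sqrt (real m)} \<subseteq> ?Z m -` {-s<..s} \<inter> space W"
    proof
      fix xs assume "xs \<in> {xs. \<bar>real_of_int (walkS xs m)\<bar> \<le> \<delta> * sqrt (real m)}"
      then have "\<bar>?Z m xs\<bar> \<le> s / 2"
        using r by (simp add: \<delta>_def pos_divide_le_eq real_sqrt_mult mult_ac)
      then have "?Z m xs \<in> {-s<..s}" using s(1) unfolding greaterThanAtMost_iff by linarith
      then show "xs \<in> ?Z m -` {-s<..s} \<inter> space W" by (simp only: vimage_eq space_W Int_UNIV_right)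
    qed
    then have "W.prob {xs. \<bar>real_of_int (walkS xs m)\<bar> \<le> \<delta> * sqrt (real m)} \<le> W.prob (?Z m -` {-s<..s} \<inter> space W)"
      by (rule W.finite_measure_mono) (rule measurable_sets[of _ _ borel], auto)
    also have "\<dots> = measure (?D m) {-s<..s}" by (subst measure_distr) auto
    also have "\<dots> = cdf (?D m) s - cdf (?D m) (- s)"
      using s by (intro Dm.cdf_diff_eq[symmetric]) auto
    also have "\<dots> \<le> \<kappa>" using m0[of m] m by simp
    finally show ?thesis .
  qed
  ultimately show ?thesis using that by blast
qed

lemma S_pmf_0_tendsto: "(\<lambda>n. pmf (S_pmf n) 0) \<longlonglongrightarrow> 0"
proof (rule tendstoI)
  fix e :: real assume "e > 0"
  then have "e / 2 > 0" by simp
  obtain \<delta> m0 where \<delta>: "\<delta> > 0"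
    and m0: "\<And>m. m \<ge> m0 \<Longrightarrow> W.prob {xs. \<bar>real_of_int (walkS xs m)\<bar> \<le> \<delta> * sqrt (real m)} \<le> e / 2"
    using walkS_anticoncentration[OF \<open>e / 2 > 0\<close>] by metis
  have "pmf (S_pmf m) 0 < e" if "m \<ge> m0" for m
  proof -
    have "pmf (S_pmf m) 0 = W.prob {xs. walkS xs m \<in> {0}}"
      by (subst prob_walkS[symmetric]) (simp add: measure_pmf_single)
    also have "\<dots> \<le> W.prob {xs. \<bar>real_of_int (walkS xs m)\<bar> \<le> \<delta> * sqrt (real m)}"
      using \<delta> by (intro W.finite_measure_mono sets_Collect_W) auto
    also have "\<dots> \<le> e / 2" by (rule m0) fact
    finally show ?thesis using \<open>e > 0\<close> by simp
  qed
  then show "\<forall>\<^sub>F n in sequentially. dist (pmf (S_pmf n) 0) 0 < e"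
    by (auto simp: eventually_sequentially)
qed

section \<open>Decay of correlations along the walk\<close>

lemma covariance_bound:
  fixes g :: "int \<Rightarrow> real"
  assumes B: "\<And>i. \<bar>g i\<bar> \<le> B" and kl: "k \<le> l"
  shows "\<bar>\<integral>xs. g (walkS xs k) * g (walkS xs l) \<partial>W\<bar>
    \<le> B * (\<integral>xs. \<bar>measure_pmf.expectation (S_pmf (l - k)) (\<lambda>i. g (walkS xs k + i))\<bar> \<partial>W)"
proof -
  let ?H = "\<lambda>j. measure_pmf.expectation (S_pmf (l - k)) (\<lambda>i. g (j + i))"
  have B0: "B \<ge> 0" using B[of 0] by linarith
  have H: "\<bar>?H j\<bar> \<le> B" for j
  proof -
    have "\<bar>?H j\<bar> \<le> (\<integral>i. \<bar>g (j + i)\<bar> \<partial>S_pmf (l - k))" by (rule integral_abs_bound)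
    also have "\<dots> \<le> (\<integral>i. B \<partial>S_pmf (l - k))"
      by (intro integral_mono measure_pmf.integrable_const_bound[where B=B]) (auto simp: B B0)
    finally show ?thesis by simp
  qed
  have gg: "\<bar>g i * g j\<bar> \<le> B * B" for i j
    unfolding abs_mult by (intro mult_mono B) (auto simp: B0)
  have int: "integrable W (\<lambda>xs. g (walkS xs k) * g (walkS xs l))"
    by (rule W.integrable_const_bound[where B="B * B"]) (auto simp: gg)
  \<comment> \<open>Split the path at time \<open>k\<close>: given the past, the second factor
    averages to \<open>?H\<close> at the present site, and the first factor is then estimated by
    \<open>B\<close>.\<close>
  have "(\<integral>xs. g (walkS xs k) * g (walkS xs l) \<partial>W)
      = (\<integral>\<omega>. \<integral>\<omega>'. g (walkS \<omega> k) * g (walkS \<omega> k + walkS \<omega>' (l - k)) \<partial>W \<partial>W)"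
    using kl walkS_comb_seq_add[of k _ _ "l - k"]
    by (subst integral_split[OF int, where k=k]) (simp add: walkS_comb_seq_le)
  also have "\<dots> = (\<integral>\<omega>. g (walkS \<omega> k) * ?H (walkS \<omega> k) \<partial>W)"
    by (simp add: integral_walkS[where f="\<lambda>i. g (_ + i)"])
  also have "\<bar>\<dots>\<bar> \<le> (\<integral>\<omega>. \<bar>g (walkS \<omega> k) * ?H (walkS \<omega> k)\<bar> \<partial>W)" by (rule integral_abs_bound)
  also have "\<dots> \<le> (\<integral>\<omega>. B * \<bar>?H (walkS \<omega> k)\<bar> \<partial>W)"
  proof (intro integral_mono)
    show "integrable W (\<lambda>\<omega>. \<bar>g (walkS \<omega> k) * ?H (walkS \<omega> k)\<bar>)"
    proof (rule W.integrable_const_bound[where B="B * B"])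
      show "AE \<omega> in W. norm \<bar>g (walkS \<omega> k) * ?H (walkS \<omega> k)\<bar> \<le> B * B"
        by (auto simp: abs_mult intro!: mult_mono B H B0)
    qed (rule measurable_compose[OF measurable_walkS], simp)
    show "integrable W (\<lambda>\<omega>. B * \<bar>?H (walkS \<omega> k)\<bar>)"
    proof (intro integrable_mult_right, rule W.integrable_const_bound[where B="B"])
      show "AE \<omega> in W. norm \<bar>?H (walkS \<omega> k)\<bar> \<le> B" by (auto simp: H)
    qed (rule measurable_compose[OF measurable_walkS], simp)
    show "\<bar>g (walkS \<omega> k) * ?H (walkS \<omega> k)\<bar> \<le> B * \<bar>?H (walkS \<omega> k)\<bar>" for \<omega>
      unfolding abs_mult by (intro mult_right_mono B) auto
  qed
  finally show ?thesis by simp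
qed

text \<open>The window estimate is applied to the law of the last \<open>m\<close> steps, started at
  the site reached at time \<open>k\<close>. Its error is linear in the distance of that site from
  0, whose mean is at most sqrt(n vp) by the second moment.\<close>

lemma covariance_bound_window:
  fixes g :: "int \<Rightarrow> real"
  assumes B: "\<And>i. \<bar>g i\<bar> \<le> B" and C: "C \<ge> 0" and \<eta>: "\<eta> > 0" and \<delta>: "\<delta> > 0"
    and window: "\<And>a b. \<bar>\<Sum>i\<in>{a..b}. g i\<bar> \<le> \<eta> * (\<bar>real_of_int a\<bar> + \<bar>real_of_int b\<bar>) + C"
    and anti: "W.prob {xs. \<bar>real_of_int (walkS xs m)\<bar> \<le> \<delta> * sqrt (real m)} \<le> \<kappa>"
    and m: "m > 0" and kn: "k \<le> n"
  shows "\<bar>\<integral>xs. g (walkS xs k) * g (walkS xs (k + m)) \<partial>W\<bar>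
    \<le> B * (\<eta> + (2 * \<eta> * sqrt (real n * vp p) + C) / (\<delta> * sqrt (real m)) + B * \<kappa>)"
proof -
  have B0: "B \<ge> 0" using B[of 0] by linarith
  let ?H = "\<lambda>j. measure_pmf.expectation (S_pmf m) (\<lambda>i. g (j + i))"
  let ?s = "\<delta> * sqrt (real m)"
  have s: "?s > 0" using \<delta> m by simp
  \<comment> \<open>This radius serves both sides: \<open>R \<le> \<delta> * sqrt m\<close> lets the
    small-ball bound control the short windows, and \<open>\<delta> * sqrt m \<le> 2 * R + 1\<close>
    bounds the length of the long ones from below.\<close>
  define R where "R = nat \<lfloor>?s\<rfloor>"
  have "0 \<le> \<lfloor>?s\<rfloor>" using s by simp
  then have "real R = real_of_int \<lfloor>?s\<rfloor>" by (simp add: R_def)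
  then have R: "real R \<le> ?s" "?s \<le> real (2 * R + 1)" using s by linarith+
  have PR: "measure_pmf.prob (S_pmf m) {i. \<bar>i\<bar> \<le> int R} \<le> \<kappa>"
  proof -
    have "measure_pmf.prob (S_pmf m) {i. \<bar>i\<bar> \<le> int R} = W.prob {xs. \<bar>walkS xs m\<bar> \<le> int R}"
      by (simp add: prob_walkS)
    also have "\<dots> \<le> W.prob {xs. \<bar>real_of_int (walkS xs m)\<bar> \<le> ?s}"
    proof (intro W.finite_measure_mono sets_Collect_W)
      show "{xs. \<bar>walkS xs m\<bar> \<le> int R} \<subseteq> {xs. \<bar>real_of_int (walkS xs m)\<bar> \<le> ?s}"
      proof (rule Collect_mono, rule impI)
        fix xs assume "\<bar>walkS xs m\<bar> \<le> int R"
        then have "real_of_int \<bar>walkS xs m\<bar> \<le> real_of_int (int R)" by (simp only: of_int_le_iff)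
        then show "\<bar>real_of_int (walkS xs m)\<bar> \<le> ?s" using R(1) by simp
      qed
    qed measurable
    finally show ?thesis using anti by simp
  qed
  have H: "\<bar>?H j\<bar> \<le> (\<eta> + C / ?s + B * \<kappa>) + 2 * \<eta> / ?s * \<bar>real_of_int j\<bar>" for j
  proof -
    have "\<bar>?H j\<bar> \<le> \<eta> + (2 * \<eta> * \<bar>real_of_int j\<bar> + C) / real (2 * R + 1)
        + B * measure_pmf.prob (S_pmf m) {i. \<bar>i\<bar> \<le> int R}"
      by (rule sym_unimodal_expectation_window[OF sym_unimodal_S_pmf B C \<eta> window])
    also have "\<dots> \<le> \<eta> + (2 * \<eta> * \<bar>real_of_int j\<bar> + C) / ?s + B * \<kappa>"
      using R s C \<eta> PR B0 \<delta> m by (intro add_mono divide_left_mono mult_left_mono mult_pos_pos) auto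
    finally show ?thesis by (simp add: add_divide_distrib)
  qed
  have "\<bar>\<integral>xs. g (walkS xs k) * g (walkS xs (k + m)) \<partial>W\<bar> \<le> B * (\<integral>xs. \<bar>?H (walkS xs k)\<bar> \<partial>W)"
    using covariance_bound[of g B k "k + m"] B by simp
  also have "(\<integral>xs. \<bar>?H (walkS xs k)\<bar> \<partial>W)
      \<le> (\<integral>xs. (\<eta> + C / ?s + B * \<kappa>) + 2 * \<eta> / ?s * \<bar>real_of_int (walkS xs k)\<bar> \<partial>W)"
  proof (rule integral_mono')
    show "integrable W (\<lambda>xs. (\<eta> + C / ?s + B * \<kappa>) + 2 * \<eta> / ?s * \<bar>real_of_int (walkS xs k)\<bar>)"
      using integrable_walkS by auto
  qed (use H order_trans[OF abs_ge_zero H] in auto)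
  also have "\<dots> = (\<eta> + C / ?s + B * \<kappa>) + 2 * \<eta> / ?s * (\<integral>xs. \<bar>real_of_int (walkS xs k)\<bar> \<partial>W)"
    using integrable_walkS by (simp add: W.prob_space[simplified])
  also have "\<dots> \<le> (\<eta> + C / ?s + B * \<kappa>) + 2 * \<eta> / ?s * sqrt (real n * vp p)"
  proof (intro add_left_mono mult_left_mono)
    show "(\<integral>xs. \<bar>real_of_int (walkS xs k)\<bar> \<partial>W) \<le> sqrt (real n * vp p)"
      using kn vp_pos by (intro order_trans[OF expectation_abs_walkS]) simp
  qed (use s \<eta> in auto)
  also have "\<dots> = \<eta> + (2 * \<eta> * sqrt (real n * vp p) + C) / ?s + B * \<kappa>"
    by (simp add: add_divide_distrib)
  finally show ?thesis using B0 by (simp add: mult_left_mono)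
qed

end

section \<open>Additive functionals of the walk\<close>

text \<open>Along the row \<open>k\<close> each lag below \<open>n\<close> occurs at most twice,
  once on each side of the diagonal.\<close>

lemma sum_abs_diff_le:
  fixes \<phi> :: "nat \<Rightarrow> real"
  assumes \<phi>: "\<And>m. 0 \<le> \<phi> m" and k: "k < n"
  shows "(\<Sum>l<n. \<phi> (if k \<le> l then l - k else k - l)) \<le> 2 * (\<Sum>m<n. \<phi> m)"
proof -
  have "{..<n} = {..<k} \<union> {k..<n}" using k by auto
  then have "(\<Sum>l<n. \<phi> (if k \<le> l then l - k else k - l))
      = (\<Sum>l<k. \<phi> (k - l)) + (\<Sum>l\<in>{k..<n}. \<phi> (l - k))"
    by (simp add: sum.union_disjoint ivl_disj_int)
  also have "(\<Sum>l<k. \<phi> (k - l)) = (\<Sum>m\<in>{1..k}. \<phi> m)"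
    by (rule sum.reindex_bij_witness[of _ "\<lambda>m. k - m" "\<lambda>l. k - l"]) auto
  also have "\<dots> \<le> (\<Sum>m<n. \<phi> m)"
    using k by (intro sum_mono2) (auto simp: \<phi>)
  also have "(\<Sum>l\<in>{k..<n}. \<phi> (l - k)) = (\<Sum>m<n - k. \<phi> m)"
    using k by (intro sum.reindex_bij_witness[of _ "\<lambda>m. k + m" "\<lambda>l. l - k"]) auto
  also have "\<dots> \<le> (\<Sum>m<n. \<phi> m)"
    by (intro sum_mono2) (auto simp: \<phi>)
  finally show ?thesis by simp
qed

text \<open>The term at \<open>m = 0\<close> is 0 by the convention for division by zero, which is
  what lets the sharper bound up to \<open>Suc n\<close> start its induction at
  \<open>n = 0\<close>. The induction step is \<open>(?b - ?a)\<^sup>2 \<ge> 0\<close> with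
  \<open>?b * ?b = ?a * ?a + 1\<close>.\<close>

lemma sum_inverse_sqrt_le: "(\<Sum>m<n. 1 / sqrt (real m)) \<le> 2 * sqrt (real n)"
proof -
  have "(\<Sum>m<Suc n. 1 / sqrt (real m)) \<le> 2 * sqrt (real n)" for n
  proof (induction n)
    case (Suc n)
    let ?a = "sqrt (real n)" and ?b = "sqrt (real (Suc n))"
    have b: "?b > 0" by simp
    have "?a * ?a = real n" "?b * ?b = real n + 1" by simp_all
    moreover have "0 \<le> ?b * ?b - 2 * (?a * ?b) + ?a * ?a"
      using zero_le_power2[of "?b - ?a"] by (simp only: power2_eq_square algebra_simps)
    ultimately have "2 * ?a * ?b + 1 \<le> 2 * ?b * ?b" unfolding mult.assoc by linarith
    then have "(2 * ?a + 1 / ?b) * ?b \<le> (2 * ?b) * ?b" using b by (simp add: distrib_right)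
    then have "2 * ?a + 1 / ?b \<le> 2 * ?b" using b by (simp only: mult_le_cancel_right_pos)
    with Suc show ?case by simp
  qed simp
  then have "(\<Sum>m<Suc n. 1 / sqrt (real m)) \<le> 2 * sqrt (real n)" .
  then show ?thesis by simp (smt (verit) divide_nonneg_nonneg real_sqrt_ge_zero of_nat_0_le_iff)
qed

context unimodal_walk
begin

text \<open>Expanding the square gives n^2 correlations. Each row sums to at most twice the sum of a
  majorant \<open>\<phi> n\<close> over the lags, and that sum is a small multiple of
  \<open>n\<close> because the inverse square roots add up to at most 2 sqrt(n).\<close>

lemma additive_functional_L2:
  fixes g :: "int \<Rightarrow> real"
  assumes B: "\<And>i. \<bar>g i\<bar> \<le> B" and mean: "has_window_mean g 0"
  shows "(\<lambda>n. (\<integral>xs. (\<Sum>k<n. g (walkS xs k))\<^sup>2 \<partial>W) / (real n)\<^sup>2) \<longlonglongrightarrow> 0"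
proof (rule tendstoI)
  fix e :: real assume e: "e > 0"
  define b where "b = B + 1"
  have b: "b > 0" using B[of 0] by (simp add: b_def)
  have gb: "\<bar>g i\<bar> \<le> b" for i using B[of i] by (simp add: b_def)
  \<comment> \<open>The order of choices matters: \<kappa> determines \<delta> and
    \<open>m0\<close>, then \<eta> may depend on \<delta>, and \<open>C\<close> on \<eta>. For large
    \<open>n\<close> the bound approaches 2 b^2 \<kappa> plus (2 b + 8 b sqrt(vp) / \<delta>)
    \<eta>, and both parts are made equal to e/4.\<close>
  define \<kappa> where "\<kappa> = e / (8 * b\<^sup>2)"
  have "\<kappa> > 0" using e b by (simp add: \<kappa>_def)
  obtain \<delta> m0 where \<delta>: "\<delta> > 0"
    and m0: "\<And>m. m \<ge> m0 \<Longrightarrow> W.prob {xs. \<bar>real_of_int (walkS xs m)\<bar> \<le> \<delta> * sqrt (real m)} \<le> \<kappa>"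
    using walkS_anticoncentration[OF \<open>\<kappa> > 0\<close>] by metis
  define \<eta> where "\<eta> = e / (4 * (2 * b + 8 * b * sqrt (vp p) / \<delta>))"
  have den: "2 * b + 8 * b * sqrt (vp p) / \<delta> > 0"
    using b \<delta> vp_pos by (intro add_pos_nonneg) auto
  have \<eta>: "\<eta> > 0" using e den by (simp add: \<eta>_def)
  obtain C where C: "C \<ge> 0"
    "\<And>a b. \<bar>\<Sum>i\<in>{a..b}. g i\<bar> \<le> \<eta> * (\<bar>real_of_int a\<bar> + \<bar>real_of_int b\<bar>) + C"
    using has_window_meanD[OF mean \<eta>] by auto
  define M where "M = Suc m0"
  define K where "K n = b * (2 * \<eta> * sqrt (real n * vp p) + C) / \<delta>" for n
  have K: "K n \<ge> 0" for n using b \<eta> C \<delta> vp_pos by (auto simp: K_def)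
  \<comment> \<open>For lags below \<open>M\<close>, including 0, only the trivial bound is
    available. Beyond them this is \<open>covariance_bound_window\<close> sorted by its dependence
    on \<open>m\<close>; \<open>K n\<close> grows like \<eta> sqrt(n), up to a constant factor and a
    bounded term.\<close>
  define \<phi> where "\<phi> n m = b\<^sup>2 * indicator {..<M} m + b * (\<eta> + b * \<kappa>) + K n * (1 / sqrt (real m))" for n and m :: nat
  have \<phi>: "\<phi> n m \<ge> 0" for n m
    using b \<eta> K \<open>\<kappa> > 0\<close> by (auto simp: \<phi>_def intro!: add_nonneg_nonneg)
  let ?c = "\<lambda>k l. \<integral>xs. g (walkS xs k) * g (walkS xs l) \<partial>W"
  have gg: "\<bar>g i * g j\<bar> \<le> b\<^sup>2" for i j
    unfolding abs_mult power2_eq_square by (intro mult_mono gb) (use b in auto)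
  have gg_int: "integrable W (\<lambda>xs. g (walkS xs k) * g (walkS xs l))" for k l
    by (rule W.integrable_const_bound[where B="b\<^sup>2"]) (auto simp: gg)
  have c1: "\<bar>?c k (k + m)\<bar> \<le> \<phi> n m" if "k \<le> n" for k m n
  proof (cases "m < M")
    case True
    have "\<bar>?c k (k + m)\<bar> \<le> (\<integral>xs. \<bar>g (walkS xs k) * g (walkS xs (k + m))\<bar> \<partial>W)"
      by (rule integral_abs_bound)
    also have "\<dots> \<le> (\<integral>xs. b\<^sup>2 \<partial>W)"
      by (intro integral_mono integrable_abs gg_int) (auto simp: gg)
    also have "\<dots> = b\<^sup>2" by (simp add: W.prob_space[simplified])
    also have "\<dots> \<le> \<phi> n m"
      using True K b \<eta> \<open>\<kappa> > 0\<close> by (auto simp: \<phi>_def intro!: add_nonneg_nonneg)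
    finally show ?thesis .
  next
    case False
    then have m: "m > 0" "m \<ge> m0" by (auto simp: M_def)
    have "\<bar>?c k (k + m)\<bar> \<le> b * (\<eta> + (2 * \<eta> * sqrt (real n * vp p) + C) / (\<delta> * sqrt (real m)) + b * \<kappa>)"
      by (rule covariance_bound_window[OF gb C(1) \<eta> \<delta> C(2) m0[OF m(2)] m(1) that])
    moreover have "b * (\<eta> + x / (\<delta> * s) + b * \<kappa>) = b * (\<eta> + b * \<kappa>) + b * x / \<delta> * (1 / s)" for x s
      by (simp add: algebra_simps)
    then have "b * (\<eta> + (2 * \<eta> * sqrt (real n * vp p) + C) / (\<delta> * sqrt (real m)) + b * \<kappa>) = \<phi> n m"
      using False by (simp only: \<phi>_def K_def) simp
    ultimately show ?thesis by simp
  qed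
  have c2: "\<bar>?c k l\<bar> \<le> \<phi> n (if k \<le> l then l - k else k - l)" if "k < n" "l < n" for k l n
    using c1[of k n "l - k"] c1[of l n "k - l"] that by (auto simp: mult.commute)
  have I: "(\<integral>xs. (\<Sum>k<n. g (walkS xs k))\<^sup>2 \<partial>W)
      \<le> 2 * real n * (b\<^sup>2 * real M + real n * (b * (\<eta> + b * \<kappa>)) + K n * (2 * sqrt (real n)))" for n
  proof -
    have "(\<integral>xs. (\<Sum>k<n. g (walkS xs k))\<^sup>2 \<partial>W) = (\<Sum>k<n. \<Sum>l<n. ?c k l)"
      by (simp add: power2_eq_square sum_product gg_int)
    also have "\<dots> \<le> (\<Sum>k<n. \<Sum>l<n. \<phi> n (if k \<le> l then l - k else k - l))"
    proof (intro sum_mono)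
      show "?c k l \<le> \<phi> n (if k \<le> l then l - k else k - l)" if "k \<in> {..<n}" "l \<in> {..<n}" for k l
        using c2[of k n l] that by simp
    qed
    also have "\<dots> \<le> (\<Sum>k<n. 2 * (\<Sum>m<n. \<phi> n m))"
      by (intro sum_mono sum_abs_diff_le) (auto simp: \<phi>)
    also have "\<dots> = 2 * real n * (\<Sum>m<n. \<phi> n m)" by simp
    also have "(\<Sum>m<n. \<phi> n m) = b\<^sup>2 * (\<Sum>m<n. indicator {..<M} m) + real n * (b * (\<eta> + b * \<kappa>))
        + K n * (\<Sum>m<n. 1 / sqrt (real m))"
      by (simp add: \<phi>_def sum.distrib sum_distrib_left)
    also have "2 * real n * \<dots>
        \<le> 2 * real n * (b\<^sup>2 * real M + real n * (b * (\<eta> + b * \<kappa>)) + K n * (2 * sqrt (real n)))"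
    proof (intro mult_left_mono add_mono order.refl sum_inverse_sqrt_le K)
      have "(\<Sum>m<n. indicator {..<M} m) = real (card ({..<n} \<inter> {..<M}))"
        by (simp add: indicator_def sum.If_cases lessThan_def)
      also have "\<dots> \<le> real M"
        using card_mono[of "{..<M}" "{..<n} \<inter> {..<M}"] by simp
      finally show "(\<Sum>m<n. indicator {..<M} m) \<le> real M" .
    qed (use b in auto)
    finally show ?thesis .
  qed
  have lim: "(\<lambda>n. 2 * b\<^sup>2 * real M * (1 / real n) + 4 * b * C / \<delta> * (1 / sqrt (real n)))
      \<longlonglongrightarrow> 2 * b\<^sup>2 * real M * 0 + 4 * b * C / \<delta> * 0"
  proof (intro tendsto_add tendsto_mult tendsto_const)
    show "(\<lambda>n. 1 / real n) \<longlonglongrightarrow> 0" by (rule lim_1_over_n)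
    have "filterlim (\<lambda>n. sqrt (real n)) at_top sequentially"
      by (rule filterlim_compose[OF sqrt_at_top filterlim_real_sequentially])
    then show "(\<lambda>n. 1 / sqrt (real n)) \<longlonglongrightarrow> 0"
      by (intro tendsto_divide_0[OF tendsto_const]) (rule filterlim_at_top_imp_at_infinity)
  qed
  have "\<forall>\<^sub>F n in sequentially. 2 * b\<^sup>2 * real M * (1 / real n) + 4 * b * C / \<delta> * (1 / sqrt (real n)) < e / 4"
    using order_tendstoD(2)[OF lim, of "e / 4"] e by simp
  then show "\<forall>\<^sub>F n in sequentially. dist ((\<integral>xs. (\<Sum>k<n. g (walkS xs k))\<^sup>2 \<partial>W) / (real n)\<^sup>2) 0 < e"
    using eventually_gt_at_top[of 0]
  proof eventually_elim
    case (elim n)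
    define r where "r = sqrt (real n)"
    have r: "r > 0" "r * r = real n" using elim by (auto simp: r_def)
    have Kn: "K n = b * (2 * \<eta> * (r * sqrt (vp p)) + C) / \<delta>"
      by (simp add: K_def r_def real_sqrt_mult)
    have "(\<integral>xs. (\<Sum>k<n. g (walkS xs k))\<^sup>2 \<partial>W) / (real n)\<^sup>2
        \<le> 2 * real n * (b\<^sup>2 * real M + real n * (b * (\<eta> + b * \<kappa>)) + K n * (2 * sqrt (real n))) / (real n)\<^sup>2"
      by (intro divide_right_mono I) auto
    also have "\<dots> = 2 * b\<^sup>2 * real M * (1 / real n) + 2 * b * \<eta> + 2 * b\<^sup>2 * \<kappa> + 4 * K n / r"
      using r elim(2) unfolding r_def[symmetric] r(2)[symmetric]
      by (simp add: field_simps power2_eq_square)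
    also have "4 * K n / r = 8 * b * sqrt (vp p) / \<delta> * \<eta> + 4 * b * C / \<delta> * (1 / sqrt (real n))"
      using r \<delta> unfolding Kn r_def[symmetric] by (simp add: field_simps)
    also have "2 * b\<^sup>2 * \<kappa> = e / 4" using b by (simp add: \<kappa>_def)
    finally have "(\<integral>xs. (\<Sum>k<n. g (walkS xs k))\<^sup>2 \<partial>W) / (real n)\<^sup>2
        \<le> (2 * b + 8 * b * sqrt (vp p) / \<delta>) * \<eta> + e / 4
          + (2 * b\<^sup>2 * real M * (1 / real n) + 4 * b * C / \<delta> * (1 / sqrt (real n)))"
      by (simp only: distrib_right)
    also have "(2 * b + 8 * b * sqrt (vp p) / \<delta>) * \<eta> = e / 4"
    proof -
      have "x * (e / (4 * x)) = e / 4" if "x > 0" for x :: real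
        using that by simp
      from this[OF den] show ?thesis unfolding \<eta>_def .
    qed
    finally have "(\<integral>xs. (\<Sum>k<n. g (walkS xs k))\<^sup>2 \<partial>W) / (real n)\<^sup>2 < e"
      using elim(1) e by linarith
    then show ?case by simp
  qed
qed

text \<open>The summands are martingale differences: \<open>g\<close> at the present site is the
  conditional mean of the next term. The second moment is computed by induction, averaging over the
  last step alone, so no orthogonality relations are needed.\<close>

lemma martingale_part_L2:
  fixes f :: "int \<Rightarrow> int \<Rightarrow> real"
  assumes f: "\<And>j l. \<bar>f j l\<bar> \<le> M * \<bar>real_of_int l\<bar>"
  defines "g \<equiv> \<lambda>j. measure_pmf.expectation p (f j)"
  defines "A \<equiv> \<lambda>n xs. \<Sum>k<n. f (walkS xs k) (xs k) - g (walkS xs k)"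
  shows "integrable W (\<lambda>xs. (A n xs)\<^sup>2)" "(\<integral>xs. (A n xs)\<^sup>2 \<partial>W) \<le> real n * (M\<^sup>2 * vp p)"
proof -
  have M: "M \<ge> 0" using f[of 0 1] by simp
  have meas_f [measurable]: "(\<lambda>xs. f (walkS xs k) (xs k)) \<in> borel_measurable W" for k
    by (rule measurable_compose_countable[OF measurable_compose[OF measurable_coord] measurable_walkS]) simp
  have [measurable]: "(\<lambda>xs. g (walkS xs k)) \<in> borel_measurable W" for k
    by (rule measurable_compose[OF measurable_walkS]) simp
  have [measurable]: "A n \<in> borel_measurable W" for n unfolding A_def by measurable
  have int_f: "integrable (measure_pmf p) (f j)" for j
    by (rule Bochner_Integration.integrable_bound[OF integrable_mult_right[OF integrable_abs_p, of M]])
       (use f M in \<open>auto simp: abs_mult\<close>)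
  have f2: "(f j l)\<^sup>2 \<le> M\<^sup>2 * (real_of_int l)\<^sup>2" for j l
    using power_mono[OF f[of j l] abs_ge_zero, of 2] by (simp add: power_mult_distrib)
  have int_f2: "integrable (measure_pmf p) (\<lambda>l. (f j l)\<^sup>2)" for j
    by (rule Bochner_Integration.integrable_bound[OF integrable_mult_right[OF integrable_sq, of "M\<^sup>2"]])
       (use f2 in auto)
  have exp_f2: "measure_pmf.expectation p (\<lambda>l. (f j l)\<^sup>2) \<le> M\<^sup>2 * vp p" for j
  proof -
    have "measure_pmf.expectation p (\<lambda>l. (f j l)\<^sup>2) \<le> measure_pmf.expectation p (\<lambda>l. M\<^sup>2 * (real_of_int l)\<^sup>2)"
      by (intro integral_mono int_f2 f2 integrable_mult_right integrable_sq)
    then show ?thesis by (simp add: expectation_sq)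
  qed
  have g: "\<bar>g j\<bar> \<le> M * mbar p" for j
  proof -
    have "\<bar>g j\<bar> \<le> measure_pmf.expectation p (\<lambda>l. \<bar>f j l\<bar>)"
      unfolding g_def by (rule integral_abs_bound)
    also have "\<dots> \<le> measure_pmf.expectation p (\<lambda>l. M * \<bar>real_of_int l\<bar>)"
      by (intro integral_mono integrable_abs int_f f integrable_mult_right integrable_abs_p)
    finally show ?thesis by (simp add: expectation_abs)
  qed
  have sq: "(a + b)\<^sup>2 \<le> 2 * a\<^sup>2 + 2 * b\<^sup>2" for a b :: real
    using sum_squares_bound[of a b] by (simp add: power2_sum)
  have A_Suc: "A (Suc n) xs = A n xs + (f (walkS xs n) (xs n) - g (walkS xs n))" for n xs
    by (simp add: A_def)
  have int_A: "integrable W (\<lambda>xs. (A n xs)\<^sup>2)" for n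
  proof (induction n)
    case (Suc n)
    have "integrable W (\<lambda>xs. 2 * (A n xs)\<^sup>2 + (4 * (M\<^sup>2 * (real_of_int (xs n))\<^sup>2) + 4 * (M * mbar p)\<^sup>2))"
      using Suc integrable_coord[of "\<lambda>k. (real_of_int k)\<^sup>2" n] integrable_sq by auto
    then show ?case
    proof (rule Bochner_Integration.integrable_bound)
      show "AE xs in W. norm ((A (Suc n) xs)\<^sup>2)
          \<le> norm (2 * (A n xs)\<^sup>2 + (4 * (M\<^sup>2 * (real_of_int (xs n))\<^sup>2) + 4 * (M * mbar p)\<^sup>2))"
      proof (intro AE_I2)
        fix xs
        have "(A (Suc n) xs)\<^sup>2 \<le> 2 * (A n xs)\<^sup>2 + 2 * (f (walkS xs n) (xs n) - g (walkS xs n))\<^sup>2"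
          unfolding A_Suc by (rule sq)
        moreover have "(f (walkS xs n) (xs n) - g (walkS xs n))\<^sup>2
            \<le> 2 * (f (walkS xs n) (xs n))\<^sup>2 + 2 * (g (walkS xs n))\<^sup>2"
          using sq[of "f (walkS xs n) (xs n)" "- g (walkS xs n)"] by simp
        moreover have "(g (walkS xs n))\<^sup>2 \<le> (M * mbar p)\<^sup>2"
          using power_mono[OF g[of "walkS xs n"] abs_ge_zero, of 2] by simp
        moreover note f2[of "walkS xs n" "xs n"]
        ultimately show "norm ((A (Suc n) xs)\<^sup>2)
          \<le> norm (2 * (A n xs)\<^sup>2 + (4 * (M\<^sup>2 * (real_of_int (xs n))\<^sup>2) + 4 * (M * mbar p)\<^sup>2))"
          by simp
      qed
    qed measurable
  qed (simp add: A_def)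
  show "integrable W (\<lambda>xs. (A n xs)\<^sup>2)" by (rule int_A)
  show "(\<integral>xs. (A n xs)\<^sup>2 \<partial>W) \<le> real n * (M\<^sup>2 * vp p)"
  proof (induction n)
    case (Suc n)
    have A_comb: "A n (comb_seq n \<omega> \<omega>') = A n \<omega>" for \<omega> \<omega>'
      unfolding A_def by (intro sum.cong) (auto simp: walkS_comb_seq_le comb_seq_less)
    have inner: "(\<integral>\<omega>'. (A (Suc n) (comb_seq n \<omega> \<omega>'))\<^sup>2 \<partial>W) \<le> (A n \<omega>)\<^sup>2 + M\<^sup>2 * vp p" for \<omega>
    proof -
      let ?j = "walkS \<omega> n"
      \<comment> \<open>Everything known before the last step is collected in \<open>a\<close>.
        Completing the square afterwards, the conditional second moment equals that of
        \<open>A n\<close> plus the conditional variance of the new term, which is at most its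
        second moment.\<close>
      define a where "a = A n \<omega> - g ?j"
      have "(\<integral>\<omega>'. (A (Suc n) (comb_seq n \<omega> \<omega>'))\<^sup>2 \<partial>W) = (\<integral>\<omega>'. (a + f ?j (\<omega>' 0))\<^sup>2 \<partial>W)"
        by (simp add: A_Suc A_comb walkS_comb_seq_le comb_seq_def a_def algebra_simps)
      also have "\<dots> = measure_pmf.expectation p (\<lambda>l. (a + f ?j l)\<^sup>2)"
        by (rule integral_coord)
      also have "\<dots> = measure_pmf.expectation p (\<lambda>l. a\<^sup>2 + (f ?j l)\<^sup>2 + (2 * a) * f ?j l)"
        by (simp add: power2_sum)
      also have "\<dots> = a\<^sup>2 + measure_pmf.expectation p (\<lambda>l. (f ?j l)\<^sup>2) + (2 * a) * g ?j"
        using int_f[of ?j] int_f2[of ?j] by (simp add: g_def measure_pmf.prob_space[simplified])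
      also have "\<dots> \<le> a\<^sup>2 + M\<^sup>2 * vp p + (2 * a) * g ?j" using exp_f2[of ?j] by simp
      also have "\<dots> \<le> (A n \<omega>)\<^sup>2 + M\<^sup>2 * vp p"
      proof -
        have "(A n \<omega>)\<^sup>2 = a\<^sup>2 + (2 * a) * g ?j + (g ?j)\<^sup>2"
          unfolding a_def by (simp add: power2_eq_square algebra_simps)
        then show ?thesis by simp
      qed
      finally show ?thesis .
    qed
    have "(\<integral>xs. (A (Suc n) xs)\<^sup>2 \<partial>W) = (\<integral>\<omega>. \<integral>\<omega>'. (A (Suc n) (comb_seq n \<omega> \<omega>'))\<^sup>2 \<partial>W \<partial>W)"
      by (rule integral_split[OF int_A])
    also have "\<dots> \<le> (\<integral>\<omega>. (A n \<omega>)\<^sup>2 + M\<^sup>2 * vp p \<partial>W)"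
      by (rule integral_mono') (use int_A inner vp_pos in \<open>auto intro!: add_nonneg_nonneg\<close>)
    also have "\<dots> = (\<integral>\<omega>. (A n \<omega>)\<^sup>2 \<partial>W) + M\<^sup>2 * vp p"
      using int_A by (simp add: W.prob_space[simplified])
    also have "\<dots> \<le> real (Suc n) * (M\<^sup>2 * vp p)" using Suc by (simp add: algebra_simps)
    finally show ?case .
  qed (simp add: A_def)
qed

end

section \<open>The law of large numbers for \<open>\<tau>\<close>\<close>

lemma tau_eq_sum: "tau \<omega> xs n = (\<Sum>k<n. \<bar>\<omega> (walkS xs k + xs k) - \<omega> (walkS xs k)\<bar>)"
  unfolding tau_def One_nat_def sum.atLeast1_atMost_eq by (simp add: walkS_Suc)

text \<open>With nonnegative gaps the length of a jump is the sum of the gaps it crosses, so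
  \<open>tau\<close> is additive in the gaps. Truncation therefore splits \<open>tau\<close>
  exactly.\<close>

lemma tau_env_add:
  assumes "\<And>j. 0 \<le> z j" "\<And>j. 0 \<le> z' j" "\<And>j. z j + z' j = y j"
  shows "tau (env z) xs n + tau (env z') xs n = tau (env y) xs n"
proof -
  have "0 \<le> y j" for j using assms[of j] by linarith
  then show ?thesis
    by (simp add: tau_eq_sum sum.distrib[symmetric] abs_env_diff assms(1,2) assms(3)[symmetric])
qed

lemma tau_nonneg: "0 \<le> tau \<omega> xs n"
  by (simp add: tau_def sum_nonneg)

lemma tau_mono: "m \<le> n \<Longrightarrow> tau \<omega> xs m \<le> tau \<omega> xs n"
  unfolding tau_eq_sum by (intro sum_mono2) auto

context unimodal_walk
begin

text \<open>The conditional mean of the next increment of \<open>tau\<close> when the walk sits at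
  \<open>j\<close>; summed along the walk it is the compensator of \<open>tau\<close>.\<close>

definition jump_mean :: "(int \<Rightarrow> real) \<Rightarrow> int \<Rightarrow> real" where
  "jump_mean z j = measure_pmf.expectation p (\<lambda>l. \<bar>env z (j + l) - env z j\<bar>)"

lemma jump_mean_nonneg: "0 \<le> jump_mean z j"
  by (simp add: jump_mean_def)

lemma measurable_jump [measurable]:
  "(\<lambda>xs. \<bar>\<omega> (walkS xs k + xs k) - \<omega> (walkS xs k) :: real\<bar>) \<in> borel_measurable W"
proof -
  have "(\<lambda>xs. \<bar>\<omega> (walkS xs (Suc k)) - \<omega> (walkS xs k) :: real\<bar>) \<in> borel_measurable W"
    by measurable
  then show ?thesis by (simp add: walkS_Suc)
qed

lemma measurable_tau [measurable]: "(\<lambda>xs. tau \<omega> xs n) \<in> borel_measurable W"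
  unfolding tau_eq_sum by measurable

text \<open>A window mean forces \<open>env z\<close> to grow at most linearly, so the first moment
  of \<open>p\<close> suffices even for unbounded gaps.\<close>

lemma integrable_jump:
  assumes mean: "has_window_mean z \<mu>"
  shows "integrable (measure_pmf p) (\<lambda>l. \<bar>env z (j + l) - env z j\<bar>)"
proof -
  obtain C where C: "C \<ge> 0" "\<And>k. \<bar>env z k - \<mu> * real_of_int k\<bar> \<le> 1 * \<bar>real_of_int k\<bar> + C"
    using has_window_mean_env_bound[OF mean, of 1] by auto
  have E: "\<bar>env z k\<bar> \<le> (\<bar>\<mu>\<bar> + 1) * \<bar>real_of_int k\<bar> + C" for k
    using C(2)[of k] by (simp add: abs_mult[symmetric] distrib_right)
  have bound: "\<bar>env z (j + l) - env z j\<bar>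
      \<le> ((\<bar>\<mu>\<bar> + 1) * \<bar>real_of_int j\<bar> + C + \<bar>env z j\<bar>) + (\<bar>\<mu>\<bar> + 1) * \<bar>real_of_int l\<bar>" for l
  proof -
    have "\<bar>env z (j + l)\<bar> \<le> (\<bar>\<mu>\<bar> + 1) * (\<bar>real_of_int j\<bar> + \<bar>real_of_int l\<bar>) + C"
      by (rule order_trans[OF E]) (intro add_right_mono mult_left_mono, auto)
    then show ?thesis unfolding distrib_left by linarith
  qed
  have "integrable (measure_pmf p)
      (\<lambda>l. ((\<bar>\<mu>\<bar> + 1) * \<bar>real_of_int j\<bar> + C + \<bar>env z j\<bar>) + (\<bar>\<mu>\<bar> + 1) * \<bar>real_of_int l\<bar>)"
    using integrable_abs_p by auto
  then show ?thesis
    by (rule Bochner_Integration.integrable_bound) (use bound order_trans[OF _ abs_ge_self] in auto)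
qed

text \<open>A jump of size \<open>l\<close> crosses |l| gaps. Exchanging the sums, each crossed gap
  contributes a window of the environment shifted by at most |l|; the shift costs an error of order
  l^2, which the finite variance of the step integrates.\<close>

lemma has_window_mean_jump_mean:
  assumes z: "\<And>j. 0 \<le> z j" and mean: "has_window_mean z \<mu>"
  shows "has_window_mean (jump_mean z) (mbar p * \<mu>)"
  unfolding has_window_mean_def
proof (intro allI impI)
  fix \<eta> :: real assume \<eta>: "\<eta> > 0"
  \<comment> \<open>Scaled so that the factor |l| from the number of crossed gaps, whose mean is
    \<open>mbar p\<close>, turns \<theta> back into \<eta>.\<close>
  define \<theta> where "\<theta> = \<eta> / mbar p"
  have \<theta>: "\<theta> > 0" using \<eta> mbar_pos by (simp add: \<theta>_def)
  obtain C where C: "C \<ge> 0"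
    "\<And>a b. \<bar>\<Sum>j\<in>{a..b}. z j - \<mu>\<bar> \<le> \<theta> * (\<bar>real_of_int a\<bar> + \<bar>real_of_int b\<bar>) + C"
    using has_window_meanD[OF mean \<theta>] by blast
  let ?f = "\<lambda>j l. \<bar>env z (j + l) - env z j\<bar> - \<bar>real_of_int l\<bar> * \<mu>"
  have f_int: "integrable (measure_pmf p) (?f j)" for j
    using integrable_jump[OF mean] integrable_abs_p by auto
  have f_exp: "measure_pmf.expectation p (?f j) = jump_mean z j - mbar p * \<mu>" for j
    using integrable_jump[OF mean] integrable_abs_p by (simp add: jump_mean_def expectation_abs)
  have pt: "\<bar>\<Sum>j\<in>{a..b}. ?f j l\<bar>
      \<le> (\<theta> * (\<bar>real_of_int a\<bar> + \<bar>real_of_int b\<bar>) + C) * \<bar>real_of_int l\<bar> + (2 * \<theta>) * (real_of_int l)\<^sup>2" for a b l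
  proof -
    have "(\<Sum>j\<in>{a..b}. ?f j l) = (\<Sum>j\<in>{a..b}. \<Sum>i\<in>jump_span l. z (j + i) - \<mu>)"
      by (simp add: abs_env_diff[OF z] sum_subtractf)
    also have "\<dots> = (\<Sum>i\<in>jump_span l. \<Sum>j\<in>{a..b}. z (j + i) - \<mu>)" by (rule sum.swap)
    also have "\<dots> = (\<Sum>i\<in>jump_span l. \<Sum>j\<in>{a+i..b+i}. z j - \<mu>)"
    proof (rule sum.cong[OF refl])
      fix i
      show "(\<Sum>j\<in>{a..b}. z (j + i) - \<mu>) = (\<Sum>j\<in>{a+i..b+i}. z j - \<mu>)"
        by (rule sum.reindex_bij_witness[of _ "\<lambda>j. j - i" "\<lambda>j. j + i"]) auto
    qed
    also have "\<bar>\<dots>\<bar> \<le> (\<Sum>i\<in>jump_span l. \<bar>\<Sum>j\<in>{a+i..b+i}. z j - \<mu>\<bar>)" by (rule sum_abs)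
    also have "\<dots> \<le> (\<Sum>i\<in>jump_span l. \<theta> * (\<bar>real_of_int a\<bar> + \<bar>real_of_int b\<bar> + 2 * \<bar>real_of_int l\<bar>) + C)"
    proof (intro sum_mono)
      fix i assume "i \<in> jump_span l"
      then have "\<bar>i\<bar> \<le> \<bar>l\<bar>" by (rule jump_span_bound)
      then have i: "\<bar>real_of_int i\<bar> \<le> \<bar>real_of_int l\<bar>" by (metis of_int_abs of_int_le_iff)
      have "\<bar>\<Sum>j\<in>{a+i..b+i}. z j - \<mu>\<bar> \<le> \<theta> * (\<bar>real_of_int (a + i)\<bar> + \<bar>real_of_int (b + i)\<bar>) + C"
        by (rule C(2))
      also have "\<bar>real_of_int (a + i)\<bar> + \<bar>real_of_int (b + i)\<bar>
          \<le> \<bar>real_of_int a\<bar> + \<bar>real_of_int b\<bar> + 2 * \<bar>real_of_int l\<bar>" using i by linarith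
      finally show "\<bar>\<Sum>j\<in>{a+i..b+i}. z j - \<mu>\<bar>
          \<le> \<theta> * (\<bar>real_of_int a\<bar> + \<bar>real_of_int b\<bar> + 2 * \<bar>real_of_int l\<bar>) + C"
        using \<theta> by (simp add: mult_left_mono)
    qed
    also have "\<dots> = \<bar>real_of_int l\<bar> * (\<theta> * (\<bar>real_of_int a\<bar> + \<bar>real_of_int b\<bar> + 2 * \<bar>real_of_int l\<bar>) + C)"
      by simp
    also have "\<dots> = (\<theta> * (\<bar>real_of_int a\<bar> + \<bar>real_of_int b\<bar>) + C) * \<bar>real_of_int l\<bar>
        + (2 * \<theta>) * (\<bar>real_of_int l\<bar> * \<bar>real_of_int l\<bar>)" by (simp add: algebra_simps)
    also have "\<bar>real_of_int l\<bar> * \<bar>real_of_int l\<bar> = (real_of_int l)\<^sup>2" by (simp add: power2_eq_square)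
    finally show ?thesis .
  qed
  have "\<bar>\<Sum>j\<in>{a..b}. jump_mean z j - mbar p * \<mu>\<bar>
      \<le> \<eta> * (\<bar>real_of_int a\<bar> + \<bar>real_of_int b\<bar>) + (C * mbar p + 2 * \<theta> * vp p)" for a b
  proof -
    have "(\<Sum>j\<in>{a..b}. jump_mean z j - mbar p * \<mu>) = measure_pmf.expectation p (\<lambda>l. \<Sum>j\<in>{a..b}. ?f j l)"
      by (subst Bochner_Integration.integral_sum) (auto simp: f_exp intro: f_int)
    also have "\<bar>\<dots>\<bar> \<le> measure_pmf.expectation p (\<lambda>l. \<bar>\<Sum>j\<in>{a..b}. ?f j l\<bar>)"
      by (rule integral_abs_bound)
    also have "\<dots> \<le> measure_pmf.expectation p (\<lambda>l. (\<theta> * (\<bar>real_of_int a\<bar> + \<bar>real_of_int b\<bar>) + C) * \<bar>real_of_int l\<bar>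
        + (2 * \<theta>) * (real_of_int l)\<^sup>2)"
      using integrable_abs_p integrable_sq
      by (intro integral_mono integrable_abs Bochner_Integration.integrable_sum f_int pt) auto
    also have "\<dots> = (\<theta> * (\<bar>real_of_int a\<bar> + \<bar>real_of_int b\<bar>) + C) * mbar p + (2 * \<theta>) * vp p"
      using integrable_abs_p integrable_sq by (simp add: expectation_abs expectation_sq)
    also have "\<dots> = (\<theta> * mbar p) * (\<bar>real_of_int a\<bar> + \<bar>real_of_int b\<bar>) + (C * mbar p + 2 * \<theta> * vp p)"
      by (simp add: algebra_simps)
    also have "\<theta> * mbar p = \<eta>" using mbar_pos by (simp add: \<theta>_def)
    finally show ?thesis .
  qed
  moreover have "C * mbar p + 2 * \<theta> * vp p \<ge> 0" using C \<theta> mbar_pos vp_pos by auto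
  ultimately show "\<exists>C\<ge>0. \<forall>a b. \<bar>\<Sum>j\<in>{a..b}. jump_mean z j - mbar p * \<mu>\<bar>
      \<le> \<eta> * (\<bar>real_of_int a\<bar> + \<bar>real_of_int b\<bar>) + C" by blast
qed

text \<open>The deviation of \<open>tau\<close> is a martingale \<open>A\<close> (jumps minus
  conditional means) plus an additive functional \<open>G\<close> of the walk. Bounded gaps give
  \<open>|f j l| \<le> M * |l|\<close> and a bounded \<open>jump_mean\<close>, which are the
  hypotheses of the two L2 estimates; Markov's inequality for the squares concludes.\<close>

lemma tau_LLN_bounded:
  assumes z: "\<And>j. 0 \<le> z j" "\<And>j. z j \<le> M" and mean: "has_window_mean z \<mu>" and \<epsilon>: "\<epsilon> > 0"
  shows "(\<lambda>n. W.prob {xs. \<bar>tau (env z) xs n - real n * (mbar p * \<mu>)\<bar> \<ge> \<epsilon> * real n}) \<longlonglongrightarrow> 0"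
proof -
  define c where "c = mbar p * \<mu>"
  define f where "f j l = \<bar>env z (j + l) - env z j\<bar>" for j l
  have M: "M \<ge> 0" using z[of 0] by linarith
  have f: "\<bar>f j l\<bar> \<le> M * \<bar>real_of_int l\<bar>" for j l
  proof -
    have "f j l = (\<Sum>i\<in>jump_span l. z (j + i))" unfolding f_def by (rule abs_env_diff[OF z(1)])
    also have "\<dots> \<le> (\<Sum>i\<in>jump_span l. M)" by (intro sum_mono z)
    finally show ?thesis by (simp add: f_def mult.commute)
  qed
  let ?g = "jump_mean z"
  have g: "?g = (\<lambda>j. measure_pmf.expectation p (f j))"
    by (simp add: jump_mean_def[abs_def] f_def[abs_def])
  have g_le: "\<bar>?g j - c\<bar> \<le> M * mbar p + \<bar>c\<bar>" for j
  proof -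
    have "?g j \<le> measure_pmf.expectation p (\<lambda>l. M * \<bar>real_of_int l\<bar>)"
      unfolding jump_mean_def using f[of j]
      by (intro integral_mono integrable_jump[OF mean] integrable_mult_right integrable_abs_p)
         (auto simp: f_def)
    then show ?thesis using jump_mean_nonneg[of z j] by (simp add: expectation_abs)
  qed
  define A where "A n xs = (\<Sum>k<n. f (walkS xs k) (xs k) - ?g (walkS xs k))" for n xs
  define G where "G n xs = (\<Sum>k<n. ?g (walkS xs k) - c)" for n xs
  have A: "integrable W (\<lambda>xs. (A n xs)\<^sup>2)" "(\<integral>xs. (A n xs)\<^sup>2 \<partial>W) \<le> real n * (M\<^sup>2 * vp p)" for n
    unfolding A_def g using martingale_part_L2[of f M, OF f] by simp_all
  have G_lim: "(\<lambda>n. (\<integral>xs. (G n xs)\<^sup>2 \<partial>W) / (real n)\<^sup>2) \<longlonglongrightarrow> 0"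
    unfolding G_def
  proof (rule additive_functional_L2[where g="\<lambda>j. ?g j - c"])
    show "has_window_mean (\<lambda>j. ?g j - c) 0"
      using has_window_mean_jump_mean[OF z(1) mean] by (simp add: has_window_mean_def c_def)
  qed (rule g_le)
  have [measurable]: "G n \<in> borel_measurable W" for n
    unfolding G_def[abs_def] by (intro borel_measurable_sum measurable_compose[OF measurable_walkS]) simp
  have G: "integrable W (\<lambda>xs. (G n xs)\<^sup>2)" for n
  proof (rule W.integrable_const_bound[where B="(real n * (M * mbar p + \<bar>c\<bar>))\<^sup>2"])
    have "\<bar>G n xs\<bar> \<le> real n * (M * mbar p + \<bar>c\<bar>)" for xs
      unfolding G_def
      by (intro order_trans[OF sum_abs] order_trans[OF sum_mono[OF g_le]]) simp
    then show "AE xs in W. norm ((G n xs)\<^sup>2) \<le> (real n * (M * mbar p + \<bar>c\<bar>))\<^sup>2"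
      by (auto intro!: AE_I2 simp: abs_le_square_iff[symmetric] intro: order_trans[OF _ abs_ge_self])
  qed measurable
  have dec: "tau (env z) xs n - real n * c = A n xs + G n xs" for n xs
    by (simp add: A_def G_def tau_eq_sum f_def sum_subtractf)
  have "A n = (\<lambda>xs. tau (env z) xs n - real n * c - G n xs)" for n
    by (simp add: dec)
  then have [measurable]: "A n \<in> borel_measurable W" for n by simp
  have le: "W.prob {xs. \<bar>tau (env z) xs n - real n * c\<bar> \<ge> \<epsilon> * real n}
      \<le> 2 * M\<^sup>2 * vp p / \<epsilon>\<^sup>2 * (1 / real n) + 2 / \<epsilon>\<^sup>2 * ((\<integral>xs. (G n xs)\<^sup>2 \<partial>W) / (real n)\<^sup>2)"
    if n: "n > 0" for n
  proof -
    let ?U = "\<lambda>xs. 2 * (A n xs)\<^sup>2 + 2 * (G n xs)\<^sup>2"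
    have U: "integrable W ?U" using A(1) G by auto
    have en: "\<epsilon> * real n > 0" using n \<epsilon> by simp
    have sub: "{xs. \<bar>tau (env z) xs n - real n * c\<bar> \<ge> \<epsilon> * real n} \<subseteq> {xs \<in> space W. ?U xs \<ge> (\<epsilon> * real n)\<^sup>2}"
    proof
      fix xs assume "xs \<in> {xs. \<bar>tau (env z) xs n - real n * c\<bar> \<ge> \<epsilon> * real n}"
      then have "\<bar>A n xs + G n xs\<bar> \<ge> \<epsilon> * real n" by (simp add: dec)
      then have "(\<epsilon> * real n)\<^sup>2 \<le> (A n xs + G n xs)\<^sup>2"
        using en by (metis abs_le_square_iff abs_of_pos)
      also have "\<dots> \<le> ?U xs"
        using sum_squares_bound[of "A n xs" "G n xs"] by (simp add: power2_sum)
      finally show "xs \<in> {xs \<in> space W. ?U xs \<ge> (\<epsilon> * real n)\<^sup>2}" by simp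
    qed
    have "W.prob {xs. \<bar>tau (env z) xs n - real n * c\<bar> \<ge> \<epsilon> * real n}
        \<le> W.prob {xs \<in> space W. ?U xs \<ge> (\<epsilon> * real n)\<^sup>2}"
      by (intro W.finite_measure_mono[OF sub]) measurable
    also have "\<dots> \<le> (\<integral>xs. ?U xs \<partial>W) / (\<epsilon> * real n)\<^sup>2"
      by (rule integral_Markov_inequality_measure[OF U, of "{}"]) (use en n \<epsilon> in auto)
    also have "(\<integral>xs. ?U xs \<partial>W) = 2 * (\<integral>xs. (A n xs)\<^sup>2 \<partial>W) + 2 * (\<integral>xs. (G n xs)\<^sup>2 \<partial>W)"
      using A(1) G by simp
    also have "\<dots> / (\<epsilon> * real n)\<^sup>2 \<le> (2 * (real n * (M\<^sup>2 * vp p)) + 2 * (\<integral>xs. (G n xs)\<^sup>2 \<partial>W)) / (\<epsilon> * real n)\<^sup>2"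
      using A(2) by (intro divide_right_mono add_right_mono mult_left_mono) auto
    also have "\<dots> = 2 * M\<^sup>2 * vp p / \<epsilon>\<^sup>2 * (1 / real n) + 2 / \<epsilon>\<^sup>2 * ((\<integral>xs. (G n xs)\<^sup>2 \<partial>W) / (real n)\<^sup>2)"
      using n \<epsilon> by (simp add: field_simps power2_eq_square)
    finally show ?thesis .
  qed
  have "(\<lambda>n. 2 * M\<^sup>2 * vp p / \<epsilon>\<^sup>2 * (1 / real n) + 2 / \<epsilon>\<^sup>2 * ((\<integral>xs. (G n xs)\<^sup>2 \<partial>W) / (real n)\<^sup>2))
      \<longlonglongrightarrow> 2 * M\<^sup>2 * vp p / \<epsilon>\<^sup>2 * 0 + 2 / \<epsilon>\<^sup>2 * 0"
    by (intro tendsto_add tendsto_mult tendsto_const G_lim lim_1_over_n)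
  then have lim: "(\<lambda>n. 2 * M\<^sup>2 * vp p / \<epsilon>\<^sup>2 * (1 / real n) + 2 / \<epsilon>\<^sup>2 * ((\<integral>xs. (G n xs)\<^sup>2 \<partial>W) / (real n)\<^sup>2)) \<longlonglongrightarrow> 0"
    by simp
  show ?thesis
    unfolding c_def[symmetric]
    by (rule tendsto_sandwich[OF _ _ tendsto_const lim])
       (use le in \<open>auto intro: eventually_mono[OF eventually_gt_at_top[of 0]]\<close>)
qed

text \<open>Only first moments are used, so the gaps may be unbounded. The expected
  \<open>k\<close>-th jump is at most about \<open>c\<close> plus \<open>C\<close> times the return
  probability at time \<open>k\<close>, and the return probabilities vanish in the mean because they
  tend to 0.\<close>

lemma tau_upper:
  assumes z: "\<And>j. 0 \<le> z j" and mean: "has_window_mean z \<mu>" and \<mu>: "\<mu> \<ge> 0"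
    and \<epsilon>: "\<epsilon> > 0" and a: "mbar p * \<mu> < a"
  shows "\<forall>\<^sub>F n in sequentially. W.prob {xs. tau (env z) xs n \<ge> \<epsilon> * real n} \<le> a / \<epsilon>"
proof -
  define c where "c = mbar p * \<mu>"
  have c: "c \<ge> 0" using \<mu> mbar_pos by (simp add: c_def)
  \<comment> \<open>The slack between \<open>c\<close> and \<open>a\<close> pays for three errors:
    the window average, the small return probabilities at late times, and the early times below
    \<open>N\<close>.\<close>
  define \<eta> where "\<eta> = (a - c) / 3"
  have \<eta>: "\<eta> > 0" using a by (simp add: \<eta>_def c_def)
  obtain C where C: "C \<ge> 0"
    "\<And>a b. \<bar>\<Sum>j\<in>{a..b}. jump_mean z j - c\<bar> \<le> \<eta> * (\<bar>real_of_int a\<bar> + \<bar>real_of_int b\<bar>) + C"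
    using has_window_meanD[OF has_window_mean_jump_mean[OF z mean] \<eta>] unfolding c_def by blast
  have jm: "(\<integral>\<^sup>+xs. ennreal (jump_mean z (walkS xs k)) \<partial>W) \<le> ennreal ((c + \<eta>) + C * pmf (S_pmf k) 0)" for k
    unfolding nn_integral_walkS[of "\<lambda>j. ennreal (jump_mean z j)"]
  proof (rule sym_unimodal_nn_integral_window[OF sym_unimodal_S_pmf jump_mean_nonneg C(1)])
    fix r :: nat
    have "(\<Sum>i\<in>{- int r..int r}. jump_mean z i) = (\<Sum>i\<in>{- int r..int r}. jump_mean z i - c) + c * real (2 * r + 1)"
      by (simp add: sum_subtractf nat_add_distrib nat_mult_distrib mult.commute)
    also have "\<dots> \<le> (\<eta> * real (2 * r + 1) + C) + c * real (2 * r + 1)"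
      using C(2)[of "- int r" "int r"] \<eta> by (simp add: distrib_left)
    finally show "(\<Sum>i\<in>{- int r..int r}. jump_mean z i) \<le> (c + \<eta>) * real (2 * r + 1) + C"
      by (simp add: algebra_simps)
  qed (use c \<eta> in auto)
  have jump: "(\<integral>\<^sup>+xs. ennreal \<bar>env z (walkS xs k + xs k) - env z (walkS xs k)\<bar> \<partial>W)
      = (\<integral>\<^sup>+xs. ennreal (jump_mean z (walkS xs k)) \<partial>W)" for k
  proof -
    have "(\<integral>\<^sup>+xs. ennreal \<bar>env z (walkS xs k + xs k) - env z (walkS xs k)\<bar> \<partial>W)
      = (\<integral>\<^sup>+\<omega>. \<integral>\<^sup>+\<omega>'. ennreal \<bar>env z (walkS \<omega> k + \<omega>' 0) - env z (walkS \<omega> k)\<bar> \<partial>W \<partial>W)"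
      by (subst nn_integral_split[where k=k]) (auto simp: walkS_comb_seq_le comb_seq_def)
    also have "\<dots> = (\<integral>\<^sup>+\<omega>. \<integral>\<^sup>+l. ennreal \<bar>env z (walkS \<omega> k + l) - env z (walkS \<omega> k)\<bar> \<partial>measure_pmf p \<partial>W)"
      by (intro nn_integral_cong nn_integral_coord)
    also have "\<dots> = (\<integral>\<^sup>+xs. ennreal (jump_mean z (walkS xs k)) \<partial>W)"
      unfolding jump_mean_def
      by (intro nn_integral_cong nn_integral_eq_integral integrable_jump[OF mean]) auto
    finally show ?thesis .
  qed
  have "(\<integral>\<^sup>+xs. ennreal (tau (env z) xs n) \<partial>W) \<le> (\<Sum>k<n. ennreal ((c + \<eta>) + C * pmf (S_pmf k) 0))" for n
  proof -
    have "(\<integral>\<^sup>+xs. ennreal (tau (env z) xs n) \<partial>W)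
        = (\<Sum>k<n. \<integral>\<^sup>+xs. ennreal \<bar>env z (walkS xs k + xs k) - env z (walkS xs k)\<bar> \<partial>W)"
      unfolding tau_eq_sum by (simp add: sum_ennreal[symmetric] nn_integral_sum del: sum_ennreal)
    then show ?thesis by (auto simp only: jump intro: sum_mono jm)
  qed
  also have "(\<Sum>k<n. ennreal ((c + \<eta>) + C * pmf (S_pmf k) 0))
      = ennreal (\<Sum>k<n. (c + \<eta>) + C * pmf (S_pmf k) 0)" for n
    using c \<eta> C by (intro sum_ennreal) auto
  finally have E: "(\<integral>\<^sup>+xs. ennreal (tau (env z) xs n) \<partial>W)
      \<le> ennreal (real n * (c + \<eta>) + C * (\<Sum>k<n. pmf (S_pmf k) 0))" for n
    by (simp add: sum.distrib sum_distrib_left)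
  \<comment> \<open>\<open>C + 1\<close> in place of \<open>C\<close>, which may be 0.\<close>
  define \<kappa> where "\<kappa> = \<eta> / (C + 1)"
  have \<kappa>: "\<kappa> > 0" "C * \<kappa> \<le> \<eta>" using \<eta> C by (auto simp: \<kappa>_def field_simps)
  obtain N where N: "\<And>n. n \<ge> N \<Longrightarrow> pmf (S_pmf n) 0 < \<kappa>"
    using order_tendstoD(2)[OF S_pmf_0_tendsto \<kappa>(1)] by (auto simp: eventually_sequentially)
  have "(\<Sum>k<n. pmf (S_pmf k) 0) \<le> real N + real n * \<kappa>" for n
  proof -
    have "(\<Sum>k<n. pmf (S_pmf k) 0) \<le> (\<Sum>k<n. indicator {..<N} k + \<kappa>)"
      using N \<kappa> pmf_le_1[of "S_pmf _" 0] less_imp_le[OF N]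
      by (intro sum_mono) (auto simp: indicator_def not_less add_increasing2)
    also have "\<dots> = real (card ({..<n} \<inter> {..<N})) + real n * \<kappa>"
      by (simp add: indicator_def sum.distrib sum.If_cases lessThan_def)
    also have "\<dots> \<le> real N + real n * \<kappa>"
      using card_mono[of "{..<N}" "{..<n} \<inter> {..<N}"] by simp
    finally show ?thesis .
  qed
  then have E2: "real n * (c + \<eta>) + C * (\<Sum>k<n. pmf (S_pmf k) 0) \<le> real n * (c + 2 * \<eta>) + C * real N" for n
  proof -
    have "C * (\<Sum>k<n. pmf (S_pmf k) 0) \<le> C * (real N + real n * \<kappa>)"
      by (intro mult_left_mono C) fact
    also have "\<dots> = C * real N + real n * (C * \<kappa>)" by (simp add: algebra_simps)
    also have "\<dots> \<le> C * real N + real n * \<eta>" by (intro add_left_mono mult_left_mono \<kappa>) auto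
    finally show ?thesis by (simp add: algebra_simps)
  qed
  have prob: "W.prob {xs. tau (env z) xs n \<ge> \<epsilon> * real n} \<le> a / \<epsilon>"
    if n: "n > 0" "C * real N / \<eta> \<le> real n" for n
  proof -
    have en: "\<epsilon> * real n > 0" using n \<epsilon> by simp
    let ?K = "real n * (c + 2 * \<eta>) + C * real N"
    have K: "?K \<le> real n * a"
    proof -
      have "C * real N \<le> real n * \<eta>" using n(2) \<eta> by (simp add: pos_divide_le_eq mult.commute)
      then have "?K \<le> real n * (c + 3 * \<eta>)" by (simp add: algebra_simps)
      also have "c + 3 * \<eta> = a" by (simp add: \<eta>_def field_simps)
      finally show ?thesis .
    qed
    have a0: "a > 0" using a c by (simp add: c_def)
    have "emeasure W {xs \<in> space W. 1 \<le> ennreal (1 / (\<epsilon> * real n)) * ennreal (tau (env z) xs n)}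
        \<le> ennreal (1 / (\<epsilon> * real n)) * (\<integral>\<^sup>+xs. ennreal (tau (env z) xs n) * indicator (space W) xs \<partial>W)"
      by (rule nn_integral_Markov_inequality) (use sets.top[of W] in auto)
    also have "\<dots> = ennreal (1 / (\<epsilon> * real n)) * (\<integral>\<^sup>+xs. ennreal (tau (env z) xs n) \<partial>W)" by simp
    also have "\<dots> \<le> ennreal (1 / (\<epsilon> * real n)) * ennreal (real n * a)"
      using E2[of n] K by (intro mult_left_mono order_trans[OF E] ennreal_leI) auto
    also have "\<dots> = ennreal (1 / (\<epsilon> * real n) * (real n * a))"
      using en by (intro ennreal_mult'[symmetric]) auto
    also have "1 / (\<epsilon> * real n) * (real n * a) = a / \<epsilon>" using n \<epsilon> by (simp add: field_simps)
    also have "{xs \<in> space W. 1 \<le> ennreal (1 / (\<epsilon> * real n)) * ennreal (tau (env z) xs n)}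
        = {xs. tau (env z) xs n \<ge> \<epsilon> * real n}"
      using en tau_nonneg[of "env z" _ n]
      by (simp add: ennreal_mult'[symmetric] le_divide_eq ennreal_1[symmetric] del: ennreal_1)
    finally show ?thesis
      using a0 \<epsilon> by (simp add: W.emeasure_eq_measure)
  qed
  show ?thesis
    unfolding eventually_sequentially
  proof (intro exI allI impI prob)
    fix n assume n: "n \<ge> Suc (nat \<lceil>C * real N / \<eta>\<rceil>)"
    then show "n > 0" by simp
    show "C * real N / \<eta> \<le> real n" using n by linarith
  qed
qed

text \<open>The truncated part obeys the law of large numbers for bounded gaps; the remainder has
  mean gap \<open>\<mu> - \<nu> M\<close> and is handled by \<open>tau_upper\<close>. A one-sided
  bound is enough for it because its \<open>tau\<close> is nonnegative.\<close>

lemma tau_LLN: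
  assumes z: "\<And>j. 0 \<le> z j" and mean: "has_window_mean z \<mu>"
    and trunc: "\<And>M::nat. has_window_mean (\<lambda>j. min (z j) (real M)) (\<nu> M)"
    and \<nu>: "\<nu> \<longlonglongrightarrow> \<mu>" "\<And>M. \<nu> M \<le> \<mu>" and \<epsilon>: "\<epsilon> > 0"
  shows "(\<lambda>n. W.prob {xs. \<bar>tau (env z) xs n - real n * (mbar p * \<mu>)\<bar> \<ge> \<epsilon> * real n}) \<longlonglongrightarrow> 0"
proof (rule tendstoI)
  fix e :: real assume e: "e > 0"
  \<comment> \<open>The first entry keeps the change of centring \<open>D\<close> below a third of
    the tolerance; the second makes the Markov bound \<open>a / (\<epsilon> / 3)\<close> at most
    e/2.\<close>
  define a where "a = min (\<epsilon> / 3) (\<epsilon> * e / 6)"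
  have a: "a > 0" using e \<epsilon> by (simp add: a_def)
  have "(\<lambda>M. mbar p * (\<mu> - \<nu> M)) \<longlonglongrightarrow> mbar p * (\<mu> - \<mu>)"
    by (intro tendsto_intros \<nu>)
  then have "\<forall>\<^sub>F M in sequentially. mbar p * (\<mu> - \<nu> M) < a"
    using a by (intro order_tendstoD) auto
  then obtain M where M: "mbar p * (\<mu> - \<nu> M) < a" by (auto simp: eventually_sequentially)
  let ?y = "\<lambda>j. min (z j) (real M)" and ?r = "\<lambda>j. z j - min (z j) (real M)"
  have e3: "\<epsilon> / 3 > 0" using \<epsilon> by simp
  have "\<forall>\<^sub>F n in sequentially. W.prob {xs. \<bar>tau (env ?y) xs n - real n * (mbar p * \<nu> M)\<bar> \<ge> \<epsilon> / 3 * real n} < e / 2"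
    by (rule order_tendstoD(2)[OF tau_LLN_bounded[where M="real M", OF _ _ trunc e3]]) (use z e in auto)
  moreover have "\<forall>\<^sub>F n in sequentially. W.prob {xs. tau (env ?r) xs n \<ge> \<epsilon> / 3 * real n} \<le> a / (\<epsilon> / 3)"
    by (rule tau_upper[OF _ has_window_mean_diff[OF mean trunc]]) (use \<nu>(2) e3 M in auto)
  ultimately have "\<forall>\<^sub>F n in sequentially. W.prob {xs. \<bar>tau (env z) xs n - real n * (mbar p * \<mu>)\<bar> \<ge> \<epsilon> * real n} < e"
    using eventually_gt_at_top[of 0]
  proof eventually_elim
    case (elim n)
    let ?A = "{xs. \<bar>tau (env ?y) xs n - real n * (mbar p * \<nu> M)\<bar> \<ge> \<epsilon> / 3 * real n}"
    let ?B = "{xs. tau (env ?r) xs n \<ge> \<epsilon> / 3 * real n}"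
    have meas: "?A \<in> sets W" "?B \<in> sets W" by (rule sets_Collect_W, measurable)+
    have "{xs. \<bar>tau (env z) xs n - real n * (mbar p * \<mu>)\<bar> \<ge> \<epsilon> * real n} \<subseteq> ?A \<union> ?B"
    proof
      fix xs assume "xs \<in> {xs. \<bar>tau (env z) xs n - real n * (mbar p * \<mu>)\<bar> \<ge> \<epsilon> * real n}"
      then have x: "\<bar>tau (env z) xs n - real n * (mbar p * \<mu>)\<bar> \<ge> \<epsilon> * real n" by simp
      have t: "tau (env ?y) xs n + tau (env ?r) xs n = tau (env z) xs n"
        by (rule tau_env_add) (use z in auto)
      have r0: "0 \<le> tau (env ?r) xs n" by (rule tau_nonneg)
      define D where "D = real n * (mbar p * (\<mu> - \<nu> M))"
      have D: "0 \<le> D" "D \<le> \<epsilon> / 3 * real n"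
      proof -
        show "0 \<le> D" using \<nu>(2)[of M] mbar_pos by (simp add: D_def)
        have "mbar p * (\<mu> - \<nu> M) \<le> \<epsilon> / 3" using M by (simp add: a_def)
        then show "D \<le> \<epsilon> / 3 * real n" unfolding D_def mult.commute[of "\<epsilon> / 3"]
          by (rule mult_left_mono) simp
      qed
      have Deq: "real n * (mbar p * \<mu>) = real n * (mbar p * \<nu> M) + D"
        by (simp add: D_def algebra_simps)
      have pos: "\<epsilon> * real n > 0" using \<epsilon> elim by simp
      define E where "E = \<epsilon> / 3 * real n"
      have E3: "\<epsilon> * real n = 3 * E" by (simp add: E_def)
      show "xs \<in> ?A \<union> ?B"
      proof (rule ccontr)
        assume "xs \<notin> ?A \<union> ?B"
        then have "\<bar>tau (env ?y) xs n - real n * (mbar p * \<nu> M)\<bar> < \<epsilon> / 3 * real n"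
          "tau (env ?r) xs n < \<epsilon> / 3 * real n" by (auto simp: not_le)
        then show False using x t r0 D pos unfolding Deq E3 E_def[symmetric] by linarith
      qed
    qed
    then have "W.prob {xs. \<bar>tau (env z) xs n - real n * (mbar p * \<mu>)\<bar> \<ge> \<epsilon> * real n} \<le> W.prob (?A \<union> ?B)"
      using meas by (intro W.finite_measure_mono) auto
    also have "\<dots> \<le> W.prob ?A + W.prob ?B" using meas by (intro measure_Un_le) auto
    also have "\<dots> < e / 2 + a / (\<epsilon> / 3)" using elim by linarith
    also have "a / (\<epsilon> / 3) \<le> e / 2" using \<epsilon> by (simp add: a_def field_simps min_def)
    finally show ?case by simp
  qed
  then show "\<forall>\<^sub>F n in sequentially. dist (W.prob {xs. \<bar>tau (env z) xs n - real n * (mbar p * \<mu>)\<bar> \<ge> \<epsilon> * real n}) 0 < e"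
    by eventually_elim (simp add: measure_nonneg)
qed

end

section \<open>The random time change\<close>

lemma norm_iexp_diff_le: "norm (iexp a - iexp b) \<le> \<bar>a - b\<bar>"
proof -
  have "iexp a - iexp b = iexp b * (iexp (a - b) - 1)"
    by (simp add: right_diff_distrib exp_add[symmetric] algebra_simps)
  moreover have "norm (iexp (a - b) - 1) \<le> \<bar>a - b\<bar>"
    using iexp_approx1[of "a - b" 0] by simp
  ultimately show ?thesis by (simp add: norm_mult)
qed

text \<open>By Levy's continuity theorem it suffices to compare characteristic functions. Their
  integrands differ by at most 2 on the event that \<open>X n\<close> and \<open>Y n\<close> are
  \<epsilon> apart, and by at most |u| \<epsilon> off it.\<close>

lemma (in prob_space) slutsky:
  fixes X Y :: "nat \<Rightarrow> 'a \<Rightarrow> real"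
  assumes [measurable]: "\<And>n. random_variable borel (X n)" "\<And>n. random_variable borel (Y n)"
    and \<nu>: "real_distribution \<nu>" and X: "weak_conv_m (\<lambda>n. distr M borel (X n)) \<nu>"
    and close: "\<And>\<epsilon>. \<epsilon> > 0 \<Longrightarrow> (\<lambda>n. prob {x \<in> space M. \<bar>Y n x - X n x\<bar> \<ge> \<epsilon>}) \<longlonglongrightarrow> 0"
  shows "weak_conv_m (\<lambda>n. distr M borel (Y n)) \<nu>"
proof (rule levy_continuity)
  show "real_distribution (distr M borel (Y n))" for n by simp
  fix u :: real
  have X_lim: "(\<lambda>n. char (distr M borel (X n)) u) \<longlonglongrightarrow> char \<nu> u"
    by (rule levy_continuity1[OF _ \<nu> X]) simp
  have char_eq: "char (distr M borel Z) u = (CLINT x|M. iexp (u * Z x))"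
    if [measurable]: "random_variable borel Z" for Z
    unfolding char_def by (subst integral_distr) auto
  have diff: "norm (char (distr M borel (Y n)) u - char (distr M borel (X n)) u)
      \<le> 2 * prob {x \<in> space M. \<bar>Y n x - X n x\<bar> \<ge> \<epsilon>} + \<bar>u\<bar> * \<epsilon>" if "\<epsilon> > 0" for \<epsilon> n
  proof -
    let ?B = "{x \<in> space M. \<bar>Y n x - X n x\<bar> \<ge> \<epsilon>}"
    have int: "integrable M (\<lambda>x. iexp (u * Y n x))" "integrable M (\<lambda>x. iexp (u * X n x))"
      by (rule integrable_iexp, measurable)+
    have "char (distr M borel (Y n)) u - char (distr M borel (X n)) u
        = (CLINT x|M. iexp (u * Y n x) - iexp (u * X n x))"
      using int by (simp add: char_eq)
    also have "norm \<dots> \<le> (\<integral>x. norm (iexp (u * Y n x) - iexp (u * X n x)) \<partial>M)"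
      by (rule integral_norm_bound)
    also have "\<dots> \<le> (\<integral>x. 2 * indicator ?B x + \<bar>u\<bar> * \<epsilon> \<partial>M)"
    proof (rule integral_mono)
      show "integrable M (\<lambda>x. norm (iexp (u * Y n x) - iexp (u * X n x)))"
        using int by (intro integrable_norm Bochner_Integration.integrable_diff)
      show "integrable M (\<lambda>x. 2 * indicator ?B x + \<bar>u\<bar> * \<epsilon>)"
        by (auto simp: emeasure_eq_measure)
      show "norm (iexp (u * Y n x) - iexp (u * X n x)) \<le> 2 * indicator ?B x + \<bar>u\<bar> * \<epsilon>"
        if x: "x \<in> space M" for x
      proof (cases "x \<in> ?B")
        case True
        have "norm (iexp (u * Y n x) - iexp (u * X n x)) \<le> norm (iexp (u * Y n x)) + norm (iexp (u * X n x))"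
          by (rule norm_triangle_ineq4)
        also have "\<dots> = 2" by simp
        finally show ?thesis using True \<open>\<epsilon> > 0\<close> by (simp add: add_increasing2)
      next
        case False
        then have "\<bar>Y n x - X n x\<bar> \<le> \<epsilon>" using x by simp
        have "norm (iexp (u * Y n x) - iexp (u * X n x)) \<le> \<bar>u * Y n x - u * X n x\<bar>"
          by (rule norm_iexp_diff_le)
        also have "\<dots> = \<bar>u\<bar> * \<bar>Y n x - X n x\<bar>"
          by (simp add: abs_mult[symmetric] right_diff_distrib)
        also have "\<dots> \<le> \<bar>u\<bar> * \<epsilon>" by (intro mult_left_mono) (fact, simp)
        finally show ?thesis by (simp add: add_increasing)
      qed
    qed
    also have "\<dots> = 2 * prob ?B + \<bar>u\<bar> * \<epsilon>"
      by (simp add: emeasure_eq_measure prob_space)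
    finally show ?thesis .
  qed
  have "(\<lambda>n. char (distr M borel (Y n)) u - char (distr M borel (X n)) u) \<longlonglongrightarrow> 0"
  proof (rule tendstoI)
    fix e :: real assume e: "e > 0"
    \<comment> \<open>The added 1 covers \<open>u = 0\<close>; the term |u| \<epsilon> then stays
      within e/2.\<close>
    define \<epsilon> where "\<epsilon> = e / (2 * (\<bar>u\<bar> + 1))"
    have \<epsilon>: "\<epsilon> > 0" using e by (simp add: \<epsilon>_def)
    have "\<bar>u\<bar> * \<epsilon> \<le> (\<bar>u\<bar> + 1) * \<epsilon>" using \<epsilon> by simp
    also have "\<dots> = e / 2"
    proof -
      have *: "w * (e / (2 * w)) = e / 2" if "w > 0" for w :: real using that by simp
      show ?thesis unfolding \<epsilon>_def by (rule *) simp
    qed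
    finally have u: "\<bar>u\<bar> * \<epsilon> \<le> e / 2" .
    have "\<forall>\<^sub>F n in sequentially. prob {x \<in> space M. \<bar>Y n x - X n x\<bar> \<ge> \<epsilon>} < e / 4"
      using order_tendstoD(2)[OF close[OF \<epsilon>], of "e / 4"] e by simp
    then show "\<forall>\<^sub>F n in sequentially. dist (char (distr M borel (Y n)) u - char (distr M borel (X n)) u) 0 < e"
    proof eventually_elim
      case (elim n)
      show ?case using diff[OF \<epsilon>, of n] elim u by simp
    qed
  qed
  from tendsto_add[OF this X_lim] show "(\<lambda>n. char (distr M borel (Y n)) u) \<longlonglongrightarrow> char \<nu> u" by simp
qed (rule \<nu>)

section \<open>Rescaling and reindexing weak limits\<close>

lemma distr_scale_std_normal:
  assumes s: "s > 0"
  shows "distr std_normal_distribution borel (\<lambda>x. s * x) = density lborel (normal_density 0 s)"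
proof -
  interpret N: prob_space std_normal_distribution
    by (rule prob_space_normal_density) simp
  have "distributed std_normal_distribution lborel (\<lambda>x. x) std_normal_density"
    by (auto simp: distributed_def intro!: distr_id2)
  from N.normal_density_affine[OF this _ , of s 0] s
  have "distributed std_normal_distribution lborel (\<lambda>x. s * x) (normal_density 0 s)" by simp
  then have "distr std_normal_distribution lborel (\<lambda>x. s * x) = density lborel (normal_density 0 s)"
    by (simp add: distributed_def)
  moreover have "distr std_normal_distribution lborel (\<lambda>x. s * x) = distr std_normal_distribution borel (\<lambda>x. s * x)"
    by (rule distr_cong) auto
  ultimately show ?thesis by simp
qed

lemma weak_conv_m_scale:
  assumes X: "\<And>n. real_distribution (X n)" "real_distribution \<nu>" and c: "weak_conv_m X \<nu>"
  shows "weak_conv_m (\<lambda>n. distr (X n) borel (\<lambda>x. s * x)) (distr \<nu> borel (\<lambda>x. s * x))"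
proof (rule levy_continuity)
  have rd: "real_distribution (distr N borel (\<lambda>x. s * x))" if "real_distribution N" for N
  proof -
    interpret real_distribution N by fact
    show ?thesis by (rule real_distribution_distr) simp
  qed
  have ch: "char (distr N borel (\<lambda>x. s * x)) u = char N (u * s)" if "real_distribution N" for N u
  proof -
    interpret real_distribution N by fact
    show ?thesis unfolding char_def by (subst integral_distr) (auto simp: mult.assoc)
  qed
  show "real_distribution (distr (X n) borel (\<lambda>x. s * x))" for n by (rule rd[OF X(1)])
  show "real_distribution (distr \<nu> borel (\<lambda>x. s * x))" by (rule rd[OF X(2)])
  show "(\<lambda>n. char (distr (X n) borel (\<lambda>x. s * x)) u) \<longlonglongrightarrow> char (distr \<nu> borel (\<lambda>x. s * x)) u" for u
    unfolding ch[OF X(1)] ch[OF X(2)] by (rule levy_continuity1[OF X c])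
qed

lemma weak_conv_m_compose:
  assumes "weak_conv_m X \<nu>" "filterlim m at_top sequentially"
  shows "weak_conv_m (\<lambda>n. X (m n)) \<nu>"
  using assms unfolding weak_conv_m_def weak_conv_def by (auto intro: filterlim_compose)

text \<open>A pathwise statement. If \<open>t\<close> lies between \<open>tau\<close> at
  \<open>a\<close> and at \<open>b\<close>, the step in progress at time \<open>t\<close> has index
  in \<open>[a, b)\<close>, so the process is between sites visited during that stretch, all of
  which are close to \<mu> times the position at \<open>a\<close>.\<close>

lemma procX_close:
  assumes z: "\<And>j. 0 \<le> z j" and \<mu>: "\<mu> \<ge> 0" and \<eta>: "\<eta> \<ge> 0"
    and E: "\<And>k. \<bar>env z k - \<mu> * real_of_int k\<bar> \<le> \<eta> * \<bar>real_of_int k\<bar> + C"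
    and t0: "0 \<le> t" and t1: "tau (env z) xs a \<le> t" and t2: "t < tau (env z) xs b"
    and d: "\<And>k. a \<le> k \<Longrightarrow> k \<le> b \<Longrightarrow> \<bar>real_of_int (walkS xs k) - real_of_int (walkS xs a)\<bar> \<le> d"
  shows "\<bar>procX (env z) xs t - \<mu> * real_of_int (walkS xs a)\<bar>
    \<le> 3 * \<eta> * \<bar>real_of_int (walkS xs a)\<bar> + 3 * C + (3 * \<eta> + 3 * \<mu>) * d"
proof -
  let ?T = "tau (env z) xs" and ?S = "\<lambda>k. real_of_int (walkS xs k)" and ?w = "\<lambda>k. env z (walkS xs k)"
  define N where "N = (LEAST n. t < ?T (Suc n))"
  have b0: "b \<noteq> 0" using t0 t2 by (intro notI) (simp add: tau_def)
  then have "t < ?T (Suc (b - 1))" using t2 by simp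
  then have N1: "t < ?T (Suc N)" and "N \<le> b - 1"
    unfolding N_def by (rule LeastI, rule Least_le)
  then have Nb: "Suc N \<le> b" using b0 by simp
  have N2: "?T N \<le> t"
  proof (cases N)
    case 0
    then show ?thesis using t0 by (simp add: tau_def)
  next
    case (Suc N')
    then have "N' < (LEAST n. t < ?T (Suc n))" unfolding N_def by simp
    from not_less_Least[OF this] have "\<not> t < ?T (Suc N')" .
    then show ?thesis using Suc by simp
  qed
  have aN: "a \<le> N"
  proof (rule ccontr)
    assume "\<not> a \<le> N"
    then have "?T (Suc N) \<le> ?T a" by (intro tau_mono) simp
    then show False using N1 t1 by simp
  qed
  define q where "q = sgn (real_of_int (xs N)) * (t - ?T N)"
  have X: "procX (env z) xs t = ?w N + q"
    unfolding procX_def Let_def N_def q_def ..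
  have "\<bar>procX (env z) xs t - ?w N\<bar> = \<bar>q\<bar>" unfolding X by simp
  \<comment> \<open>Of the direction of motion only \<open>|sgn| \<le> 1\<close> is used: within a
    step the process moves no farther than the length of the jump.\<close>
  also have "\<dots> \<le> 1 * (t - ?T N)"
    unfolding q_def abs_mult using N2 by (intro mult_mono) (auto simp: sgn_real_def)
  also have "\<dots> \<le> ?T (Suc N) - ?T N" using N1 by simp
  also have "\<dots> = \<bar>?w (Suc N) - ?w N\<bar>"
    by (simp add: tau_eq_sum walkS_Suc)
  finally have 1: "\<bar>procX (env z) xs t - ?w N\<bar> \<le> \<bar>?w (Suc N) - ?w N\<bar>" .
  have w: "\<bar>?w k - \<mu> * ?S a\<bar> \<le> \<eta> * \<bar>?S a\<bar> + C + (\<eta> + \<mu>) * d" if "a \<le> k" "k \<le> b" for k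
  proof -
    note dk = d[OF that]
    have "\<bar>\<mu> * ?S k - \<mu> * ?S a\<bar> \<le> \<mu> * d"
      using dk \<mu> by (simp add: right_diff_distrib[symmetric] abs_mult mult_left_mono)
    moreover have "\<eta> * \<bar>?S k\<bar> \<le> \<eta> * (\<bar>?S a\<bar> + d)"
      using dk \<eta> by (intro mult_left_mono) auto
    moreover note E[of "walkS xs k"]
    ultimately show ?thesis unfolding distrib_left distrib_right by linarith
  qed
  define K where "K = \<eta> * \<bar>?S a\<bar> + C + (\<eta> + \<mu>) * d"
  have "\<bar>?w N - \<mu> * ?S a\<bar> \<le> K" "\<bar>?w (Suc N) - \<mu> * ?S a\<bar> \<le> K"
    unfolding K_def by (rule w, use aN Nb in simp, use aN Nb in simp)+
  \<comment> \<open>One \<open>K\<close> for the site where the step begins and two more for the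
    length of the jump, whose endpoints are both within \<open>K\<close>.\<close>
  then have "\<bar>procX (env z) xs t - \<mu> * ?S a\<bar> \<le> 3 * K"
    using 1 by linarith
  then have "\<bar>procX (env z) xs t - \<mu> * ?S a\<bar> \<le> 3 * (\<eta> * \<bar>?S a\<bar> + C + (\<eta> + \<mu>) * d)"
    unfolding K_def .
  then show ?thesis by (simp add: algebra_simps)
qed

context unimodal_walk
begin

lemma measurable_procX [measurable]: "(\<lambda>xs. procX \<omega> xs t) \<in> borel_measurable W"
proof -
  let ?N = "\<lambda>xs. LEAST n. t < tau \<omega> xs (Suc n)"
  have N: "?N \<in> measurable W (count_space UNIV)" by measurable
  have "(\<lambda>xs. (\<lambda>n xs. \<omega> (walkS xs n) + sgn (real_of_int (xs n)) * (t - tau \<omega> xs n)) (?N xs) xs)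
      \<in> borel_measurable W"
    by (rule measurable_compose_countable[OF _ N]) measurable
  then show ?thesis by (simp add: procX_def Let_def)
qed

lemma increment_maximal:
  assumes d: "0 < d"
  shows "W.prob {xs. \<exists>k\<le>n. \<bar>real_of_int (walkS xs (a + k)) - real_of_int (walkS xs a)\<bar> \<ge> d} \<le> real n * vp p / d\<^sup>2"
proof -
  let ?A = "{xs. \<exists>k\<le>n. \<bar>real_of_int (walkS xs (a + k)) - real_of_int (walkS xs a)\<bar> \<ge> d}"
  have A: "?A \<in> sets W" by (rule sets_Collect_W) measurable
  have "comb_seq a \<omega> \<omega>' \<in> ?A \<longleftrightarrow> (\<exists>k\<le>n. \<bar>0 + real_of_int (walkS \<omega>' k)\<bar> \<ge> d)" for \<omega> \<omega>'
    by (simp add: of_int_diff[symmetric] walkS_comb_seq_shift del: of_int_diff)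
  then have "W.prob ?A = W.prob {xs. \<exists>k\<le>n. \<bar>0 + real_of_int (walkS xs k)\<bar> \<ge> d}"
    by (subst prob_split[OF A, of a]) (simp add: W.prob_space[simplified])
  also have "\<dots> \<le> (0\<^sup>2 + real n * vp p) / d\<^sup>2" by (rule kolmogorov_maximal[OF d])
  finally show ?thesis by simp
qed

lemma walkS_chebyshev:
  assumes d: "0 < d"
  shows "W.prob {xs. \<bar>real_of_int (walkS xs n)\<bar> \<ge> d} \<le> real n * vp p / d\<^sup>2"
proof -
  have "W.prob {xs. \<bar>real_of_int (walkS xs n)\<bar> \<ge> d} \<le> W.prob {xs. \<exists>k\<le>n. \<bar>0 + real_of_int (walkS xs k)\<bar> \<ge> d}"
    by (intro W.finite_measure_mono sets_Collect_W) auto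
  also have "\<dots> \<le> (0\<^sup>2 + real n * vp p) / d\<^sup>2" by (rule kolmogorov_maximal[OF d])
  finally show ?thesis by simp
qed

text \<open>Outside events of small probability, \<open>t\<close> is enclosed between
  \<open>tau\<close> at the deterministic counts \<open>a n\<close> and \<open>b n\<close>, a
  proportion \<delta> below and above t/c. Between these counts the walk hardly moves, by the
  maximal inequality, so it does not matter that the actual count depends on the walk.\<close>

lemma procX_approx:
  assumes z: "\<And>j. 0 \<le> z j" and mean: "has_window_mean z \<mu>" and \<mu>: "\<mu> > 0"
    and LLN: "\<And>\<epsilon>. \<epsilon> > 0 \<Longrightarrow>
      (\<lambda>n. W.prob {xs. \<bar>tau (env z) xs n - real n * (mbar p * \<mu>)\<bar> \<ge> \<epsilon> * real n}) \<longlonglongrightarrow> 0"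
    and \<kappa>: "\<kappa> > 0" and t: "filterlim t at_top sequentially"
  shows "(\<lambda>n. W.prob {xs. \<bar>procX (env z) xs (t n) - \<mu> * real_of_int (walkS xs (nat \<lfloor>t n / (mbar p * \<mu>)\<rfloor>))\<bar>
    \<ge> \<kappa> * sqrt (t n)}) \<longlonglongrightarrow> 0"
proof (rule tendstoI)
  fix e :: real assume e: "e > 0"
  define c where "c = mbar p * \<mu>"
  have c: "c > 0" using \<mu> mbar_pos by (simp add: c_def)
  \<comment> \<open>\<open>\<eta> \<le> \<mu>\<close> gives 3 \<eta> + 4 \<mu> \<le> 7 \<mu> below.
    The Chebyshev bound for \<open>?L\<close> is 144 \<eta>^2 vp / (\<kappa>^2 c); with
    \<open>\<eta> \<le> 1\<close> on one factor and the last entry on the other it is at most 0.144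
    e.\<close>
  define \<eta> where "\<eta> = min (min \<mu> 1) (e * \<kappa>\<^sup>2 * c / (1000 * vp p))"
  have \<eta>: "\<eta> > 0" "\<eta> \<le> \<mu>" "\<eta> \<le> 1" "\<eta> \<le> e * \<kappa>\<^sup>2 * c / (1000 * vp p)"
    using \<mu> e \<kappa> c vp_pos by (auto simp: \<eta>_def)
  \<comment> \<open>The maximal inequality for \<open>?D\<close> yields 3136 \<delta> \<mu>^2 vp /
    (\<kappa>^2 c) with 3136 = 4 * 28^2, hence at most 0.3136 e. The cap 1/2 keeps
    \<open>1 - \<delta>\<close> positive, so that \<open>a n\<close> tends to infinity.\<close>
  define \<delta> where "\<delta> = min (1 / 2) (e * \<kappa>\<^sup>2 * c / (10000 * \<mu>\<^sup>2 * vp p))"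
  have \<delta>: "\<delta> > 0" "\<delta> \<le> 1 / 2" "\<delta> \<le> e * \<kappa>\<^sup>2 * c / (10000 * \<mu>\<^sup>2 * vp p)"
    using \<mu> e \<kappa> c vp_pos by (auto simp: \<delta>_def)
  obtain C where C: "C \<ge> 0" "\<And>k. \<bar>env z k - \<mu> * real_of_int k\<bar> \<le> \<eta> * \<bar>real_of_int k\<bar> + C"
    using has_window_mean_env_bound[OF mean \<eta>(1)] by blast
  define a where "a n = nat \<lfloor>(1 - \<delta>) * (t n / c)\<rfloor>" for n
  define b where "b n = nat \<lceil>(1 + \<delta>) * (t n / c)\<rceil>" for n
  define m where "m n = nat \<lfloor>t n / c\<rfloor>" for n
  \<comment> \<open>The relative tolerance is \<delta>/2 because (1 + \<delta>/2)(1 - \<delta>)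
    \<le> 1 \<le> (1 - \<delta>/2)(1 + \<delta>): at good counts \<open>a n\<close> and
    \<open>b n\<close> the clock encloses \<open>t n\<close>.\<close>
  let ?bad = "\<lambda>n. {xs. \<bar>tau (env z) xs n - real n * c\<bar> \<ge> c * \<delta> / 2 * real n}"
  have tc: "filterlim (\<lambda>n. r * (t n / c)) at_top sequentially" if "r > 0" for r
    using filterlim_tendsto_pos_mult_at_top[OF tendsto_const[of "r / c"] _ t] that c
    by (simp add: mult.commute)
  have a_lim: "filterlim a at_top sequentially"
    unfolding a_def
    by (rule filterlim_compose[OF filterlim_nat_sequentially], rule filterlim_compose[OF filterlim_floor_sequentially], rule tc)
       (use \<delta> in simp)
  have b_lim: "filterlim b at_top sequentially"
  proof (rule filterlim_at_top_mono[OF a_lim])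
    have "\<forall>\<^sub>F n in sequentially. 0 \<le> t n" using t unfolding filterlim_at_top by blast
    then show "\<forall>\<^sub>F n in sequentially. a n \<le> b n"
    proof eventually_elim
      case (elim n)
      then have "(1 - \<delta>) * (t n / c) \<le> (1 + \<delta>) * (t n / c)"
        using c \<delta> by (intro mult_right_mono) auto
      then show ?case unfolding a_def b_def by (intro nat_mono) linarith
    qed
  qed
  have cd: "c * \<delta> / 2 > 0" using c \<delta> by simp
  note bad = LLN[OF cd, folded c_def]
  have e8: "e / 8 > 0" using e by simp
  have "\<forall>\<^sub>F n in sequentially. W.prob (?bad (a n)) < e / 8"
    using order_tendstoD(2)[OF filterlim_compose[OF bad a_lim] e8] .
  moreover have "\<forall>\<^sub>F n in sequentially. W.prob (?bad (b n)) < e / 8"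
    using order_tendstoD(2)[OF filterlim_compose[OF bad b_lim] e8] .
  \<comment> \<open>The first threshold makes the constant \<open>3 * C\<close> at most a quarter of
    the tolerance; the second gives \<open>1 \<le> \<delta> * (t n / c)\<close>, which absorbs the
    rounding in \<open>a n\<close> and \<open>b n\<close>.\<close>
  moreover have "\<forall>\<^sub>F n in sequentially. max (1 + (12 * C / \<kappa>)\<^sup>2) (c / \<delta>) < t n"
    using t unfolding filterlim_at_top_dense by blast
  ultimately have "\<forall>\<^sub>F n in sequentially. W.prob {xs. \<bar>procX (env z) xs (t n) - \<mu> * real_of_int (walkS xs (m n))\<bar>
    \<ge> \<kappa> * sqrt (t n)} < e"
  proof eventually_elim
    case (elim n)
    let ?t = "t n" and ?T = "tau (env z)"
    define s where "s = sqrt ?t"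
    have t1: "1 + (12 * C / \<kappa>)\<^sup>2 < ?t" "c / \<delta> < ?t"
      using elim(3) unfolding max_less_iff_conj by auto
    have t0: "?t > 0" using t1(1) zero_le_power2[of "12 * C / \<kappa>"] by linarith
    have s: "s > 0" "s\<^sup>2 = ?t" using t0 by (auto simp: s_def)
    have tcp: "?t / c > 0" using t0 c by simp
    have "(12 * C / \<kappa>)\<^sup>2 \<le> s\<^sup>2" unfolding s(2) using t1(1) by linarith
    then have "12 * C / \<kappa> \<le> s" by (rule power2_le_imp_le) (rule less_imp_le[OF s(1)])
    then have sC: "12 * C \<le> \<kappa> * s" using \<kappa> by (simp add: pos_divide_le_eq mult.commute)
    have dt: "1 \<le> \<delta> * (?t / c)" using t1(2) \<delta>(1) c by (simp add: field_simps)
    have a1: "real (a n) \<le> (1 - \<delta>) * (?t / c)"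
    proof -
      have "(1 - \<delta>) * (?t / c) \<ge> 0"
        using \<delta> by (intro mult_nonneg_nonneg less_imp_le[OF tcp]) simp
      then show ?thesis unfolding a_def by linarith
    qed
    have a2: "(1 - \<delta>) * (?t / c) - 1 \<le> real (a n)" unfolding a_def by linarith
    have b1: "(1 + \<delta>) * (?t / c) \<le> real (b n)" unfolding b_def by linarith
    have b2: "real (b n) \<le> (1 + \<delta>) * (?t / c) + 1"
    proof -
      have "(1 + \<delta>) * (?t / c) \<ge> 0"
        using \<delta> by (intro mult_nonneg_nonneg less_imp_le[OF tcp]) simp
      then show ?thesis unfolding b_def by linarith
    qed
    have m1: "real (m n) \<le> ?t / c" "?t / c - 1 < real (m n)" unfolding m_def using tcp by linarith+
    have am: "a n \<le> m n"
      unfolding a_def m_def using \<delta>(1) tcp mult_right_mono[of "1 - \<delta>" 1 "?t / c"] by (intro nat_mono floor_mono) simp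
    have mb: "m n \<le> b n"
    proof -
      have "1 * (?t / c) \<le> (1 + \<delta>) * (?t / c)"
        using \<delta> tcp by (intro mult_right_mono) auto
      then have "real (m n) \<le> real (b n)" using m1 b1 by linarith
      then show ?thesis by simp
    qed
    \<comment> \<open>The tolerance \<open>\<kappa> * s\<close> is split into quarters: 7 \<mu> d, 3
      \<eta> l and 3 C take at most one each, whence 28 = 4 * 7 and 12 = 4 * 3. The last quarter
      makes the inequality strict.\<close>
    define d where "d = \<kappa> * s / (28 * \<mu>)"
    have d: "d > 0" using \<kappa> s \<mu> by (simp add: d_def)
    define l where "l = \<kappa> * s / (12 * \<eta>)"
    have l: "l > 0" using \<kappa> s \<eta> by (simp add: l_def)
    let ?D = "{xs. \<exists>k\<le>b n - a n. \<bar>real_of_int (walkS xs (a n + k)) - real_of_int (walkS xs (a n))\<bar> \<ge> d}"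
    let ?L = "{xs. \<bar>real_of_int (walkS xs (a n))\<bar> \<ge> l}"
    let ?Z = "{xs. \<bar>procX (env z) xs ?t - \<mu> * real_of_int (walkS xs (m n))\<bar> \<ge> \<kappa> * s}"
    have sub: "?Z \<subseteq> ?bad (a n) \<union> ?bad (b n) \<union> ?D \<union> ?L"
    proof (rule subsetI, rule ccontr)
      fix xs assume "xs \<in> ?Z" and notin: "xs \<notin> ?bad (a n) \<union> ?bad (b n) \<union> ?D \<union> ?L"
      then have Z: "\<bar>procX (env z) xs ?t - \<mu> * real_of_int (walkS xs (m n))\<bar> \<ge> \<kappa> * s" by simp
      have "x \<notin> A \<union> B \<union> C \<union> D \<Longrightarrow> x \<notin> A \<and> x \<notin> B \<and> x \<notin> C \<and> x \<notin> D"
        for x :: "nat \<Rightarrow> int" and A B C D by blast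
      note n1 = this[OF notin]
      note n2 = conjunct2[OF n1]
      note n3 = conjunct2[OF n2]
      have ba: "\<bar>?T xs (a n) - real (a n) * c\<bar> < c * \<delta> / 2 * real (a n)"
        using conjunct1[OF n1] unfolding mem_Collect_eq not_le .
      have bb: "\<bar>?T xs (b n) - real (b n) * c\<bar> < c * \<delta> / 2 * real (b n)"
        using conjunct1[OF n2] unfolding mem_Collect_eq not_le .
      have D: "\<bar>real_of_int (walkS xs (a n + k)) - real_of_int (walkS xs (a n))\<bar> < d" if "k \<le> b n - a n" for k
        using conjunct1[OF n3] that unfolding mem_Collect_eq by (meson not_le)
      have L: "\<bar>real_of_int (walkS xs (a n))\<bar> < l"
        using conjunct2[OF n3] unfolding mem_Collect_eq not_le .
      have D': "\<bar>real_of_int (walkS xs k) - real_of_int (walkS xs (a n))\<bar> \<le> d" if "a n \<le> k" "k \<le> b n" for k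
        using D[of "k - a n", OF diff_le_mono[OF that(2)]] that(1) by simp
      have Ta: "?T xs (a n) \<le> ?t"
      proof -
        have "real (a n) * c \<le> (1 - \<delta>) * ?t" using a1 c by (simp add: field_simps)
        moreover have "c * \<delta> / 2 * real (a n) \<le> \<delta> * ?t"
        proof -
          have "\<delta> * (real (a n) * c) \<le> \<delta> * ((1 - \<delta>) * ?t)" using calculation \<delta> by (intro mult_left_mono) auto
          also have "\<dots> \<le> \<delta> * (1 * ?t)" using \<delta> t0 by (intro mult_left_mono mult_right_mono) auto
          finally show ?thesis using \<delta> t0 by (simp add: mult_ac)
        qed
        ultimately show ?thesis using ba unfolding left_diff_distrib by linarith
      qed
      have Tb: "?t < ?T xs (b n)"
      proof -
        have "(1 + \<delta>) * ?t \<le> real (b n) * c" using b1 c by (simp add: field_simps)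
        then have "(1 - \<delta> / 2) * ((1 + \<delta>) * ?t) \<le> (1 - \<delta> / 2) * (real (b n) * c)"
          using \<delta> by (intro mult_left_mono) auto
        moreover have "1 * ?t \<le> ((1 - \<delta> / 2) * (1 + \<delta>)) * ?t"
        proof (intro mult_right_mono)
          have "0 \<le> \<delta> * (1 - \<delta>)" using \<delta> by (intro mult_nonneg_nonneg) auto
          then show "1 \<le> (1 - \<delta> / 2) * (1 + \<delta>)" by (simp add: algebra_simps)
        qed (use t0 in simp)
        ultimately have "?t \<le> real (b n) * c - c * \<delta> / 2 * real (b n)" by (simp add: algebra_simps)
        then show ?thesis using bb by linarith
      qed
      have "\<bar>procX (env z) xs ?t - \<mu> * real_of_int (walkS xs (a n))\<bar>
          \<le> 3 * \<eta> * \<bar>real_of_int (walkS xs (a n))\<bar> + 3 * C + (3 * \<eta> + 3 * \<mu>) * d"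
        by (rule procX_close[OF z _ _ C(2) _ Ta Tb D']) (use \<mu> \<eta> t0 in auto)
      moreover have "\<bar>\<mu> * real_of_int (walkS xs (m n)) - \<mu> * real_of_int (walkS xs (a n))\<bar> \<le> \<mu> * d"
        using D'[OF am mb] \<mu> by (simp add: right_diff_distrib[symmetric] abs_mult mult_left_mono)
      moreover have "3 * \<eta> * \<bar>real_of_int (walkS xs (a n))\<bar> \<le> \<kappa> * s / 4"
      proof -
        have "3 * \<eta> * \<bar>real_of_int (walkS xs (a n))\<bar> \<le> 3 * \<eta> * l" using L \<eta> by (intro mult_left_mono) auto
        also have "\<dots> = \<kappa> * s / 4" using \<eta> by (simp add: l_def field_simps)
        finally show ?thesis .
      qed
      moreover have "(3 * \<eta> + 3 * \<mu>) * d + \<mu> * d \<le> \<kappa> * s / 4"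
      proof -
        have "(3 * \<eta> + 3 * \<mu>) * d + \<mu> * d = (3 * \<eta> + 4 * \<mu>) * d" by (simp add: algebra_simps)
        also have "\<dots> \<le> (7 * \<mu>) * d" using \<eta> d by (intro mult_right_mono) auto
        also have "\<dots> = \<kappa> * s / 4" using \<mu> by (simp add: d_def field_simps)
        finally show ?thesis .
      qed
      moreover have "\<kappa> * s > 0" using \<kappa> s by simp
      ultimately show False using Z sC by linarith
    qed
    have meas: "?bad (a n) \<in> sets W" "?bad (b n) \<in> sets W" "?D \<in> sets W" "?L \<in> sets W"
      by (rule sets_Collect_W, measurable)+
    have "W.prob ?Z \<le> W.prob (?bad (a n) \<union> ?bad (b n) \<union> ?D \<union> ?L)"
      using meas by (intro W.finite_measure_mono[OF sub]) auto
    also have "\<dots> \<le> W.prob (?bad (a n)) + W.prob (?bad (b n)) + W.prob ?D + W.prob ?L"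
      using meas by (intro order_trans[OF measure_Un_le] add_mono order.refl) auto
    also have "W.prob ?D \<le> real (b n - a n) * vp p / d\<^sup>2" by (rule increment_maximal[OF d])
    also have "\<dots> \<le> (4 * (\<delta> * (?t / c))) * vp p / d\<^sup>2"
    proof (intro divide_right_mono mult_right_mono)
      have "real (b n - a n) = real (b n) - real (a n)" using am mb by simp
      also have "\<dots> \<le> 2 * (\<delta> * (?t / c)) + 2" using a2 b2 unfolding left_diff_distrib distrib_right by linarith
      finally show "real (b n - a n) \<le> 4 * (\<delta> * (?t / c))" using dt by linarith
    qed (use vp_pos in auto)
    also have "\<dots> = \<delta> * (3136 * \<mu>\<^sup>2 * vp p / (\<kappa>\<^sup>2 * c))"
      using s \<kappa> \<mu> c unfolding d_def s(2)[symmetric] by (simp add: field_simps power2_eq_square)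
    also have "\<dots> \<le> e * \<kappa>\<^sup>2 * c / (10000 * \<mu>\<^sup>2 * vp p) * (3136 * \<mu>\<^sup>2 * vp p / (\<kappa>\<^sup>2 * c))"
      using \<mu> vp_pos \<kappa> c by (intro mult_right_mono \<delta>) auto
    also have "\<dots> = e * (3136 / 10000)"
      using \<mu> vp_pos \<kappa> c by (simp add: field_simps)
    also have "W.prob ?L \<le> real (a n) * vp p / l\<^sup>2" by (rule walkS_chebyshev[OF l])
    also have "\<dots> \<le> (?t / c) * vp p / l\<^sup>2"
      using am m1 vp_pos by (intro divide_right_mono mult_right_mono) auto
    also have "\<dots> = (\<eta> * \<eta>) * (144 * vp p / (\<kappa>\<^sup>2 * c))"
      using s \<kappa> \<eta>(1) c unfolding l_def s(2)[symmetric] by (simp add: field_simps power2_eq_square)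
    also have "\<dots> \<le> (e * \<kappa>\<^sup>2 * c / (1000 * vp p) * 1) * (144 * vp p / (\<kappa>\<^sup>2 * c))"
      using \<eta> vp_pos \<kappa> c e by (intro mult_right_mono mult_mono) auto
    also have "\<dots> = e * (144 / 1000)"
      using vp_pos \<kappa> c by (simp add: field_simps)
    finally have "W.prob ?Z \<le> W.prob (?bad (a n)) + W.prob (?bad (b n)) + e * (3136 / 10000) + e * (144 / 1000)"
      by simp
    then show ?case using elim(1,2) e unfolding s_def by linarith
  qed
  then show "\<forall>\<^sub>F n in sequentially. dist (W.prob {xs. \<bar>procX (env z) xs (t n)
      - \<mu> * real_of_int (walkS xs (nat \<lfloor>t n / (mbar p * \<mu>)\<rfloor>))\<bar> \<ge> \<kappa> * sqrt (t n)}) 0 < e"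
    unfolding m_def c_def by eventually_elim (simp add: measure_nonneg)
qed

text \<open>The central limit theorem is used at the deterministic count \<open>m n\<close>. Two
  errors separate it from the process: the approximation by \<mu> times the walk, and the difference
  between normalising by sqrt(t) and by the standard deviation of the walk. One application of
  \<open>slutsky\<close> removes both.\<close>

lemma quenched_clt:
  assumes z: "\<And>j. 0 \<le> z j" and mean: "has_window_mean z \<mu>" and \<mu>: "\<mu> > 0"
    and LLN: "\<And>\<epsilon>. \<epsilon> > 0 \<Longrightarrow>
      (\<lambda>n. W.prob {xs. \<bar>tau (env z) xs n - real n * (mbar p * \<mu>)\<bar> \<ge> \<epsilon> * real n}) \<longlonglongrightarrow> 0"
    and t: "filterlim t at_top sequentially"
  shows "weak_conv_m (\<lambda>n. distr W borel (\<lambda>xs. procX (env z) xs (t n) / sqrt (t n)))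
    (density lborel (normal_density 0 (sqrt (\<mu> / mbar p * m2 p))))"
proof -
  define c where "c = mbar p * \<mu>"
  have c: "c > 0" using \<mu> mbar_pos by (simp add: c_def)
  define s where "s = sqrt (\<mu> / mbar p * m2 p)"
  have s: "s > 0" using \<mu> mbar_pos vp_pos by (simp add: s_def m2_eq_vp)
  \<comment> \<open>About t/c steps of variance \<open>vp p\<close>, scaled by \<mu>, give \<mu>^2
    vp / c; since \<open>c = mbar p * \<mu>\<close>, one factor \<mu> cancels.\<close>
  have s_eq: "s = \<mu> * sqrt (vp p / c)"
  proof -
    have "\<mu> / mbar p * m2 p = \<mu>\<^sup>2 * (vp p / c)"
      using \<mu> mbar_pos by (simp add: c_def m2_eq_vp power2_eq_square)
    then show ?thesis unfolding s_def using \<mu> by (simp only: real_sqrt_mult real_sqrt_abs abs_of_pos)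
  qed
  define m where "m n = nat \<lfloor>t n / c\<rfloor>" for n
  have t0: "\<forall>\<^sub>F n in sequentially. 0 < t n" using t unfolding filterlim_at_top_dense by blast
  have m_lim: "filterlim m at_top sequentially"
  proof -
    have "filterlim (\<lambda>n. (1 / c) * t n) at_top sequentially"
      by (rule filterlim_tendsto_pos_mult_at_top[OF tendsto_const _ t]) (use c in simp)
    then have "filterlim (\<lambda>n. t n / c) at_top sequentially" by simp
    then show ?thesis unfolding m_def
      by (intro filterlim_compose[OF filterlim_nat_sequentially] filterlim_compose[OF filterlim_floor_sequentially])
  qed
  have mt: "(\<lambda>n. real (m n) / t n) \<longlonglongrightarrow> 1 / c"
  proof (rule tendsto_sandwich)
    show "\<forall>\<^sub>F n in sequentially. 1 / c - 1 / t n \<le> real (m n) / t n"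
      using t0
    proof eventually_elim
      case (elim n)
      have "t n / c - 1 \<le> real (m n)" unfolding m_def by linarith
      then have "(t n / c - 1) / t n \<le> real (m n) / t n" using elim by (intro divide_right_mono) auto
      then show ?case using elim by (simp add: diff_divide_distrib)
    qed
    show "\<forall>\<^sub>F n in sequentially. real (m n) / t n \<le> 1 / c"
      using t0
    proof eventually_elim
      case (elim n)
      have "t n / c > 0" using elim c by simp
      then have "real (m n) \<le> t n / c" unfolding m_def by linarith
      then have "real (m n) / t n \<le> (t n / c) / t n" using elim by (intro divide_right_mono) auto
      then show ?case using elim by simp
    qed
    have "(\<lambda>n. 1 / t n) \<longlonglongrightarrow> 0"
      by (intro tendsto_divide_0[OF tendsto_const] filterlim_at_top_imp_at_infinity t)
    from tendsto_diff[OF tendsto_const[of "1 / c"] this]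
    show "(\<lambda>n. 1 / c - 1 / t n) \<longlonglongrightarrow> 1 / c" by simp
  qed (rule tendsto_const)
  define Z where "Z k xs = real_of_int (walkS xs k) / sqrt (real k * vp p)" for k xs
  have [measurable]: "Z k \<in> borel_measurable W" for k unfolding Z_def[abs_def] by measurable
  have rd: "real_distribution (distr W borel (Z k))" for k by simp
  have X: "weak_conv_m (\<lambda>n. distr W borel (\<lambda>xs. s * Z (m n) xs)) (density lborel (normal_density 0 s))"
  proof -
    have "weak_conv_m (\<lambda>k. distr W borel (Z k)) std_normal_distribution"
      using walkS_clt by (simp add: Z_def[abs_def])
    from weak_conv_m_compose[OF this m_lim]
    have "weak_conv_m (\<lambda>n. distr (distr W borel (Z (m n))) borel (\<lambda>x. s * x))
        (distr std_normal_distribution borel (\<lambda>x. s * x))"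
      by (rule weak_conv_m_scale[OF rd real_dist_normal_dist])
    then show ?thesis by (simp add: distr_scale_std_normal[OF s] distr_distr comp_def)
  qed
  have rdN: "real_distribution (density lborel (normal_density 0 s))"
  proof -
    interpret N: real_distribution std_normal_distribution by (rule real_dist_normal_dist)
    show ?thesis unfolding distr_scale_std_normal[OF s, symmetric] by (rule N.real_distribution_distr) simp
  qed
  show ?thesis
    unfolding s_def[symmetric]
  proof (rule W.slutsky[OF _ _ rdN X])
    fix \<epsilon> :: real assume \<epsilon>: "\<epsilon> > 0"
    then have \<epsilon>2: "\<epsilon> / 2 > 0" by simp
    let ?P1 = "\<lambda>n. {xs. \<bar>procX (env z) xs (t n) - \<mu> * real_of_int (walkS xs (m n))\<bar> \<ge> \<epsilon> / 2 * sqrt (t n)}"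
    \<comment> \<open>The mismatch between the two normalisations of the walk at
      \<open>m n\<close>.\<close>
    define w where "w n = \<bar>\<mu> / sqrt (t n) - s / sqrt (real (m n) * vp p)\<bar>" for n
    let ?P2 = "\<lambda>n. {xs. w n * \<bar>real_of_int (walkS xs (m n))\<bar> \<ge> \<epsilon> / 2}"
    let ?P = "\<lambda>n. {xs \<in> space W. \<bar>procX (env z) xs (t n) / sqrt (t n) - s * Z (m n) xs\<bar> \<ge> \<epsilon>}"
    \<comment> \<open>The Chebyshev bound for the walk multiplied by \<open>w n\<close>. It vanishes
      in the limit because m/t tends to 1/c and \<open>s\<close> has the value found in
      \<open>s_eq\<close>.\<close>
    let ?h = "\<lambda>n. (\<mu> * sqrt (vp p * (real (m n) / t n)) - s)\<^sup>2 / (\<epsilon> / 2)\<^sup>2"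
    have P1: "(\<lambda>n. W.prob (?P1 n)) \<longlonglongrightarrow> 0"
      unfolding m_def c_def by (rule procX_approx[OF z mean \<mu> LLN \<epsilon>2 t])
    have "?h \<longlonglongrightarrow> (\<mu> * sqrt (vp p * (1 / c)) - s)\<^sup>2 / (\<epsilon> / 2)\<^sup>2"
      by (intro tendsto_intros mt) (use \<epsilon> in auto)
    then have h: "?h \<longlonglongrightarrow> 0" by (simp add: s_eq)
    have le: "\<forall>\<^sub>F n in sequentially. W.prob (?P n) \<le> W.prob (?P1 n) + ?h n"
      using t0 m_lim[unfolded filterlim_at_top, rule_format, of 1]
    proof eventually_elim
      case (elim n)
      let ?r = "sqrt (t n)" and ?q = "sqrt (real (m n) * vp p)"
      have r: "?r > 0" and q: "?q > 0" using elim vp_pos by auto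
      have w0: "w n \<ge> 0" by (simp add: w_def)
      have P2: "W.prob (?P2 n) \<le> ?h n"
      proof (cases "w n = 0")
        case True
        then have "?P2 n = {}" using \<epsilon> by auto
        then show ?thesis by (simp add: divide_nonneg_nonneg)
      next
        case False
        then have wp: "w n > 0" using w0 by simp
        have "?P2 n = {xs. \<bar>real_of_int (walkS xs (m n))\<bar> \<ge> \<epsilon> / 2 / w n}"
          using wp by (simp add: pos_divide_le_eq mult_ac)
        then have "W.prob (?P2 n) \<le> real (m n) * vp p / (\<epsilon> / 2 / w n)\<^sup>2"
          using walkS_chebyshev[of "\<epsilon> / 2 / w n" "m n"] \<epsilon> wp by simp
        also have "\<dots> = (?q * w n)\<^sup>2 / (\<epsilon> / 2)\<^sup>2"
          using vp_pos by (simp add: power_mult_distrib power_divide)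
        also have "(?q * w n)\<^sup>2 = (?q * (\<mu> / ?r - s / ?q))\<^sup>2"
          by (simp add: w_def power_mult_distrib)
        also have "?q * (\<mu> / ?r - s / ?q) = \<mu> * (?q / ?r) - s"
        proof -
          have "y * (\<mu> / x - s / y) = \<mu> * (y / x) - s" if "y \<noteq> 0" for x y :: real
            using that by (simp add: right_diff_distrib)
          from this[OF less_imp_neq[OF q, symmetric]] show ?thesis .
        qed
        also have "?q / ?r = sqrt (vp p * (real (m n) / t n))"
          by (simp add: real_sqrt_divide[symmetric] mult.commute)
        finally show ?thesis .
      qed
      have sub: "?P n \<subseteq> ?P1 n \<union> ?P2 n"
      proof (rule subsetI, rule ccontr)
        fix xs assume P: "xs \<in> ?P n" and notin: "xs \<notin> ?P1 n \<union> ?P2 n"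
        let ?S = "real_of_int (walkS xs (m n))" and ?Y = "procX (env z) xs (t n)"
        have 1: "\<bar>?Y - \<mu> * ?S\<bar> < \<epsilon> / 2 * ?r" and 2: "w n * \<bar>?S\<bar> < \<epsilon> / 2"
          using notin unfolding Un_iff mem_Collect_eq de_Morgan_disj not_le by blast+
        have "?Y / ?r - s * Z (m n) xs = (?Y - \<mu> * ?S) / ?r + (\<mu> / ?r - s / ?q) * ?S"
          unfolding Z_def by (simp add: diff_divide_distrib left_diff_distrib)
        then have "\<bar>?Y / ?r - s * Z (m n) xs\<bar> \<le> \<bar>?Y - \<mu> * ?S\<bar> / ?r + w n * \<bar>?S\<bar>"
          using abs_triangle_ineq[of "(?Y - \<mu> * ?S) / ?r" "(\<mu> / ?r - s / ?q) * ?S"] r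
          by (simp add: w_def abs_mult abs_divide)
        also have "\<bar>?Y - \<mu> * ?S\<bar> / ?r < \<epsilon> / 2" using 1 r by (simp only: pos_divide_less_eq)
        finally show False using 2 P by simp
      qed
      have meas: "?P1 n \<in> sets W" "?P2 n \<in> sets W" by (rule sets_Collect_W, measurable)+
      have "W.prob (?P n) \<le> W.prob (?P1 n \<union> ?P2 n)"
        using meas by (intro W.finite_measure_mono[OF sub]) auto
      also have "\<dots> \<le> W.prob (?P1 n) + W.prob (?P2 n)" using meas by (rule measure_Un_le)
      finally show ?case using P2 by linarith
    qed
    have lim: "(\<lambda>n. W.prob (?P1 n) + ?h n) \<longlonglongrightarrow> 0" using tendsto_add[OF P1 h] by simp
    show "(\<lambda>n. W.prob (?P n)) \<longlonglongrightarrow> 0"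
      by (rule tendsto_sandwich[OF _ le tendsto_const lim]) simp
  qed measurable
qed

end

section \<open>From fixed environments to almost every environment\<close>

lemma truncated_mean_tendsto:
  fixes D :: "real measure"
  assumes "integrable D (\<lambda>x. x)"
  shows "(\<lambda>M. \<integral>x. min x (real M) \<partial>D) \<longlonglongrightarrow> (\<integral>x. x \<partial>D)"
proof (rule integral_dominated_convergence[where w="\<lambda>x. \<bar>x\<bar>"])
  note [measurable] = borel_measurable_integrable[OF assms]
  show "(\<lambda>x. x) \<in> borel_measurable D" by measurable
  show "(\<lambda>x. min x (real M)) \<in> borel_measurable D" for M by measurable
  show "integrable D (\<lambda>x. \<bar>x\<bar>)" using assms by simp
  show "AE x in D. (\<lambda>M. min x (real M)) \<longlonglongrightarrow> x"
  proof (intro AE_I2)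
    fix x :: real
    obtain N where "x \<le> real N" using real_arch_simple by blast
    then have "min x (real M) = x" if "M \<ge> N" for M using that by (simp add: min_def)
    then show "(\<lambda>M. min x (real M)) \<longlonglongrightarrow> x"
      by (intro tendsto_eventually) (auto simp: eventually_sequentially)
  qed
  show "AE x in D. norm (min x (real M)) \<le> \<bar>x\<bar>" for M by (auto simp: min_def)
qed

text \<open>Convergence as time tends to infinity through the reals is expressed by all sequences of
  times tending to infinity; the quantifier stands inside \<open>AE\<close>, so the exceptional set
  does not depend on the sequence. \<open>normal_density\<close> takes the standard deviation, hence
  the square root.\<close>

theorem theorem2p2:
  fixes D :: "real measure" and p :: "int pmf"
  assumes D_prob: "prob_space D"
    and D_sets: "sets D = sets borel"
    and D_pos: "AE x in D. 0 < x"
    and D_mean: "integrable D (\<lambda>x. x)"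
    and p_sym: "\<And>k. pmf p k = pmf p (- k)"
    and p_mono: "\<And>k. 0 \<le> k \<Longrightarrow> pmf p (k + 1) \<le> pmf p k"
    and p_var: "(\<lambda>k. (real_of_int k)\<^sup>2 * pmf p k) summable_on UNIV"
    and p_var_pos: "0 < vp p"
  shows "AE \<zeta> in (\<Pi>\<^sub>M j\<in>(UNIV::int set). D).
           \<forall>t :: nat \<Rightarrow> real. filterlim t at_top sequentially \<longrightarrow>
             weak_conv_m
               (\<lambda>n. distr (walk_law p) borel (\<lambda>xs. procX (env \<zeta>) xs (t n) / sqrt (t n)))
               (density lborel (normal_density 0
                  (sqrt ((\<integral>x. x \<partial>D) / mbar p * m2 p))))"
proof -
  interpret D: prob_space D by (rule D_prob)
  interpret unimodal_walk p
    by unfold_locales (use p_sym p_mono p_var p_var_pos in \<open>auto simp: sym_unimodal_def\<close>)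
  let ?\<mu> = "\<integral>x. x \<partial>D" and ?\<nu> = "\<lambda>M::nat. \<integral>x. min x (real M) \<partial>D"
  note [measurable] = borel_measurable_integrable[OF D_mean]
  have min_int: "integrable D (\<lambda>x. min x (real M))" for M
    by (intro integrable_min D_mean) simp
  have \<mu>_pos: "?\<mu> > 0"
  proof -
    have nonneg: "AE x in D. 0 \<le> x" using D_pos by eventually_elim simp
    have "?\<mu> \<noteq> 0"
    proof
      assume "?\<mu> = 0"
      then have "AE x in D. x = 0"
        using integral_nonneg_eq_0_iff_AE[OF D_mean nonneg] by simp
      with D_pos have "AE x in D. False" by eventually_elim simp
      then show False by simp
    qed
    moreover have "?\<mu> \<ge> 0" by (rule integral_nonneg_AE[OF nonneg])
    ultimately show ?thesis by simp
  qed
  have \<nu>_le: "?\<nu> M \<le> ?\<mu>" for M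
    by (intro integral_mono min_int D_mean) simp
  have "AE \<zeta> in (\<Pi>\<^sub>M j\<in>(UNIV::int set). D). \<forall>j. 0 < \<zeta> j"
    by (subst AE_all_countable, intro allI AE_PiM_component) (use D_prob D_pos in auto)
  moreover have "AE \<zeta> in (\<Pi>\<^sub>M j\<in>(UNIV::int set). D). has_window_mean \<zeta> ?\<mu>"
    using AE_has_window_mean[OF D_prob D_mean] by simp
  moreover have "AE \<zeta> in (\<Pi>\<^sub>M j\<in>(UNIV::int set). D).
      \<forall>M::nat. has_window_mean (\<lambda>j. min (\<zeta> j) (real M)) (?\<nu> M)"
    by (subst AE_all_countable, intro allI AE_has_window_mean[OF D_prob min_int])
  ultimately show ?thesis
  proof eventually_elim
    case (elim \<zeta>)
    have z: "0 \<le> \<zeta> j" for j using elim(1) by (simp add: less_imp_le)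
    show ?case
      using quenched_clt[OF z elim(2) \<mu>_pos
        tau_LLN[OF z elim(2) elim(3)[rule_format] truncated_mean_tendsto[OF D_mean] \<nu>_le]] by blast
  qed
qed

end
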